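(* Suppose that $\lambda$ and $\mu$ are partitions of $n$ such that \[ \lambda_i = \begin{cases} \mu_i +\gamma & \text{if } i = a, \\ \mu_i -\gamma & \text{if } i = a+1, \\ \mu_i &\text{otherwise},\end{cases}\] for some positive integers $a$ and $\gamma$. If $p=0$, then \[\dim_F(\operatorname{Hom}_{\mathcal H}(S^\lambda,S^\mu)) \geq 1 \quad\text{if } \mu_a -\mu_{a+1} + \gamma \equiv -1 \bmod e \text{ and } \gamma < e.\] If $p>0$, then \[\dim_F(\operatorname{Hom}_{\mathcal H}(S^\lambda,S^\mu)) \geq 1 \quad\text{if } \mu_a -\mu_{a+1} + \gamma \equiv -1 \bmod e p^{\ell_p(\gamma^\ast)}.\]
   Context: $F$ is a field of characteristic $p\ge 0$, $q\in F$ is invertible, $n\ge1$, and $e$ is the least integer $>1$ with $1+q+\dots+q^{e-1}=0$ in $F$; $e$ is assumed to exist (to be finite). For a non-negative integer $b$ write $b=b^\ast e+b'$ with $0\le b'<e$; for $p>0$, $\ell_p(b)$ is the least non-negative integer with $b<p^{\ell_p(b)}$. The symmetric group $\mathfrak S_n$ acts on $\{1,\dots,n\}$ from the right (products are read left to right); $s_i=(i,i+1)$ and $\ell(w)$ is the length of $w$ in the generators $s_i$. $\mathcal H=\mathcal H_{F,q}(\mathfrak S_n)$ is the associative $F$-algebra with basis $\{T_w\mid w\in\mathfrak S_n\}$ and multiplication determined by $T_wT_{s_i}=T_{ws_i}$ if $\ell(ws_i)=\ell(w)+1$ and $T_wT_{s_i}=qT_{ws_i}+(q-1)T_w$ if $\ell(ws_i)=\ell(w)-1$.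 For a composition $\lambda$ of $n$, the diagram of $\lambda$ is $\{(i,j)\mid i\geq 1,\ 1\le j\le\lambda_i\}$; a $\lambda$-tableau is a filling of it by $1,\dots,n$, on which $\mathfrak S_n$ acts from the right by permuting entries. $\mathfrak t^\lambda$ is the $\lambda$-tableau with $1,\dots,n$ entered in order along the rows, $\mathfrak t_\lambda$ the one with $1,\dots,n$ entered in order down the columns; $w_\lambda$ is defined by $\mathfrak t^\lambda w_\lambda=\mathfrak t_\lambda$. $\mathfrak S_\lambda$ is the row stabilizer of $\mathfrak t^\lambda$, $x_\lambda=\sum_{w\in\mathfrak S_\lambda}T_w$, $y_\lambda=\sum_{w\in\mathfrak S_\lambda}(-q)^{-\ell(w)}T_w$. For a partition $\lambda$ with conjugate $\lambda'$, the Specht module is the right $\mathcal H$-module $S^\lambda=x_\lambda T_{w_\lambda}y_{\lambda'}\mathcal H$. *)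

theory Defs
  imports
    Complex_Main
    "HOL-Combinatorics.Permutations"
    "HOL-Number_Theory.Cong"
    "HOL-Library.Function_Algebras"
begin

section \<open>The symmetric group, acting from the right\<close>

text \<open>
  Elements of the symmetric group on \<open>{1..n}\<close> are functions \<open>w :: nat \<Rightarrow> nat\<close> with
  \<open>w permutes {1..n}\<close>; the image of \<open>i\<close> under \<open>w\<close> is \<open>w i\<close>. Products are read from left to right,
  so \<open>u \<cdot> v\<close> is the function applying \<open>u\<close> first.
\<close>

definition pmul :: "(nat \<Rightarrow> nat) \<Rightarrow> (nat \<Rightarrow> nat) \<Rightarrow> nat \<Rightarrow> nat"  (infixl \<open>\<cdot>\<close> 70)
  where "u \<cdot> v = v \<circ> u"

definition simple_refl :: "nat \<Rightarrow> nat \<Rightarrow> nat"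
  where "simple_refl i = transpose i (Suc i)"

definition word_prod :: "nat list \<Rightarrow> nat \<Rightarrow> nat"
  where "word_prod is = foldl (\<lambda>w i. w \<cdot> simple_refl i) id is"

definition perm_length :: "nat \<Rightarrow> (nat \<Rightarrow> nat) \<Rightarrow> nat"
  where "perm_length n w =
    (LEAST k. \<exists>is. length is = k \<and> set is \<subseteq> {1..<n} \<and> word_prod is = w)"


section \<open>Compositions, partitions and tableaux\<close>

text \<open>
  A composition is the function \<open>i \<mapsto> \<lambda>\<^sub>i\<close> with \<open>i \<ge> 1\<close>; the unused value at \<open>0\<close> is fixed to be \<open>0\<close>.
\<close>

definition is_composition :: "nat \<Rightarrow> (nat \<Rightarrow> nat) \<Rightarrow> bool"
  where "is_composition n lam \<longleftrightarrow>
    lam 0 = 0 \<and> finite {i. lam i \<noteq> 0} \<and> (\<Sum>i | lam i \<noteq> 0. lam i) = n"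

definition is_partition :: "nat \<Rightarrow> (nat \<Rightarrow> nat) \<Rightarrow> bool"
  where "is_partition n lam \<longleftrightarrow> is_composition n lam \<and> (\<forall>i\<ge>1. lam (Suc i) \<le> lam i)"

definition diagram :: "(nat \<Rightarrow> nat) \<Rightarrow> (nat \<times> nat) set"
  where "diagram lam = {(i, j). 1 \<le> i \<and> 1 \<le> j \<and> j \<le> lam i}"

definition conjugate :: "(nat \<Rightarrow> nat) \<Rightarrow> nat \<Rightarrow> nat"
  where "conjugate lam j = card {i. (i, j) \<in> diagram lam}"

text \<open>
  A tableau is a map from nodes to entries. The entry of a node in the two initial tableaux is the
  position of that node when the diagram is read along the rows, respectively down the columns.
\<close>

definition row_tableau :: "(nat \<Rightarrow> nat) \<Rightarrow> nat \<times> nat \<Rightarrow> nat"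
  where "row_tableau lam = (\<lambda>(i, j).
    card {(r, c). (r, c) \<in> diagram lam \<and> (r < i \<or> r = i \<and> c \<le> j)})"

definition col_tableau :: "(nat \<Rightarrow> nat) \<Rightarrow> nat \<times> nat \<Rightarrow> nat"
  where "col_tableau lam = (\<lambda>(i, j).
    card {(r, c). (r, c) \<in> diagram lam \<and> (c < j \<or> c = j \<and> r \<le> i)})"

definition tableau_perm :: "nat \<Rightarrow> (nat \<Rightarrow> nat) \<Rightarrow> nat \<Rightarrow> nat"
  where "tableau_perm n lam = (THE w. w permutes {1..n} \<and>
    (\<forall>x\<in>diagram lam. w (row_tableau lam x) = col_tableau lam x))"

definition row_stabilizer :: "nat \<Rightarrow> (nat \<Rightarrow> nat) \<Rightarrow> (nat \<Rightarrow> nat) set"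
  where "row_stabilizer n lam = {w. w permutes {1..n} \<and>
    (\<forall>i. w ` row_tableau lam ` {x \<in> diagram lam. fst x = i}
           = row_tableau lam ` {x \<in> diagram lam. fst x = i})}"


section \<open>The Iwahori-Hecke algebra and its Specht modules\<close>

text \<open>
  The locale says that the ring \<open>'h\<close>, with scalar multiplication \<open>scale\<close>, is the associative unital
  algebra over the field \<open>'f\<close> with basis \<open>T w\<close>, for \<open>w\<close> in the symmetric group on \<open>{1..n}\<close>, and
  the multiplication of the Hecke algebra with parameter \<open>q\<close>. This determines the algebra up to
  isomorphism. The values of \<open>T\<close> outside the symmetric group are irrelevant.
\<close>

locale hecke_algebra = vector_space scale
  for scale :: "'f::field \<Rightarrow> 'h::ring_1 \<Rightarrow> 'h" +
  fixes n :: nat and q :: 'f and T :: "(nat \<Rightarrow> nat) \<Rightarrow> 'h"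
  assumes scale_mult_left: "scale c x * y = scale c (x * y)"
    and scale_mult_right: "x * scale c y = scale c (x * y)"
    and T_inj: "inj_on T {w. w permutes {1..n}}"
    and T_independent: "independent (T ` {w. w permutes {1..n}})"
    and T_span: "span (T ` {w. w permutes {1..n}}) = UNIV"
    and T_id: "T id = 1"
    and T_mult_up: "\<lbrakk>w permutes {1..n}; i \<in> {1..<n};
          perm_length n (w \<cdot> simple_refl i) = perm_length n w + 1\<rbrakk>
        \<Longrightarrow> T w * T (simple_refl i) = T (w \<cdot> simple_refl i)"
    and T_mult_down: "\<lbrakk>w permutes {1..n}; i \<in> {1..<n};
          perm_length n w = perm_length n (w \<cdot> simple_refl i) + 1\<rbrakk>
        \<Longrightarrow> T w * T (simple_refl i) = scale q (T (w \<cdot> simple_refl i)) + scale (q - 1) (T w)"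
begin

definition x_elt :: "(nat \<Rightarrow> nat) \<Rightarrow> 'h"
  where "x_elt lam = (\<Sum>w\<in>row_stabilizer n lam. T w)"

definition y_elt :: "(nat \<Rightarrow> nat) \<Rightarrow> 'h"
  where "y_elt lam =
    (\<Sum>w\<in>row_stabilizer n lam. scale ((- q) powi (- int (perm_length n w))) (T w))"

definition specht :: "(nat \<Rightarrow> nat) \<Rightarrow> 'h set"
  where "specht lam =
    {x_elt lam * T (tableau_perm n lam) * y_elt (conjugate lam) * h | h. True}"

text \<open>
  Homomorphisms of right modules between two right ideals. They are represented by functions on the
  whole algebra that vanish outside the domain, so that each homomorphism has exactly one
  representative and the pointwise operations are those of the Hom space.
\<close>

definition hom_space :: "'h set \<Rightarrow> 'h set \<Rightarrow> ('h \<Rightarrow> 'h) set"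
  where "hom_space M N = {f.
    (\<forall>x\<in>M. f x \<in> N) \<and>
    (\<forall>x\<in>M. \<forall>y\<in>M. f (x + y) = f x + f y) \<and>
    (\<forall>x\<in>M. \<forall>h. f (x * h) = f x * h) \<and>
    (\<forall>x. x \<notin> M \<longrightarrow> f x = 0)}"

definition fun_scale :: "'f \<Rightarrow> ('h \<Rightarrow> 'h) \<Rightarrow> 'h \<Rightarrow> 'h"
  where "fun_scale c f = (\<lambda>x. scale c (f x))"

lemma vector_space_fun_scale: "vector_space fun_scale"
  by unfold_locales
    (auto simp: fun_scale_def fun_eq_iff scale_right_distrib scale_left_distrib)

lemma zero_in_specht: "0 \<in> specht lam"
  unfolding specht_def by (metis (mono_tags, lifting) mem_Collect_eq mult_zero_right)

lemma specht_add: "x \<in> specht lam \<Longrightarrow> y \<in> specht lam \<Longrightarrow> x + y \<in> specht lam"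
  unfolding specht_def by (auto simp flip: distrib_left)

lemma specht_mult: "x \<in> specht lam \<Longrightarrow> x * h \<in> specht lam"
  unfolding specht_def by (auto simp: mult.assoc)

lemma specht_scale: "x \<in> specht lam \<Longrightarrow> scale c x \<in> specht lam"
  using specht_mult[of x lam "scale c 1"] by (simp add: scale_mult_right)

lemma hom_space_scale:
  assumes "f \<in> hom_space M N" "x \<in> M"
  shows "f (scale c x) = scale c (f x)"
proof -
  have "f (x * scale c 1) = f x * scale c 1"
    using assms unfolding hom_space_def by blast
  then show ?thesis by (simp add: scale_mult_right)
qed

lemma hom_space_specht_subspace:
  "module.subspace fun_scale (hom_space (specht lam) (specht mu))"
proof -
  interpret F: vector_space fun_scale by (rule vector_space_fun_scale)
  show ?thesis
    by (rule F.subspaceI)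
      (auto simp: hom_space_def fun_scale_def scale_mult_left scale_right_distrib
        distrib_right add_ac zero_in_specht specht_add specht_scale)
qed

definition hom_dim :: "'h set \<Rightarrow> 'h set \<Rightarrow> nat"
  where "hom_dim M N = vector_space.dim fun_scale (hom_space M N)"

end


section \<open>The numerical invariants\<close>

definition is_quantum_char :: "'f::field \<Rightarrow> nat \<Rightarrow> bool"
  where "is_quantum_char q e \<longleftrightarrow> 1 < e \<and> (\<Sum>i<e. q ^ i) = 0 \<and>
    (\<forall>d. 1 < d \<and> d < e \<longrightarrow> (\<Sum>i<d. q ^ i) \<noteq> 0)"

definition ell_p :: "nat \<Rightarrow> nat \<Rightarrow> nat"
  where "ell_p p b = (LEAST k. b < p ^ k)"

end

theory Submission
  imports Defs "HOL-Computational_Algebra.Polynomial" "HOL-Computational_Algebra.Primes"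
begin

text \<open>
The proof takes place in spaces of words. The right ideal \<open>x\<^sub>\<mu>H\<close> has a basis indexed by the words
of length \<open>n\<close> in which each letter \<open>r\<close> occurs \<open>\<mu>\<^sub>r\<close> times: a row standard tableau becomes the word
whose \<open>k\<close>-th letter is the row of the entry \<open>k\<close>. On vectors, i.e. functions on words, \<open>T\<close> of a simple
reflection acts by exchanging neighbouring letters, with the usual quadratic correction (\<open>act\<close>).
Quantum \<open>gl\<close> acts from the other side: its divided powers \<open>move\<close> turn a number of letters into a
neighbouring letter, and they commute with the Hecke algebra (\<open>move_act\<close>). The generator of the
Specht module is the \<open>polytabloid\<close>, a product of \<open>q\<close>-antisymmetrised columns.

Let \<open>E\<close> be the divided power that turns \<open>\<gamma>\<close> letters \<open>a\<close> into \<open>a + 1\<close>, and let \<open>v\<close> be the image under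
\<open>E\<close> of the polytabloid of \<open>\<lambda>\<close>. As \<open>E\<close> commutes with the Hecke algebra, everything that annihilates
the generator of \<open>S\<^sup>\<lambda>\<close> annihilates \<open>v\<close>, so that \<open>z\<^sub>\<lambda>h \<mapsto> vh\<close> is a well defined homomorphism. It is
nonzero because \<open>v \<noteq> 0\<close>, and what has to be shown is that \<open>v\<close> lies in \<open>S\<^sup>\<mu>\<close>.

This follows from one half of the kernel intersection theorem (\<open>highest_in_specht\<close>): a vector of
content \<open>\<mu>\<close> that is killed by all divided powers raising letters \<open>b + 1\<close> to \<open>b\<close> lies in \<open>S\<^sup>\<mu>\<close>. Its
proof is an elimination of leading words. On one side, the last word in the support of such a vector
is a ballot word, i.e. comes from a standard tableau (\<open>highest_max_ballot\<close>); the reason is that there are no highest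
weight vectors of negative weight, in the form of \<open>negative_weight_vanish\<close>. On the other side, every
ballot word is the leading word of an element of \<open>S\<^sup>\<mu>\<close>, obtained from the polytabloid by a product
of elements \<open>T\<close> of simple reflections (\<open>ballot_leading\<close>).

Finally \<open>v\<close> is killed by all raising operators (\<open>shifted_highest\<close>). Its images are alternating on
the columns of \<open>\<lambda>\<close>, and a nonzero vector of this kind has a content that \<open>\<lambda>\<close> dominates. This settles
all raising operators except those that turn letters \<open>a + 1\<close> back into \<open>a\<close>, and the image under
the \<open>k\<close>-th divided power of these, \<open>1 \<le> k \<le> \<gamma>\<close>, is governed by one scalar: the Gaussian
binomial coefficient of \<open>m + k\<close> over \<open>k\<close> with \<open>m = \<mu>\<^sub>a - \<mu>\<^sub>a\<^sub>+\<^sub>1 + \<gamma>\<close>. The congruence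
makes these vanish (\<open>gauss_sum_eq_0\<close>): in the product of the \<open>1 + q\<^sup>ix\<close> over a whole
number of periods \<open>eP\<close>, where \<open>P\<close> is a power of the characteristic, or 1, with
\<open>\<gamma> < eP\<close>, only powers of \<open>x\<^sup>e\<^sup>P\<close> survive.
\<close>

section \<open>Sums over subsets weighted by crossings, and Gaussian binomial coefficients\<close>

definition ksubsets :: "'a set \<Rightarrow> nat \<Rightarrow> 'a set set"
  where "ksubsets A k = {B. B \<subseteq> A \<and> card B = k}"

definition crossings :: "nat set \<Rightarrow> nat set \<Rightarrow> nat"
  where "crossings B A = card {(i, j). i \<in> B \<and> j \<in> A \<and> i < j}"

lemma finite_ksubsets [simp]: "finite A \<Longrightarrow> finite (ksubsets A k)"
  unfolding ksubsets_def by simp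

lemma ksubsets_0 [simp]: "finite A \<Longrightarrow> ksubsets A 0 = {{}}"
  unfolding ksubsets_def using finite_subset by fastforce

lemma ksubsets_empty_Suc [simp]: "ksubsets {} (Suc k) = {}"
  unfolding ksubsets_def by auto

lemma sum_ksubsets_insert:
  fixes f :: "'a set \<Rightarrow> 'b::comm_monoid_add"
  assumes A: "finite A" and x: "x \<notin> A"
  shows "(\<Sum>B\<in>ksubsets (insert x A) (Suc k). f B)
    = (\<Sum>B\<in>ksubsets A (Suc k). f B) + (\<Sum>B\<in>ksubsets A k. f (insert x B))"
proof -
  have eq: "ksubsets (insert x A) (Suc k) = ksubsets A (Suc k) \<union> insert x ` ksubsets A k"
    (is "?L = ?R")
  proof
    show "?L \<subseteq> ?R"
    proof
      fix B assume "B \<in> ?L"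
      then have B: "B \<subseteq> insert x A" "card B = Suc k" by (auto simp: ksubsets_def)
      show "B \<in> ?R"
      proof (cases "x \<in> B")
        case True
        then have "B = insert x (B - {x})" by auto
        moreover have "B - {x} \<in> ksubsets A k" using B True by (auto simp: ksubsets_def)
        ultimately show ?thesis by blast
      next
        case False
        then show ?thesis using B by (auto simp: ksubsets_def)
      qed
    qed
    show "?R \<subseteq> ?L"
    proof
      fix B assume "B \<in> ?R"
      then show "B \<in> ?L"
      proof
        assume "B \<in> insert x ` ksubsets A k"
        then obtain C where C: "B = insert x C" "C \<subseteq> A" "card C = k" by (auto simp: ksubsets_def)
        then have "finite C" "x \<notin> C" using A x finite_subset by auto
        then show ?thesis using C by (auto simp: ksubsets_def)
      qed (auto simp: ksubsets_def)
    qed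
  qed
  have inj: "inj_on (insert x) (ksubsets A k)"
    using x by (auto simp: inj_on_def ksubsets_def dest: insert_ident[THEN iffD1, rotated 2])
  have disj: "ksubsets A (Suc k) \<inter> insert x ` ksubsets A k = {}"
    using x by (auto simp: ksubsets_def)
  show ?thesis
    unfolding eq using A disj inj by (simp add: sum.union_disjoint sum.reindex)
qed

lemma crossings_insert_small_right:
  assumes "\<forall>i\<in>B. x < i"
  shows "crossings B (insert x A) = crossings B A"
  unfolding crossings_def using assms by (intro arg_cong[where f = card]) force

lemma crossings_insert_small_left:
  assumes "finite A" "finite B" "x \<notin> B" "\<forall>j\<in>A. x < j"
  shows "crossings (insert x B) A = card A + crossings B A"
proof -
  have eq: "{(i, j). i \<in> insert x B \<and> j \<in> A \<and> i < j}
      = Pair x ` A \<union> {(i, j). i \<in> B \<and> j \<in> A \<and> i < j}"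
    using assms(4) by auto
  have fin: "finite {(i, j). i \<in> B \<and> j \<in> A \<and> i < j}"
    by (rule finite_subset[of _ "B \<times> A"]) (use assms in auto)
  show ?thesis
    unfolding crossings_def eq using assms fin
    by (subst card_Un_disjoint) (auto simp: card_image inj_on_def)
qed

lemma crossings_empty_left [simp]: "crossings {} A = 0"
  by (simp add: crossings_def)

text \<open>
For \<open>f = 1\<close> and \<open>|A| = N\<close> this is the Gaussian binomial coefficient of \<open>N\<close> over \<open>k\<close>; for general \<open>f\<close> it
is the action of a divided power on words in two letters, where \<open>B\<close> is the set of positions that
change their letter.
\<close>

definition crossing_sum :: "'f::field \<Rightarrow> nat set \<Rightarrow> nat \<Rightarrow> (nat set \<Rightarrow> 'f) \<Rightarrow> 'f"
  where "crossing_sum q A k f = (\<Sum>B\<in>ksubsets A k. q ^ crossings B (A - B) * f B)"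

lemma crossing_sum_0 [simp]: "finite A \<Longrightarrow> crossing_sum q A 0 f = f {}"
  by (simp add: crossing_sum_def)

lemma crossing_sum_cong:
  "(\<And>B. B \<in> ksubsets A k \<Longrightarrow> f B = g B) \<Longrightarrow> crossing_sum q A k f = crossing_sum q A k g"
  by (simp add: crossing_sum_def)

text \<open>
The Pascal recursion, splitting the subsets according to whether they contain the new smallest
element. It drives the inductions for the \<open>q\<close>-binomial theorem and for \<open>negative_weight_vanish\<close>.
\<close>

lemma crossing_sum_insert:
  assumes A: "finite A" and x: "\<forall>j\<in>A. x < j"
  shows "crossing_sum q (insert x A) (Suc k) f
    = crossing_sum q A (Suc k) f + q ^ (card A - k) * crossing_sum q A k (\<lambda>B. f (insert x B))"
proof -
  have xA: "x \<notin> A" using x by auto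
  have 1: "crossings B (insert x A - B) = crossings B (A - B)" if "B \<in> ksubsets A (Suc k)" for B
  proof -
    have "insert x A - B = insert x (A - B)" using that xA by (auto simp: ksubsets_def)
    moreover have "\<forall>i\<in>B. x < i" using that x by (auto simp: ksubsets_def)
    ultimately show ?thesis by (simp add: crossings_insert_small_right)
  qed
  have 2: "crossings (insert x B) (insert x A - insert x B) = card A - k + crossings B (A - B)"
    if "B \<in> ksubsets A k" for B
  proof -
    have B: "B \<subseteq> A" "card B = k" "finite B" using that A finite_subset by (auto simp: ksubsets_def)
    have "insert x A - insert x B = A - B" using xA B by auto
    moreover have "card (A - B) = card A - k" using B A by (simp add: card_Diff_subset)
    moreover have "x \<notin> B" using B xA by auto
    ultimately show ?thesis
      using crossings_insert_small_left[of "A - B" B x] B A x by auto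
  qed
  have "(\<Sum>B\<in>ksubsets A k. q ^ crossings (insert x B) (insert x A - insert x B) * f (insert x B))
      = q ^ (card A - k) * crossing_sum q A k (\<lambda>B. f (insert x B))"
    unfolding crossing_sum_def sum_distrib_left
    by (intro sum.cong refl) (simp only: 2 power_add mult.assoc)
  moreover have "(\<Sum>B\<in>ksubsets A (Suc k). q ^ crossings B (insert x A - B) * f B)
      = crossing_sum q A (Suc k) f"
    unfolding crossing_sum_def by (intro sum.cong refl) (simp only: 1)
  ultimately show ?thesis
    unfolding crossing_sum_def[of q "insert x A"] sum_ksubsets_insert[OF A xA] by (simp only:)
qed

lemma crossings_Un_large:
  assumes "finite A" "finite B" "finite S" "A \<inter> S = {}" "\<forall>i\<in>B. \<forall>s\<in>S. i < s"
  shows "crossings B (A \<union> S) = crossings B A + card B * card S"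
proof -
  have eq: "{(i, j). i \<in> B \<and> j \<in> A \<union> S \<and> i < j}
      = {(i, j). i \<in> B \<and> j \<in> A \<and> i < j} \<union> B \<times> S"
    using assms(5) by auto
  have fin: "finite {(i, j). i \<in> B \<and> j \<in> A \<and> i < j}"
    by (rule finite_subset[of _ "B \<times> A"]) (use assms in auto)
  show ?thesis
    unfolding crossings_def eq using assms fin
    by (subst card_Un_disjoint) (auto simp: card_cartesian_product)
qed

lemma crossing_sum_Un_large:
  assumes A: "finite A" and S: "finite S" and less: "\<forall>i\<in>A. \<forall>s\<in>S. i < s"
    and zero: "\<And>B. B \<in> ksubsets (A \<union> S) k \<Longrightarrow> \<not> B \<subseteq> A \<Longrightarrow> f B = 0"
  shows "crossing_sum q (A \<union> S) k f = q ^ (k * card S) * crossing_sum q A k f"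
proof -
  have "crossing_sum q (A \<union> S) k f
      = (\<Sum>B\<in>ksubsets A k. q ^ crossings B (A \<union> S - B) * f B)"
    unfolding crossing_sum_def
    by (rule sum.mono_neutral_right) (use A S zero in \<open>auto simp: ksubsets_def\<close>)
  also have "\<dots> = (\<Sum>B\<in>ksubsets A k. q ^ (k * card S) * (q ^ crossings B (A - B) * f B))"
  proof (intro sum.cong refl)
    fix B assume "B \<in> ksubsets A k"
    then have B: "B \<subseteq> A" "card B = k" "finite B" using A finite_subset by (auto simp: ksubsets_def)
    then have "A \<union> S - B = (A - B) \<union> S" using less by auto
    then have "crossings B (A \<union> S - B) = crossings B (A - B) + k * card S"
      using crossings_Un_large[of "A - B" B S] A S B less by force
    then show "q ^ crossings B (A \<union> S - B) * f B = q ^ (k * card S) * (q ^ crossings B (A - B) * f B)"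
      by (simp add: power_add)
  qed
  finally show ?thesis by (simp add: crossing_sum_def sum_distrib_left)
qed

lemma crossing_sum_Un_small:
  assumes A: "finite A" and S: "finite S" and less: "\<forall>i\<in>A. \<forall>s\<in>S. s < i"
    and zero: "\<And>B. B \<in> ksubsets (A \<union> S) k \<Longrightarrow> \<not> B \<subseteq> A \<Longrightarrow> f B = 0"
  shows "crossing_sum q (A \<union> S) k f = crossing_sum q A k f"
proof -
  have "crossing_sum q (A \<union> S) k f
      = (\<Sum>B\<in>ksubsets A k. q ^ crossings B (A \<union> S - B) * f B)"
    unfolding crossing_sum_def
    by (rule sum.mono_neutral_right) (use A S zero in \<open>auto simp: ksubsets_def\<close>)
  also have "\<dots> = crossing_sum q A k f"
    unfolding crossing_sum_def
  proof (intro sum.cong refl)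
    fix B assume "B \<in> ksubsets A k"
    then have "{(i, j). i \<in> B \<and> j \<in> A \<union> S - B \<and> i < j} = {(i, j). i \<in> B \<and> j \<in> A - B \<and> i < j}"
      using less by (auto simp: ksubsets_def dest: less_asym)
    then show "q ^ crossings B (A \<union> S - B) * f B = q ^ crossings B (A - B) * f B"
      by (simp add: crossings_def)
  qed
  finally show ?thesis .
qed

text \<open>
Read subsets \<open>Y\<close> of \<open>P\<close> with \<open>j\<close> elements as words in two letters. The hypothesis says that \<open>f\<close> is
killed by all divided powers of order \<open>k \<ge> r\<close> of the raising operator, and the weight of \<open>f\<close> is
\<open>card P - 2 * j \<le> - r\<close>. For \<open>sl\<^sub>2\<close> in characteristic 0 the claim holds because the \<open>s\<close>-th power of the
raising operator is injective on the weight space \<open>-s\<close>. The induction below on the first letter of the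
word works for every \<open>q \<noteq> 0\<close>; the parameter \<open>r\<close> has to vary in it, since splitting off the
letter raises \<open>r\<close> for one half of the words and lowers it for the other.
\<close>

lemma negative_weight_vanish:
  fixes f :: "nat set \<Rightarrow> 'f::field"
  assumes q: "q \<noteq> 0" and P: "finite P" and weight: "r + card P \<le> 2 * j"
    and ker: "\<And>k X. r \<le> k \<Longrightarrow> X \<subseteq> P \<Longrightarrow> card X + k = j
      \<Longrightarrow> crossing_sum q (P - X) k (\<lambda>B. f (X \<union> B)) = 0"
    and Y: "Y \<in> ksubsets P j"
  shows "f Y = 0"
  using P weight ker Y
proof (induction P arbitrary: r j f Y rule: finite_linorder_min_induct)
  case empty
  then show ?case using empty.prems(2)[of 0 "{}"] by (auto simp: ksubsets_def)
next
  case (insert x P)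
  have xP: "x \<notin> P" using insert.hyps by auto
  have card_xP: "card (insert x P) = Suc (card P)" using insert.hyps xP by simp
  have Y: "Y \<subseteq> insert x P" "card Y = j" using insert.prems(3) by (auto simp: ksubsets_def)
  show ?case
  proof (cases r)
    case 0
    then show ?thesis
      using insert.prems(2)[of 0 Y] insert.hyps(1) Y by simp
  next
    case (Suc r')
    then obtain j' where j: "j = Suc j'" using insert.prems(1) by (cases j) auto
    have with_x: "crossing_sum q (P - X) k (\<lambda>B. f (insert x (X \<union> B))) = 0"
      if "r \<le> k" "X \<subseteq> P" "card X + k = j'" for k X
    proof -
      have "finite X" "x \<notin> X" using that insert.hyps(1) xP finite_subset by auto
      moreover have "insert x P - insert x X = P - X" using xP that by auto
      ultimately show ?thesis
        using insert.prems(2)[of k "insert x X"] that j by auto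
    qed
    have split: "crossing_sum q (P - X) (Suc k) (\<lambda>B. f (X \<union> B))
        + q ^ (card (P - X) - k) * crossing_sum q (P - X) k (\<lambda>B. f (insert x (X \<union> B))) = 0"
      if "r' \<le> k" "X \<subseteq> P" "card X + k = j'" for k X
    proof -
      have "insert x P - X = insert x (P - X)" using xP that by auto
      moreover have "\<forall>y\<in>P - X. x < y" using insert.hyps by auto
      ultimately show ?thesis
        using insert.prems(2)[of "Suc k" X] that j Suc insert.hyps(1)
        by (simp add: crossing_sum_insert subset_insertI2)
    qed
    \<comment> \<open>The half whose words do not have the new letter at \<open>x\<close> is killed by the powers of order at least \<open>r + 1\<close>, by \<open>split\<close> and \<open>with_x\<close>.\<close>
    have without: "f Z = 0" if "Z \<in> ksubsets P j" for Z
    proof (rule insert.IH[of "Suc r" j f Z])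
      show "Suc r + card P \<le> 2 * j" using insert.prems(1) card_xP by simp
      fix k X assume k: "Suc r \<le> k" "X \<subseteq> P" "card X + k = j"
      then obtain k' where "k = Suc k'" by (cases k) auto
      then show "crossing_sum q (P - X) k (\<lambda>B. f (X \<union> B)) = 0"
        using split[of k' X] with_x[of k' X] k j Suc by simp
    qed (rule that)
    \<comment> \<open>Once that half is known to vanish, \<open>split\<close> shows that the other half is killed already from order \<open>r' = r - 1\<close> on.\<close>
    have "f (insert x Z) = 0" if "Z \<in> ksubsets P j'" for Z
    proof (rule insert.IH[of r' j' "\<lambda>Z. f (insert x Z)" Z])
      show "r' + card P \<le> 2 * j'" using insert.prems(1) card_xP Suc j by simp
      fix k X assume k: "r' \<le> k" "X \<subseteq> P" "card X + k = j'"
      have "crossing_sum q (P - X) (Suc k) (\<lambda>B. f (X \<union> B)) = crossing_sum q (P - X) (Suc k) (\<lambda>B. 0)"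
      proof (rule crossing_sum_cong)
        fix B assume "B \<in> ksubsets (P - X) (Suc k)"
        then have "B \<subseteq> P - X" "card B = Suc k" by (auto simp: ksubsets_def)
        moreover from this have "finite B" by (simp add: card_ge_0_finite)
        moreover have "finite X" using insert.hyps(1) k finite_subset by auto
        moreover have "X \<inter> B = {}" using \<open>B \<subseteq> P - X\<close> by auto
        ultimately have "X \<union> B \<in> ksubsets P j"
          using k j by (auto simp: ksubsets_def card_Un_disjoint)
        then show "f (X \<union> B) = 0" by (rule without)
      qed
      then show "crossing_sum q (P - X) k (\<lambda>B. f (insert x (X \<union> B))) = 0"
        using split[OF k] q by (simp add: crossing_sum_def)
    qed (rule that)
    moreover have "Y = insert x (Y - {x})" "Y - {x} \<in> ksubsets P j'" if "x \<in> Y"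
      using that Y j by (auto simp: ksubsets_def)
    moreover have "Y \<in> ksubsets P j" if "x \<notin> Y" using that Y by (auto simp: ksubsets_def)
    ultimately show ?thesis using without by metis
  qed
qed

abbreviation gauss_sum :: "'f::field \<Rightarrow> nat set \<Rightarrow> nat \<Rightarrow> 'f"
  where "gauss_sum q Q k \<equiv> crossing_sum q Q k (\<lambda>_. 1)"

text \<open>
The \<open>q\<close>-binomial theorem says that the coefficients of this polynomial are Gaussian binomial
coefficients up to powers of \<open>q\<close>. Vanishing is easier to read off here, because the product is
compatible with periods of \<open>q\<close> and with the Frobenius map.
\<close>

definition gauss_poly :: "'f::field \<Rightarrow> nat \<Rightarrow> 'f poly"
  where "gauss_poly q N = (\<Prod>i<N. [:1, q ^ i:])"

lemma gauss_poly_Suc: "gauss_poly q (Suc N) = gauss_poly q N * [:1, q ^ N:]"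
  by (simp add: gauss_poly_def mult.commute)

lemma coeff_gauss_poly_Suc:
  "coeff (gauss_poly q (Suc N)) 0 = coeff (gauss_poly q N) 0"
  "coeff (gauss_poly q (Suc N)) (Suc k)
    = coeff (gauss_poly q N) (Suc k) + q ^ N * coeff (gauss_poly q N) k"
  by (simp_all add: gauss_poly_Suc)

lemma degree_gauss_poly: "degree (gauss_poly q N) \<le> N"
proof (induction N)
  case (Suc N)
  have "degree [:1, q ^ N:] \<le> 1" by simp
  then show ?case
    unfolding gauss_poly_Suc using Suc degree_mult_le[of "gauss_poly q N" "[:1, q ^ N:]"]
    by linarith
qed (simp add: gauss_poly_def)

lemma coeff_gauss_poly_0 [simp]: "coeff (gauss_poly q N) 0 = 1"
  by (induction N) (simp_all add: coeff_gauss_poly_Suc(1), simp add: gauss_poly_def)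

lemma coeff_gauss_poly_gt: "N < k \<Longrightarrow> coeff (gauss_poly q N) k = 0"
  using degree_gauss_poly[of q N] by (simp add: coeff_eq_0)

lemma gauss_sum_gt: "finite Q \<Longrightarrow> card Q < k \<Longrightarrow> gauss_sum q Q k = 0"
  unfolding crossing_sum_def ksubsets_def
  by (rule sum.neutral) (auto dest: card_mono)

lemma coeff_gauss_poly:
  assumes "finite Q"
  shows "coeff (gauss_poly q (card Q)) k = q ^ (k choose 2) * gauss_sum q Q k"
  using assms
proof (induction Q arbitrary: k rule: finite_linorder_min_induct)
  case empty
  then show ?case
    by (cases k) (auto simp: gauss_poly_def crossing_sum_def coeff_eq_0 numeral_2_eq_2)
next
  case (insert x Q)
  have xQ: "x \<notin> Q" using insert by auto
  show ?case
  proof (cases k)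
    case 0
    then show ?thesis using insert by (simp add: numeral_2_eq_2)
  next
    case (Suc j)
    show ?thesis
    proof (cases "j \<le> card Q")
      case True
      have "Suc j choose 2 = (j choose 2) + j"
        by (simp add: numeral_2_eq_2)
      then have "(Suc j choose 2) + (card Q - j) = card Q + (j choose 2)"
        using True by simp
      then have "q ^ (Suc j choose 2) * q ^ (card Q - j) = q ^ card Q * q ^ (j choose 2)"
        by (metis power_add)
      then have *: "q ^ (Suc j choose 2) * (q ^ (card Q - j) * gauss_sum q Q j)
          = q ^ card Q * (q ^ (j choose 2) * gauss_sum q Q j)"
        by (simp only: mult.assoc[symmetric])
      have "coeff (gauss_poly q (card (insert x Q))) k
          = q ^ (Suc j choose 2) * gauss_sum q Q (Suc j) + q ^ card Q * (q ^ (j choose 2) * gauss_sum q Q j)"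
        using insert xQ Suc by (simp add: coeff_gauss_poly_Suc)
      also have "\<dots> = q ^ (Suc j choose 2) * gauss_sum q (insert x Q) (Suc j)"
        using insert True by (simp add: crossing_sum_insert distrib_left flip: *)
      finally show ?thesis using Suc by simp
    next
      case False
      then show ?thesis
        using insert xQ Suc by (simp add: coeff_gauss_poly_gt gauss_sum_gt)
    qed
  qed
qed

text \<open>
The ratio of consecutive Gaussian binomial coefficients, with denominators cleared: the quantum
integers that would be divided by may be 0.
\<close>

lemma coeff_gauss_poly_ratio:
  assumes "k \<le> N"
  shows "(\<Sum>i<Suc k. q ^ i) * coeff (gauss_poly q N) (Suc k)
    = q ^ k * (\<Sum>i<N - k. q ^ i) * coeff (gauss_poly q N) k"
  using assms
proof (induction N arbitrary: k)
  case 0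
  then show ?case by (simp add: coeff_gauss_poly_gt)
next
  case (Suc N)
  let ?c = "\<lambda>k. coeff (gauss_poly q N) k"
  let ?b = "\<lambda>k. \<Sum>i<k. q ^ i"
  have bSuc: "?b (Suc j) = 1 + q * ?b j" for j
    by (subst sum.lessThan_Suc_shift) (simp add: sum_distrib_left)
  show ?case
  proof (cases "k \<le> N")
    case False
    then have "k = Suc N" using Suc.prems by simp
    then show ?thesis by (simp add: coeff_gauss_poly_gt)
  next
    case True
    have IH: "?b (Suc k) * ?c (Suc k) = q ^ k * ?b (N - k) * ?c k"
      using Suc.IH[OF True] .
    have b1: "?b (Suc N - k) = ?b (N - k) + q ^ (N - k)"
      using True by (simp add: Suc_diff_le)
    have qq: "q ^ k * q ^ (N - k) = q ^ N" using True by (metis le_add_diff_inverse power_add)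
    show ?thesis
    proof (cases k)
      case 0
      then show ?thesis using IH b1 qq bSuc[of 0] by (simp add: coeff_gauss_poly_Suc)
    next
      case (Suc j)
      have IH': "?b k * ?c k = q ^ j * ?b (Suc N - k) * ?c j"
        using Suc.IH[of j] True Suc by simp
      have cN: "coeff (gauss_poly q (Suc N)) (Suc k) = ?c (Suc k) + q ^ N * ?c k"
        "coeff (gauss_poly q (Suc N)) k = ?c k + q ^ N * ?c j"
        by (simp_all add: coeff_gauss_poly_Suc Suc)
      have "q ^ k * ?b (Suc N - k) * (?c k + q ^ N * ?c j)
          = q ^ k * ?b (N - k) * ?c k + (q ^ k * q ^ (N - k)) * ?c k
            + q * q ^ N * (q ^ j * ?b (Suc N - k) * ?c j)"
        unfolding b1 by (simp add: algebra_simps Suc)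
      also have "\<dots> = ?b (Suc k) * ?c (Suc k) + q ^ N * ?c k + q * q ^ N * (?b k * ?c k)"
        by (simp only: IH IH' qq)
      also have "\<dots> = ?b (Suc k) * ?c (Suc k) + ?b (Suc k) * (q ^ N * ?c k)"
        unfolding bSuc by (simp add: algebra_simps)
      finally show ?thesis unfolding cN by (simp only: distrib_left)
    qed
  qed
qed

lemma quantum_char_sum_nonzero:
  assumes "is_quantum_char q e" "0 < k" "k < e"
  shows "(\<Sum>i<k. q ^ i) \<noteq> 0"
  using assms by (cases "k = 1") (auto simp: is_quantum_char_def)

lemma quantum_char_power:
  assumes "is_quantum_char q e"
  shows "q ^ e = 1"
  using assms power_diff_1_eq[of q e] by (simp add: is_quantum_char_def)

text \<open>
Take \<open>N = e\<close> in \<open>coeff_gauss_poly_ratio\<close>. The quantum integer of \<open>e\<close> is 0 and kills the coefficient 1;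
from there on the vanishing propagates, since the quantum integers below \<open>e\<close> are nonzero.
\<close>

lemma gauss_poly_quantum_char:
  assumes e: "is_quantum_char q e"
  shows "gauss_poly q e = 1 + monom (coeff (gauss_poly q e) e) e"
proof -
  have z: "coeff (gauss_poly q e) (Suc k) = 0" if "Suc k < e" for k
    using that
  proof (induction k)
    case 0
    then show ?case
      using coeff_gauss_poly_ratio[of 0 e q] e by (simp add: is_quantum_char_def)
  next
    case (Suc k)
    then show ?case
      using coeff_gauss_poly_ratio[of "Suc k" e q] quantum_char_sum_nonzero[OF e, of "Suc (Suc k)"]
      by simp
  qed
  have "e > 0" using e by (simp add: is_quantum_char_def)
  show ?thesis
  proof (rule poly_eqI)
    fix k
    consider "k = 0" | j where "k = Suc j" "k < e" | "k = e" | "k > e"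
      by (metis linorder_neqE_nat not0_implies_Suc)
    then show "coeff (gauss_poly q e) k = coeff (1 + monom (coeff (gauss_poly q e) e) e) k"
      by cases (use z \<open>e > 0\<close> in \<open>auto simp: coeff_gauss_poly_gt\<close>)
  qed
qed

lemma gauss_poly_add:
  assumes "q ^ e = 1"
  shows "gauss_poly q (e + N) = gauss_poly q e * gauss_poly q N"
proof (induction N)
  case (Suc N)
  then show ?case using assms by (simp add: gauss_poly_Suc power_add mult.assoc del: mult_pCons_right)
qed (simp add: gauss_poly_def)

lemma gauss_poly_mult:
  assumes "q ^ e = 1"
  shows "gauss_poly q (e * t + N) = gauss_poly q e ^ t * gauss_poly q N"
  by (induction t) (simp_all add: gauss_poly_add[OF assms] add.assoc mult.assoc)

lemma one_plus_monom_power_char: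
  assumes "P = 1 \<or> prime CHAR('f) \<and> P = CHAR('f::field) ^ s"
  shows "(1 + monom (c::'f) e) ^ P = 1 + monom (c ^ P) (e * P)"
proof (cases "P = 1")
  case False
  then have "prime CHAR('f poly)" "P = CHAR('f poly) ^ s" using assms by simp_all
  then show ?thesis by (simp add: freshmans_dream' monom_power mult.commute)
qed simp

text \<open>
Write \<open>m + k\<close> as a multiple of \<open>e * P\<close> plus \<open>k - 1\<close>. The periods contribute a polynomial in
\<open>x\<^sup>e\<^sup>P\<close>, whose only term of degree at most \<open>k < e * P\<close> is the constant one, and the remaining
factor has degree at most \<open>k - 1\<close>. Hence nothing is left in degree \<open>k\<close>.
\<close>

lemma gauss_sum_eq_0:
  fixes q :: "'f::field"
  assumes e: "is_quantum_char q e" and q: "q \<noteq> 0"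
    and P: "P = 1 \<or> prime CHAR('f) \<and> P = CHAR('f) ^ s"
    and dvd: "e * P dvd m + 1" and k: "0 < k" "k < e * P"
    and Q: "finite Q" "card Q = m + k"
  shows "gauss_sum q Q k = 0"
proof -
  obtain t where t: "m + 1 = e * P * t" using dvd by (auto elim: dvdE)
  then have N: "m + k = e * (P * t) + (k - 1)" using k by (simp add: mult.assoc)
  obtain d where d: "gauss_poly q e ^ P = 1 + monom d (e * P)"
    using gauss_poly_quantum_char[OF e] one_plus_monom_power_char[OF P] by metis
  have dv: "monom 1 (e * P) dvd (1 + monom d (e * P)) ^ t - 1"
  proof (induction t)
    case (Suc t)
    have "(1 + monom d (e * P)) ^ Suc t - 1
        = ((1 + monom d (e * P)) ^ t - 1) + monom 1 (e * P) * ([:d:] * (1 + monom d (e * P)) ^ t)"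
      by (simp add: algebra_simps smult_monom flip: mult_smult_left)
    then show ?case using Suc by (metis dvd_add dvd_triv_left)
  qed simp
  then obtain R where R: "(1 + monom d (e * P)) ^ t - 1 = monom 1 (e * P) * R" by (elim dvdE)
  have "gauss_poly q (m + k) = (1 + monom d (e * P)) ^ t * gauss_poly q (k - 1)"
    unfolding N gauss_poly_mult[OF quantum_char_power[OF e]] by (simp add: power_mult d)
  also have "\<dots> = gauss_poly q (k - 1) + monom 1 (e * P) * (R * gauss_poly q (k - 1))"
    using R by (simp add: algebra_simps)
  finally have "coeff (gauss_poly q (m + k)) k = 0"
    using k by (simp add: coeff_monom_mult coeff_gauss_poly_gt)
  then show ?thesis
    using coeff_gauss_poly[OF Q(1), of q k] Q q by simp
qed

section \<open>Inversions and lengths of permutations\<close>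

lemma simple_refl_simps [simp]:
  "simple_refl k k = Suc k" "simple_refl k (Suc k) = k"
  "i \<noteq> k \<Longrightarrow> i \<noteq> Suc k \<Longrightarrow> simple_refl k i = i"
  by (auto simp: simple_refl_def transpose_def)

lemma simple_refl_simple_refl [simp]: "simple_refl k (simple_refl k i) = i"
  by (simp add: simple_refl_def)

lemma simple_refl_comp [simp]: "simple_refl k \<circ> simple_refl k = id" "w \<circ> simple_refl k \<circ> simple_refl k = w"
  by (auto simp: fun_eq_iff)

lemma simple_refl_permutes: "k \<in> {1..<n} \<Longrightarrow> simple_refl k permutes {1..n}"
  unfolding simple_refl_def by (rule permutes_swap_id) auto

lemma simple_refl_in: "k \<in> {1..<n} \<Longrightarrow> simple_refl k i \<in> {1..n} \<longleftrightarrow> i \<in> {1..n}"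
  using permutes_in_image[OF simple_refl_permutes] .

lemma simple_refl_less:
  "i < j \<Longrightarrow> (i, j) \<noteq> (k, Suc k) \<Longrightarrow> simple_refl k i < simple_refl k j"
  "i < j \<Longrightarrow> (simple_refl k i, simple_refl k j) \<noteq> (k, Suc k)"
  by (auto simp: simple_refl_def transpose_def split: if_splits)

definition pair_count :: "nat \<Rightarrow> (nat \<Rightarrow> nat \<Rightarrow> bool) \<Rightarrow> nat"
  where "pair_count n Q = card {(i, j). i \<in> {1..n} \<and> j \<in> {1..n} \<and> i < j \<and> Q i j}"

text \<open>
The permutation exchanging \<open>k\<close> and \<open>k + 1\<close> preserves the order of every pair except this one. The
statement serves both the length of a permutation and the power of \<open>q\<close> in a divided power.
\<close>

lemma pair_count_swap:
  assumes k: "k \<in> {1..<n}"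
  shows "pair_count n (\<lambda>i j. Q (simple_refl k i) (simple_refl k j)) + of_bool (Q k (Suc k))
    = pair_count n Q + of_bool (Q (Suc k) k)"
proof -
  let ?s = "simple_refl k"
  define D where "D Q = {(i, j). i \<in> {1..n} \<and> j \<in> {1..n} \<and> i < j \<and> Q i j}" for Q
  define D0 where "D0 Q = D Q - {(k, Suc k)}" for Q
  have fin: "finite (D Q)" for Q
    by (rule finite_subset[of _ "{1..n} \<times> {1..n}"]) (auto simp: D_def)
  have c: "card (D Q) = card (D0 Q) + of_bool (Q k (Suc k))" for Q
  proof (cases "Q k (Suc k)")
    case True
    then have "(k, Suc k) \<in> D Q" using k by (auto simp: D_def)
    then show ?thesis using True card_Suc_Diff1[OF fin] by (simp add: D0_def)
  next
    case False
    then have "(k, Suc k) \<notin> D Q" by (auto simp: D_def)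
    then show ?thesis using False by (simp add: D0_def)
  qed
  have "bij_betw (map_prod ?s ?s) (D0 (\<lambda>i j. Q (?s i) (?s j))) (D0 Q)"
  proof (rule bij_betwI[where g = "map_prod ?s ?s"])
    show "map_prod ?s ?s \<in> D0 (\<lambda>i j. Q (?s i) (?s j)) \<rightarrow> D0 Q"
      using simple_refl_less[where k = k] simple_refl_in[OF k] by (auto simp: D0_def D_def simp del: atLeastAtMost_iff)
    show "map_prod ?s ?s \<in> D0 Q \<rightarrow> D0 (\<lambda>i j. Q (?s i) (?s j))"
      using simple_refl_less[where k = k] simple_refl_in[OF k] by (auto simp: D0_def D_def simp del: atLeastAtMost_iff)
  qed auto
  then have "card (D0 (\<lambda>i j. Q (?s i) (?s j))) = card (D0 Q)" by (rule bij_betw_same_card)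
  then show ?thesis
    using c[of Q] c[of "\<lambda>i j. Q (?s i) (?s j)"] by (simp add: pair_count_def D_def)
qed

text \<open>
Inversions are read off the inverse because multiplying by a simple reflection from the right
exchanges two neighbouring values of the inverse.
\<close>

definition inversions :: "nat \<Rightarrow> (nat \<Rightarrow> nat) \<Rightarrow> nat"
  where "inversions n w = pair_count n (\<lambda>i j. inv w j < inv w i)"

lemma pmul_simple_refl_permutes:
  "\<lbrakk>w permutes {1..n}; k \<in> {1..<n}\<rbrakk> \<Longrightarrow> (w \<cdot> simple_refl k) permutes {1..n}"
  unfolding pmul_def using simple_refl_permutes permutes_compose by blast

lemma inv_pmul_simple_refl:
  assumes "w permutes {1..n}" "k \<in> {1..<n}"
  shows "inv (w \<cdot> simple_refl k) = inv w \<circ> simple_refl k"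
proof -
  have "inv (simple_refl k) = simple_refl k" by (simp add: simple_refl_def)
  moreover have "inv (simple_refl k \<circ> w) = inv w \<circ> inv (simple_refl k)"
    by (rule o_inv_distrib[OF permutes_bij[OF simple_refl_permutes[OF assms(2)]] permutes_bij[OF assms(1)]])
  ultimately show ?thesis unfolding pmul_def by (simp only:)
qed

lemma pmul_simple_refl_simple_refl [simp]: "w \<cdot> simple_refl k \<cdot> simple_refl k = w"
  by (simp add: pmul_def fun_eq_iff)

lemma inv_ne:
  assumes "w permutes {1..n}"
  shows "inv w k \<noteq> inv w (Suc k)"
  using permutes_inj[OF permutes_inv[OF assms]] by (simp add: inj_eq)

lemma inversions_up:
  assumes "w permutes {1..n}" "k \<in> {1..<n}" "inv w k < inv w (Suc k)"
  shows "inversions n (w \<cdot> simple_refl k) = inversions n w + 1"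
  using pair_count_swap[OF assms(2), of "\<lambda>i j. inv w j < inv w i"] assms
  by (simp add: inversions_def inv_pmul_simple_refl[OF assms(1,2)])

lemma inversions_down:
  assumes "w permutes {1..n}" "k \<in> {1..<n}" "inv w (Suc k) < inv w k"
  shows "inversions n w = inversions n (w \<cdot> simple_refl k) + 1"
  using pair_count_swap[OF assms(2), of "\<lambda>i j. inv w j < inv w i"] assms
  by (simp add: inversions_def inv_pmul_simple_refl[OF assms(1,2)])

lemma adjacent_descent:
  fixes f :: "nat \<Rightarrow> nat"
  assumes f: "f permutes {1..n}" and ne: "f \<noteq> id"
  obtains k where "k \<in> {1..<n}" "f (Suc k) < f k"
proof -
  have "\<exists>k\<in>{1..<n}. f (Suc k) < f k"
  proof (rule ccontr)
    assume "\<not> ?thesis"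
    then have le: "f k < f (Suc k)" if "k \<in> {1..<n}" for k
      using that permutes_inj[OF f] by (metis inj_eq linorder_neqE_nat n_not_Suc_n)
    have "f i \<ge> i" if "i \<in> {1..n}" for i
      using that
    proof (induction i)
      case (Suc i)
      show ?case
      proof (cases "i = 0")
        case True
        then show ?thesis using permutes_in_image[OF f, of 1] Suc.prems by simp
      next
        case False
        then show ?thesis using Suc le[of i] by auto
      qed
    qed simp
    then have "f i = i" for i
      using permutes_natset_ge[OF f] by (metis id_apply)
    then show False using ne by auto
  qed
  then show thesis using that by blast
qed

text \<open>
Induction along a reduced expression, so that every step is a product \<open>T w * T s\<close> of the simple kind.
\<close>

lemma perm_up_induct [consumes 1, case_names id up]:
  assumes w: "w permutes {1..n}"
    and id: "P id"
    and up: "\<And>w k. \<lbrakk>w permutes {1..n}; k \<in> {1..<n}; inv w k < inv w (Suc k); P w\<rbrakk>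
      \<Longrightarrow> P (w \<cdot> simple_refl k)"
  shows "P w"
  using w
proof (induction "inversions n w" arbitrary: w rule: less_induct)
  case less
  show ?case
  proof (cases "w = id")
    case False
    then have "inv w \<noteq> id"
      using permutes_inv_inv[OF less.prems] by (metis inv_id)
    then obtain k where k: "k \<in> {1..<n}" "inv w (Suc k) < inv w k"
      using adjacent_descent[OF permutes_inv[OF less.prems]] by blast
    let ?w = "w \<cdot> simple_refl k"
    have p: "?w permutes {1..n}" by (rule pmul_simple_refl_permutes[OF less.prems k(1)])
    have "P ?w" using less.hyps[OF _ p] inversions_down[OF less.prems k] by simp
    moreover have "inv ?w k < inv ?w (Suc k)"
      using k by (simp add: inv_pmul_simple_refl[OF less.prems k(1)])
    ultimately have "P (?w \<cdot> simple_refl k)" by (intro up[OF p k(1)])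
    then show ?thesis by simp
  qed (simp add: id)
qed

lemma word_prod_snoc: "word_prod (is @ [i]) = word_prod is \<cdot> simple_refl i"
  by (simp add: word_prod_def)

text \<open>
A letter of the expression changes the number of inversions by one, so no expression is shorter
than the number of inversions.
\<close>

lemma word_prod_inversions:
  assumes "set is \<subseteq> {1..<n}"
  shows "word_prod is permutes {1..n} \<and> inversions n (word_prod is) \<le> length is"
  using assms
proof (induction "is" rule: rev_induct)
  case Nil
  have "pair_count n (\<lambda>i j. j < i) = 0" by (auto simp: pair_count_def card_eq_0_iff)
  then show ?case by (simp add: word_prod_def permutes_id[unfolded id_def] id_def[symmetric] inversions_def)
next
  case (snoc i "is")
  then have IH: "word_prod is permutes {1..n}" "inversions n (word_prod is) \<le> length is"
    and i: "i \<in> {1..<n}" by auto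
  have "inversions n (word_prod is \<cdot> simple_refl i) \<le> inversions n (word_prod is) + 1"
    using inversions_up[OF IH(1) i] inversions_down[OF IH(1) i] inv_ne[OF IH(1), of i]
    by linarith
  then show ?case using IH pmul_simple_refl_permutes[OF IH(1) i] by (simp add: word_prod_snoc)
qed

lemma perm_length_eq_inversions:
  assumes w: "w permutes {1..n}"
  shows "perm_length n w = inversions n w"
  unfolding perm_length_def
proof (rule Least_equality)
  show "\<exists>is. length is = inversions n w \<and> set is \<subseteq> {1..<n} \<and> word_prod is = w"
    using w
  proof (induction rule: perm_up_induct)
    case id
    have "pair_count n (\<lambda>i j. j < i) = 0" by (auto simp: pair_count_def card_eq_0_iff)
    then show ?case by (intro exI[of _ "[]"]) (simp add: inversions_def word_prod_def)
  next
    case (up w k)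
    then obtain "is" where "length is = inversions n w" "set is \<subseteq> {1..<n}" "word_prod is = w"
      by blast
    then show ?case
      using up inversions_up[OF up(1-3)]
      by (intro exI[of _ "is @ [k]"]) (auto simp: word_prod_snoc)
  qed
next
  fix k
  assume "\<exists>is. length is = k \<and> set is \<subseteq> {1..<n} \<and> word_prod is = w"
  then show "inversions n w \<le> k" using word_prod_inversions by blast
qed

lemma perm_length_up:
  assumes "w permutes {1..n}" "k \<in> {1..<n}" "inv w k < inv w (Suc k)"
  shows "perm_length n (w \<cdot> simple_refl k) = perm_length n w + 1"
  using inversions_up[OF assms] pmul_simple_refl_permutes[OF assms(1,2)] assms(1)
  by (simp add: perm_length_eq_inversions)

lemma perm_length_down:
  assumes "w permutes {1..n}" "k \<in> {1..<n}" "inv w (Suc k) < inv w k"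
  shows "perm_length n w = perm_length n (w \<cdot> simple_refl k) + 1"
  using inversions_down[OF assms] pmul_simple_refl_permutes[OF assms(1,2)] assms(1)
  by (simp add: perm_length_eq_inversions)

section \<open>The Hecke action on words and the divided powers\<close>

locale word_module =
  fixes n :: nat and q :: "'f::field"
  assumes q_nonzero: "q \<noteq> 0"
begin

text \<open>
This is right multiplication by \<open>T\<close> of a simple reflection, in coordinates. On basis words it sends
\<open>w\<close> to \<open>q w\<close> if the letters at \<open>k\<close> and \<open>k + 1\<close> agree, to the swapped word \<open>w'\<close> if they ascend, and to
\<open>q w' + (q - 1) w\<close> if they descend; the formula collects the coefficient of \<open>w\<close>. Vectors are arbitrary
functions on words, and their content is controlled by their support.
\<close>

definition act :: "nat \<Rightarrow> ((nat \<Rightarrow> nat) \<Rightarrow> 'f) \<Rightarrow> (nat \<Rightarrow> nat) \<Rightarrow> 'f"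
  where "act k v w =
    (if w k = w (Suc k) then q * v w
     else if w k < w (Suc k) then q * v (w \<circ> simple_refl k)
     else v (w \<circ> simple_refl k) + (q - 1) * v w)"

definition alternating :: "nat \<Rightarrow> ((nat \<Rightarrow> nat) \<Rightarrow> 'f) \<Rightarrow> bool"
  where "alternating k v \<longleftrightarrow>
    (\<forall>w. w k = w (Suc k) \<longrightarrow> v w = 0) \<and>
    (\<forall>w. w k < w (Suc k) \<longrightarrow> v (w \<circ> simple_refl k) = - v w / q)"

text \<open>
Being alternating at \<open>k\<close> means being a multiple of \<open>1 - T / q\<close>, for \<open>T\<close> the action at \<open>k\<close>. If \<open>q = -1\<close>
this is stronger than being an eigenvector of \<open>T\<close> with eigenvalue \<open>-1\<close>. In this form it is inherited by
images under every operator that commutes with the Hecke algebra.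
\<close>

lemma alternating_iff:
  "alternating k v \<longleftrightarrow> (\<exists>g. v = (\<lambda>w. g w - act k g w / q))"
proof
  assume v: "alternating k v"
  \<comment> \<open>The ascending half of \<open>v\<close> generates it.\<close>
  define g where "g w = (if w k < w (Suc k) then v w else 0)" for w
  have "v w = g w - act k g w / q" for w
  proof -
    consider "w k = w (Suc k)" | "w k < w (Suc k)" | "w (Suc k) < w k" by linarith
    then show ?thesis
    proof cases
      case 3
      then have "v (w \<circ> simple_refl k \<circ> simple_refl k) = - v (w \<circ> simple_refl k) / q"
        using v unfolding alternating_def by (metis comp_apply simple_refl_simps(1,2))
      then show ?thesis using 3 by (simp add: g_def act_def)
    qed (use v q_nonzero in \<open>auto simp: g_def act_def alternating_def\<close>)
  qed
  then show "\<exists>g. v = (\<lambda>w. g w - act k g w / q)" by blast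
next
  assume "\<exists>g. v = (\<lambda>w. g w - act k g w / q)"
  then obtain g where "v = (\<lambda>w. g w - act k g w / q)" by blast
  then show "alternating k v"
    using q_nonzero by (auto simp: alternating_def act_def field_simps)
qed

definition linear_op :: "(((nat \<Rightarrow> nat) \<Rightarrow> 'f) \<Rightarrow> (nat \<Rightarrow> nat) \<Rightarrow> 'f) \<Rightarrow> bool"
  where "linear_op F \<longleftrightarrow> (\<forall>c u v. F (\<lambda>w. u w + c * v w) = (\<lambda>w. F u w + c * F v w))"

lemma alternating_linear_op:
  assumes F: "linear_op F" "\<And>v. act k (F v) = F (act k v)" and v: "alternating k v"
  shows "alternating k (F v)"
proof -
  obtain g where g: "v = (\<lambda>w. g w - act k g w / q)" using v by (auto simp: alternating_iff)
  then have "v = (\<lambda>w. g w + (- 1 / q) * act k g w)" by simp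
  then have "F v = (\<lambda>w. F g w + (- 1 / q) * F (act k g) w)" 
    using F(1)[unfolded linear_op_def, rule_format, of g "- 1 / q" "act k g"] by simp
  then have "F v = (\<lambda>w. F g w - act k (F g) w / q)" by (simp add: F(2))
  then show ?thesis by (auto simp: alternating_iff)
qed

definition letters :: "nat \<Rightarrow> (nat \<Rightarrow> nat) \<Rightarrow> nat set"
  where "letters c w = {i \<in> {1..n}. w i = c}"

lemma finite_letters [simp]: "finite (letters c w)"
  by (simp add: letters_def)

definition relabel :: "nat set \<Rightarrow> nat \<Rightarrow> (nat \<Rightarrow> nat) \<Rightarrow> nat \<Rightarrow> nat"
  where "relabel B d w = (\<lambda>i. if i \<in> B then d else w i)"

definition move_exp :: "nat \<Rightarrow> nat \<Rightarrow> (nat \<Rightarrow> nat) \<Rightarrow> nat set \<Rightarrow> nat"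
  where "move_exp c d w B =
    (if c < d then crossings B (letters c w - B) else crossings (letters c w - B) B)"

text \<open>
A divided power of a root operator of quantum \<open>gl\<close>, for neighbouring letters \<open>c\<close> and \<open>d\<close>. It turns
\<open>m\<close> letters \<open>d\<close> into \<open>c\<close>: the value at \<open>w\<close> is collected from the words in which \<open>m\<close> letters \<open>c\<close> of \<open>w\<close>
still are \<open>d\<close>.
\<close>

definition move :: "nat \<Rightarrow> nat \<Rightarrow> nat \<Rightarrow> ((nat \<Rightarrow> nat) \<Rightarrow> 'f) \<Rightarrow> (nat \<Rightarrow> nat) \<Rightarrow> 'f"
  where "move c d m v w =
    (\<Sum>B\<in>ksubsets (letters c w) m. q ^ move_exp c d w B * v (relabel B d w))"

lemma linear_op_move: "linear_op (move c d m)"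
  by (simp add: linear_op_def move_def fun_eq_iff algebra_simps sum.distrib sum_distrib_left)

text \<open>
Divided powers factor through words in a finer alphabet: the letters are doubled, and the letters
\<open>c\<close> at the positions in \<open>B\<close> become the new letter \<open>x = c + d\<close>, which lies strictly between \<open>2 * c\<close> and
\<open>2 * d\<close>. Collapsing \<open>x\<close> with \<open>2 * d\<close> is a pullback along a monotone map of alphabets, and collapsing
\<open>x\<close> with \<open>2 * c\<close> is a weighted sum (\<open>merge\<close>). Each of these commutes with the action for a simple reason.
\<close>

definition refine :: "nat \<Rightarrow> nat set \<Rightarrow> (nat \<Rightarrow> nat) \<Rightarrow> nat \<Rightarrow> nat"
  where "refine x B w = (\<lambda>i. if i \<in> B then x else 2 * w i)"

text \<open>
A monotone map of alphabets can only make two neighbouring letters equal, and then both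
cases of the action for distinct letters turn into multiplication by \<open>q\<close>.
\<close>

lemma act_pullback:
  assumes "mono f"
  shows "act k v (f \<circ> w) = act k (\<lambda>w. v (f \<circ> w)) w"
proof (cases "w k = w (Suc k) \<or> f (w k) \<noteq> f (w (Suc k))")
  case True
  have "f (w k) < f (w (Suc k)) \<Longrightarrow> w k < w (Suc k)"
    using monoD[OF assms, of "w (Suc k)" "w k"] by linarith
  moreover have "f (w (Suc k)) < f (w k) \<Longrightarrow> w (Suc k) < w k"
    using monoD[OF assms, of "w k" "w (Suc k)"] by linarith
  ultimately show ?thesis using True by (auto simp: act_def comp_assoc)
next
  case False
  then have "f \<circ> w \<circ> simple_refl k = f \<circ> w"
    by (auto simp: fun_eq_iff simple_refl_def transpose_def)
  then show ?thesis using False by (auto simp: act_def comp_assoc algebra_simps)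
qed

text \<open>
In the refined word the exponent of \<open>q\<close> counts the inversions among the letters that come from \<open>c\<close>,
for both directions of the operator.
\<close>

lemma move_exp_eq_pair_count:
  assumes cd: "d = Suc c \<or> c = Suc d" and B: "B \<subseteq> letters c w"
  shows "move_exp c d w B
    = pair_count n (\<lambda>i j. w i = c \<and> w j = c \<and> refine (c + d) B w j < refine (c + d) B w i)"
  unfolding move_exp_def crossings_def pair_count_def
  using assms
  by (cases "c < d")
    (auto intro!: arg_cong[where f = card] simp: refine_def letters_def split: if_splits)

lemma letters_swap:
  assumes "k \<in> {1..<n}"
  shows "letters c (w \<circ> simple_refl k) = simple_refl k ` letters c w"
proof -
  have "i \<in> simple_refl k ` letters c w \<longleftrightarrow> simple_refl k i \<in> letters c w" for i
    by (metis image_iff simple_refl_simple_refl)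
  then show ?thesis
    using simple_refl_in[OF assms] by (auto simp: letters_def simp del: atLeastAtMost_iff)
qed

lemma simple_refl_image_mem: "i \<in> simple_refl k ` B \<longleftrightarrow> simple_refl k i \<in> B"
  by (metis image_iff simple_refl_simple_refl)

lemma refine_swap: "refine x (simple_refl k ` B) (w \<circ> simple_refl k) = refine x B w \<circ> simple_refl k"
  by (auto simp: refine_def fun_eq_iff simple_refl_image_mem)

lemma move_exp_swap:
  assumes cd: "d = Suc c \<or> c = Suc d" and B: "B \<subseteq> letters c w" and k: "k \<in> {1..<n}"
  shows "move_exp c d (w \<circ> simple_refl k) (simple_refl k ` B)
      + of_bool (w k = c \<and> w (Suc k) = c \<and> refine (c + d) B w (Suc k) < refine (c + d) B w k)
    = move_exp c d w B
      + of_bool (w k = c \<and> w (Suc k) = c \<and> refine (c + d) B w k < refine (c + d) B w (Suc k))"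
proof -
  have B': "simple_refl k ` B \<subseteq> letters c (w \<circ> simple_refl k)"
    using B by (auto simp: letters_swap[OF k])
  show ?thesis
    unfolding move_exp_eq_pair_count[OF cd B] move_exp_eq_pair_count[OF cd B'] refine_swap
    using pair_count_swap[OF k, of "\<lambda>i j. w i = c \<and> w j = c \<and> refine (c + d) B w j < refine (c + d) B w i"]
    by (simp add: conj_ac)
qed

lemma ksubsets_letters_swap:
  assumes k: "k \<in> {1..<n}"
  shows "bij_betw ((`) (simple_refl k)) (ksubsets (letters c w) m)
    (ksubsets (letters c (w \<circ> simple_refl k)) m)"
proof (rule bij_betwI[where g = "(`) (simple_refl k)"])
  have inj: "inj_on (simple_refl k) B" for B by (metis inj_onI simple_refl_simple_refl)
  show "(`) (simple_refl k) \<in> ksubsets (letters c w) m \<rightarrow> ksubsets (letters c (w \<circ> simple_refl k)) m"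
    by (auto simp: ksubsets_def letters_swap[OF k] card_image[OF inj])
  show "(`) (simple_refl k) \<in> ksubsets (letters c (w \<circ> simple_refl k)) m \<rightarrow> ksubsets (letters c w) m"
    using letters_swap[OF k, of c "w \<circ> simple_refl k"]
    by (auto simp: ksubsets_def card_image[OF inj])
qed (auto simp: image_image)

definition merge :: "nat \<Rightarrow> nat \<Rightarrow> nat \<Rightarrow> ((nat \<Rightarrow> nat) \<Rightarrow> 'f) \<Rightarrow> (nat \<Rightarrow> nat) \<Rightarrow> 'f"
  where "merge c d m g w =
    (\<Sum>B\<in>ksubsets (letters c w) m. q ^ move_exp c d w B * g (refine (c + d) B w))"

text \<open>
The bookkeeping behind collapsing two letters: \<open>H\<close> stands for the \<open>q\<close>-weighted values, and the
swap matches the ascending with the descending words, whose weights differ by a factor \<open>q\<close>.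
\<close>

lemma sum_swap_symmetrize:
  fixes H :: "'b \<Rightarrow> 'f" and r :: "'b \<Rightarrow> nat \<Rightarrow> nat"
  assumes "finite A" and bij: "bij_betw \<sigma> A A" and inv: "\<And>B. B \<in> A \<Longrightarrow> \<sigma> (\<sigma> B) = B"
    and r: "\<And>B. B \<in> A \<Longrightarrow> r (\<sigma> B) = r B \<circ> simple_refl k"
  shows "(\<Sum>B\<in>A. if r B k = r B (Suc k) then q * H B
      else if r B k < r B (Suc k) then H (\<sigma> B) else q * H (\<sigma> B) + (q - 1) * H B)
    = q * (\<Sum>B\<in>A. H B)"
proof -
  let ?lt = "\<lambda>B. r B k < r B (Suc k)" and ?gt = "\<lambda>B. r B (Suc k) < r B k"
  have flip: "(\<Sum>B\<in>A. if P B then f (\<sigma> B) else 0) = (\<Sum>B\<in>A. if P (\<sigma> B) then f B else 0)"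
    for P and f :: "'b \<Rightarrow> 'f"
  proof -
    have "(\<Sum>B\<in>A. if P (\<sigma> B) then f B else 0)
        = (\<Sum>B\<in>A. if P (\<sigma> (\<sigma> B)) then f (\<sigma> B) else 0)"
      by (rule sum.reindex_bij_betw[OF bij, symmetric])
    also have "\<dots> = (\<Sum>B\<in>A. if P B then f (\<sigma> B) else 0)" by (intro sum.cong) (auto simp: inv)
    finally show ?thesis by simp
  qed
  have lt: "?lt (\<sigma> B) \<longleftrightarrow> ?gt B" and gt: "?gt (\<sigma> B) \<longleftrightarrow> ?lt B" if "B \<in> A" for B
    using r[OF that] by auto
  have "(\<Sum>B\<in>A. if r B k = r B (Suc k) then q * H B
      else if ?lt B then H (\<sigma> B) else q * H (\<sigma> B) + (q - 1) * H B)
    = (\<Sum>B\<in>A. if r B k = r B (Suc k) then q * H B else 0)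
      + (\<Sum>B\<in>A. if ?lt B then H (\<sigma> B) else 0)
      + q * (\<Sum>B\<in>A. if ?gt B then H (\<sigma> B) else 0)
      + (q - 1) * (\<Sum>B\<in>A. if ?gt B then H B else 0)"
    unfolding sum_distrib_left sum.distrib[symmetric]
    by (intro sum.cong refl) auto
  also have "(\<Sum>B\<in>A. if ?lt B then H (\<sigma> B) else 0) = (\<Sum>B\<in>A. if ?gt B then H B else 0)"
    unfolding flip[of ?lt H] by (intro sum.cong refl) (simp add: lt)
  also have "(\<Sum>B\<in>A. if ?gt B then H (\<sigma> B) else 0) = (\<Sum>B\<in>A. if ?lt B then H B else 0)"
    unfolding flip[of ?gt H] by (intro sum.cong refl) (simp add: gt)
  also have "(\<Sum>B\<in>A. if r B k = r B (Suc k) then q * H B else 0)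
      + (\<Sum>B\<in>A. if ?gt B then H B else 0)
      + q * (\<Sum>B\<in>A. if ?lt B then H B else 0)
      + (q - 1) * (\<Sum>B\<in>A. if ?gt B then H B else 0)
    = (\<Sum>B\<in>A. q * H B)"
    unfolding sum_distrib_left sum.distrib[symmetric]
    by (intro sum.cong refl) (auto simp: algebra_simps)
  finally show ?thesis by (simp add: sum_distrib_left)
qed

lemma merge_act:
  assumes cd: "d = Suc c \<or> c = Suc d" and k: "k \<in> {1..<n}"
  shows "act k (merge c d m g) = merge c d m (act k g)"
proof
  fix w
  let ?s = "simple_refl k" and ?x = "c + d"
  let ?A = "ksubsets (letters c w) m"
  have AB: "B \<subseteq> letters c w" "\<And>i. i \<in> B \<Longrightarrow> w i = c" if "B \<in> ?A" for B
    using that by (auto simp: ksubsets_def letters_def)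
  have swapped: "merge c d m g (w \<circ> ?s) = (\<Sum>B\<in>?A. q ^ move_exp c d (w \<circ> ?s) (?s ` B) * g (refine ?x B w \<circ> ?s))"
    unfolding merge_def sum.reindex_bij_betw[OF ksubsets_letters_swap[OF k], symmetric] refine_swap ..
  consider (ne) "w k \<noteq> w (Suc k)" | (other) "w k = w (Suc k)" "w k \<noteq> c" | (eq) "w k = c" "w (Suc k) = c"
    by metis
  then show "act k (merge c d m g) w = merge c d m (act k g) w"
  proof cases
    case ne
    have e: "move_exp c d (w \<circ> ?s) (?s ` B) = move_exp c d w B" if "B \<in> ?A" for B
    proof -
      have no: "(w k = c \<and> w (Suc k) = c \<and> Q) = False" for Q using ne by auto
      show ?thesis using move_exp_swap[OF cd AB(1)[OF that] k] unfolding no by simp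
    qed
    have lt: "refine ?x B w k < refine ?x B w (Suc k) \<longleftrightarrow> w k < w (Suc k)"
      and eq: "refine ?x B w k \<noteq> refine ?x B w (Suc k)" if "B \<in> ?A" for B
      using AB(2)[OF that] ne cd by (auto simp: refine_def)
    show ?thesis
    proof (cases "w k < w (Suc k)")
      case True
      have "act k (merge c d m g) w = q * merge c d m g (w \<circ> ?s)"
        using ne True by (simp add: act_def)
      also have "\<dots> = merge c d m (act k g) w"
        unfolding swapped unfolding merge_def sum_distrib_left
        by (intro sum.cong refl) (simp add: act_def lt eq e True)
      finally show ?thesis .
    next
      case False
      have "act k (merge c d m g) w = merge c d m g (w \<circ> ?s) + (q - 1) * merge c d m g w"
        using ne False by (simp add: act_def)
      also have "\<dots> = merge c d m (act k g) w"
        unfolding swapped unfolding merge_def sum_distrib_left sum.distrib[symmetric]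
        by (intro sum.cong refl) (simp add: act_def lt eq e False algebra_simps)
      finally show ?thesis .
    qed
  next
    case other
    have "refine ?x B w k = refine ?x B w (Suc k)" if "B \<in> ?A" for B
      using AB(2)[OF that, of k] AB(2)[OF that, of "Suc k"] other by (auto simp: refine_def)
    then show ?thesis
      using other by (simp add: act_def merge_def sum_distrib_left mult.left_commute)
  next
    case eq
    then have ws: "w \<circ> ?s = w" by (auto simp: fun_eq_iff simple_refl_def transpose_def)
    have bij: "bij_betw ((`) ?s) ?A ?A"
      using ksubsets_letters_swap[OF k, of c w m] unfolding ws .
    let ?H = "\<lambda>B. q ^ move_exp c d w B * g (refine ?x B w)"
    let ?r = "\<lambda>B. refine ?x B w"
    have r: "?r (?s ` B) = ?r B \<circ> ?s" for B using refine_swap[of ?x k B w] unfolding ws .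
    have "q * (\<Sum>B\<in>?A. ?H B) = (\<Sum>B\<in>?A. if ?r B k = ?r B (Suc k) then q * ?H B
      else if ?r B k < ?r B (Suc k) then ?H (?s ` B) else q * ?H (?s ` B) + (q - 1) * ?H B)"
    proof (rule sum_swap_symmetrize[OF _ bij, symmetric])
      show "?r (?s ` B) = ?r B \<circ> ?s" for B by (rule r)
    qed (simp_all add: image_image)
    also have "\<dots> = (\<Sum>B\<in>?A. q ^ move_exp c d w B * act k g (?r B))"
    proof (intro sum.cong refl)
      fix B assume B: "B \<in> ?A"
      have e: "move_exp c d w (?s ` B) + of_bool (?r B (Suc k) < ?r B k)
          = move_exp c d w B + of_bool (?r B k < ?r B (Suc k))"
        using move_exp_swap[OF cd AB(1)[OF B] k] eq unfolding ws by simp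
      consider "?r B k = ?r B (Suc k)" | "?r B k < ?r B (Suc k)" | "?r B (Suc k) < ?r B k"
        by linarith
      then show "(if ?r B k = ?r B (Suc k) then q * ?H B
          else if ?r B k < ?r B (Suc k) then ?H (?s ` B) else q * ?H (?s ` B) + (q - 1) * ?H B)
        = q ^ move_exp c d w B * act k g (?r B)"
      proof cases
        case 3
        then have "move_exp c d w B = Suc (move_exp c d w (?s ` B))" using e by simp
        then show ?thesis using 3 by (simp add: act_def r algebra_simps)
      qed (use e in \<open>simp_all add: act_def r algebra_simps\<close>)
    qed
    finally show ?thesis using eq by (simp add: act_def merge_def)
  qed
qed

lemma move_eq_merge:
  assumes cd: "d = Suc c \<or> c = Suc d"
  obtains f where "mono f" "move c d m = (\<lambda>v. merge c d m (\<lambda>w. v (f \<circ> w)))"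
proof -
  define f where "f = (\<lambda>y::nat. if c < d then (y + 1) div 2 else y div 2)"
  have "mono f" by (auto simp: f_def mono_def intro: div_le_mono)
  moreover have rel: "relabel B d w = f \<circ> refine (c + d) B w" for B w
    using cd by (auto simp: relabel_def refine_def f_def fun_eq_iff)
  have "move c d m = (\<lambda>v. merge c d m (\<lambda>w. v (f \<circ> w)))"
    by (intro ext) (simp only: move_def merge_def rel)
  ultimately show thesis by (intro that)
qed

text \<open>
The two commuting actions on words of the Hecke algebra and of quantum \<open>gl\<close>.
\<close>

theorem move_act:
  assumes cd: "d = Suc c \<or> c = Suc d" and k: "k \<in> {1..<n}"
  shows "act k (move c d m v) = move c d m (act k v)"
proof -
  obtain f where f: "mono f" "move c d m = (\<lambda>v. merge c d m (\<lambda>w. v (f \<circ> w)))"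
    using move_eq_merge[OF cd] by blast
  show ?thesis unfolding f(2) merge_act[OF cd k] act_pullback[OF f(1)] ..
qed

lemma alternating_move:
  assumes "d = Suc c \<or> c = Suc d" "k \<in> {1..<n}" "alternating k v"
  shows "alternating k (move c d m v)"
  by (rule alternating_linear_op[OF linear_op_move _ assms(3)]) (rule move_act[OF assms(1,2)])

end

section \<open>Leading words and highest weight vectors\<close>

text \<open>
Words are compared at the last position where they differ. This total order decides which word of a
vector is the leading one.
\<close>

definition colex_less :: "(nat \<Rightarrow> nat) \<Rightarrow> (nat \<Rightarrow> nat) \<Rightarrow> bool"
  where "colex_less x w \<longleftrightarrow> (\<exists>p. x p < w p \<and> (\<forall>i>p. x i = w i))"

lemma colex_less_trans: "colex_less x y \<Longrightarrow> colex_less y w \<Longrightarrow> colex_less x w"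
  unfolding colex_less_def
proof (elim exE conjE)
  fix p p' assume "x p < y p" "\<forall>i>p. x i = y i" "y p' < w p'" "\<forall>i>p'. y i = w i"
  then show "\<exists>p. x p < w p \<and> (\<forall>i>p. x i = w i)"
    by (intro exI[of _ "max p p'"]) (cases p p' rule: linorder_cases, auto simp: max_def)
qed

lemma colex_less_irrefl: "\<not> colex_less w w"
  by (auto simp: colex_less_def)

lemma last_difference:
  fixes x w :: "nat \<Rightarrow> nat"
  assumes "\<And>i. i \<notin> {1..n} \<Longrightarrow> x i = w i" "x \<noteq> w"
  obtains p where "p \<in> {1..n}" "x p \<noteq> w p" "\<And>i. p < i \<Longrightarrow> x i = w i"
proof -
  let ?D = "{i \<in> {1..n}. x i \<noteq> w i}"
  have "finite ?D" by simp
  moreover obtain i where "x i \<noteq> w i" using assms(2) by auto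
  then have "i \<in> ?D" using assms(1) by blast
  then have "?D \<noteq> {}" by blast
  ultimately have m: "Max ?D \<in> ?D" by (intro Max_in)
  have "x i = w i" if "Max ?D < i" for i
  proof (rule ccontr)
    assume "x i \<noteq> w i"
    then have "i \<in> ?D" using assms(1) by blast
    then have "i \<le> Max ?D" by (intro Max_ge) simp_all
    then show False using that by simp
  qed
  then show thesis using m that by blast
qed

lemma colex_less_total:
  assumes "\<And>i. i \<notin> {1..n} \<Longrightarrow> x i = w i" "x \<noteq> w"
  shows "colex_less x w \<or> colex_less w x"
  using last_difference[OF assms] unfolding colex_less_def by (metis linorder_neqE_nat)

lemma colex_max:
  assumes "finite A" "A \<noteq> {}"
  obtains w where "w \<in> A" "\<And>x. x \<in> A \<Longrightarrow> \<not> colex_less w x"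
proof -
  have "\<exists>m\<in>A. \<forall>x\<in>A. x \<noteq> m \<longrightarrow> \<not> colex_less m x"
    by (rule Finite_Set.bex_max_element[OF assms(1) _ _ assms(2)])
      (auto intro!: transp_onI asymp_onI dest: colex_less_trans simp: colex_less_irrefl)
  then show thesis using that colex_less_irrefl by metis
qed

context word_module
begin

definition words :: "(nat \<Rightarrow> nat) \<Rightarrow> (nat \<Rightarrow> nat) set"
  where "words mu = {w. (\<forall>i. i \<notin> {1..n} \<longrightarrow> w i = 0) \<and> (\<forall>i\<in>{1..n}. 1 \<le> w i) \<and>
    (\<forall>r\<ge>1. card (letters r w) = mu r)}"

lemma wordsD:
  assumes "w \<in> words mu"
  shows "i \<notin> {1..n} \<Longrightarrow> w i = 0" "i \<in> {1..n} \<Longrightarrow> 1 \<le> w i" "1 \<le> r \<Longrightarrow> card (letters r w) = mu r"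
  using assms unfolding words_def by blast+

lemma finite_words:
  assumes "finite {r. mu r \<noteq> 0}"
  shows "finite (words mu)"
proof -
  have "words mu \<subseteq> {w. \<forall>i. (i \<in> {1..n} \<longrightarrow> w i \<in> {r. mu r \<noteq> 0}) \<and> (i \<notin> {1..n} \<longrightarrow> w i = 0)}"
  proof (rule subsetI, rule CollectI, intro allI conjI impI)
    fix w i assume w: "w \<in> words mu"
    show "w i = 0" if "i \<notin> {1..n}" using wordsD(1)[OF w that] .
    show "w i \<in> {r. mu r \<noteq> 0}" if i: "i \<in> {1..n}"
    proof -
      have "i \<in> letters (w i) w" using i by (simp add: letters_def)
      then have "card (letters (w i) w) \<noteq> 0" by (auto simp: card_eq_0_iff)
      then show ?thesis using wordsD(3)[OF w wordsD(2)[OF w i]] by simp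
    qed
  qed
  then show ?thesis using finite_set_of_finite_funs[OF _ assms] finite_subset by blast
qed

lemma permute_words:
  assumes "w permutes {1..n}" "x \<in> words mu"
  shows "x \<circ> inv w \<in> words mu"
proof -
  have p: "inv w permutes {1..n}" using assms(1) by (rule permutes_inv)
  have "card (letters r (x \<circ> inv w)) = card (letters r x)" for r
  proof -
    have "bij_betw (inv w) (letters r (x \<circ> inv w)) (letters r x)"
      unfolding letters_def
      by (rule bij_betwI[where g = w])
        (use permutes_in_image[OF p] permutes_in_image[OF assms(1)] permutes_inverses[OF assms(1)]
          in \<open>auto simp del: atLeastAtMost_iff One_nat_def\<close>)
    then show ?thesis by (rule bij_betw_same_card)
  qed
  moreover have "(x \<circ> inv w) i = 0" if "i \<notin> {1..n}" for i
    using wordsD(1)[OF assms(2) that] permutes_not_in[OF p that] by simp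
  moreover have "1 \<le> (x \<circ> inv w) i" if "i \<in> {1..n}" for i
    using wordsD(2)[OF assms(2), of "inv w i"] permutes_in_image[OF p, of i] that by simp
  ultimately show ?thesis
    using wordsD(3)[OF assms(2)] unfolding words_def by simp
qed

lemma act_words:
  assumes k: "k \<in> {1..<n}" and supp: "{x. v x \<noteq> 0} \<subseteq> words mu"
  shows "{x. act k v x \<noteq> 0} \<subseteq> words mu"
proof
  fix x assume "x \<in> {x. act k v x \<noteq> 0}"
  then have "v x \<noteq> 0 \<or> v (x \<circ> simple_refl k) \<noteq> 0" by (auto simp: act_def split: if_splits)
  then have "x \<in> words mu \<or> x \<circ> simple_refl k \<in> words mu" using supp by blast
  moreover have "inv (simple_refl k) = simple_refl k" by (simp add: simple_refl_def)
  ultimately show "x \<in> words mu"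
    using permute_words[OF simple_refl_permutes[OF k], of "x \<circ> simple_refl k" mu] by auto
qed

definition count_above :: "(nat \<Rightarrow> nat) \<Rightarrow> nat \<Rightarrow> nat \<Rightarrow> nat"
  where "count_above w p r = card {i \<in> {1..n}. p < i \<and> r < w i}"

text \<open>
The Bruhat order on words: large letters of \<open>w\<close> sit further to the right than those of \<open>x\<close>. It
is finer information than \<open>colex_less\<close>, and, unlike that order, stable under swaps (\<open>dominated_swap\<close>).
\<close>

definition dominated :: "(nat \<Rightarrow> nat) \<Rightarrow> (nat \<Rightarrow> nat) \<Rightarrow> bool"
  where "dominated x w \<longleftrightarrow> (\<forall>p r. count_above x p r \<le> count_above w p r)"

lemma dominated_refl [simp]: "dominated w w"
  by (simp add: dominated_def)

lemma dominated_trans: "dominated x y \<Longrightarrow> dominated y w \<Longrightarrow> dominated x w"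
  unfolding dominated_def by (meson order_trans)

lemma count_above_step:
  assumes "Suc p \<in> {1..n}"
  shows "count_above w p r = count_above w (Suc p) r + of_bool (r < w (Suc p))"
proof (cases "r < w (Suc p)")
  case True
  then have "{i \<in> {1..n}. p < i \<and> r < w i} = insert (Suc p) {i \<in> {1..n}. Suc p < i \<and> r < w i}"
    using assms by (auto simp: Suc_lessI)
  then show ?thesis using True by (simp add: count_above_def)
next
  case False
  then have "{i \<in> {1..n}. p < i \<and> r < w i} = {i \<in> {1..n}. Suc p < i \<and> r < w i}"
    by (auto simp: less_Suc_eq) (metis Suc_lessI)
  then show ?thesis using False by (simp add: count_above_def)
qed

lemma dominated_imp_colex_less:
  assumes z: "\<And>i. i \<notin> {1..n} \<Longrightarrow> x i = w i" and d: "dominated x w" and "x \<noteq> w"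
  shows "colex_less x w"
proof -
  obtain p where p: "p \<in> {1..n}" "x p \<noteq> w p" and above: "\<And>i. p < i \<Longrightarrow> x i = w i"
    using last_difference[OF z \<open>x \<noteq> w\<close>] by blast
  then obtain p' where p': "p = Suc p'" by (cases p) auto
  have "\<not> w p < x p"
  proof
    assume "w p < x p"
    moreover have "count_above x p (w p) = count_above w p (w p)"
      unfolding count_above_def by (intro arg_cong[where f = card]) (use above in auto)
    ultimately have "count_above x p' (w p) > count_above w p' (w p)"
      using p by (simp add: p' count_above_step)
    then show False using d by (simp add: dominated_def leD)
  qed
  then show ?thesis using p above unfolding colex_less_def by (metis linorder_neqE_nat)
qed

lemma count_above_swap:
  assumes k: "k \<in> {1..<n}"
  shows "count_above (w \<circ> simple_refl k) p r
    = (if p = k then count_above w (Suc k) r + of_bool (r < w k) else count_above w p r)"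
proof -
  have ne: "count_above (w \<circ> simple_refl k) p r = count_above w p r" if "p \<noteq> k" for p
  proof -
    have mono: "p < simple_refl k i \<longleftrightarrow> p < i" for i
      using that by (auto simp: simple_refl_def transpose_def)
    have "bij_betw (simple_refl k) {i \<in> {1..n}. p < i \<and> r < (w \<circ> simple_refl k) i}
        {i \<in> {1..n}. p < i \<and> r < w i}"
      by (rule bij_betwI[where g = "simple_refl k"])
        (auto simp: mono simple_refl_in[OF k] simp del: atLeastAtMost_iff One_nat_def)
    then show ?thesis unfolding count_above_def by (rule bij_betw_same_card)
  qed
  show ?thesis
    using ne[of p] ne[of "Suc k"] count_above_step[of k "w \<circ> simple_refl k" r] k by auto
qed

text \<open>
Swapping changes the counts only for the suffix beginning at \<open>k + 1\<close>. If \<open>t k\<close> exceeds \<open>r\<close>, the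
new count of \<open>t\<close> is as large as it can be; otherwise neither of the two letters of \<open>t\<close> exceeds \<open>r\<close>, and the
counts for the suffix from \<open>k\<close> on can be compared instead.
\<close>

lemma dominated_swap:
  assumes k: "k \<in> {1..<n}" and t: "t (Suc k) < t k" and d: "dominated x t"
  shows "dominated x (t \<circ> simple_refl k)" "dominated (x \<circ> simple_refl k) (t \<circ> simple_refl k)"
proof -
  have dom: "count_above x p r \<le> count_above t p r" for p r using d by (simp add: dominated_def)
  have up: "count_above t p r \<le> count_above (t \<circ> simple_refl k) p r" for p r
    using count_above_step[of k t r] k t by (auto simp: count_above_swap[OF k])
  show "dominated x (t \<circ> simple_refl k)"
    unfolding dominated_def using dom up order_trans by blast
  have "count_above x (Suc k) r + of_bool (r < x k) \<le> count_above t (Suc k) r + of_bool (r < t k)" for r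
  proof (cases "r < t k")
    case True
    then show ?thesis using dom[of "Suc k" r] by simp
  next
    case False
    obtain k' where k': "k = Suc k'" using k by (cases k) auto
    have "count_above x (Suc k) r + of_bool (r < x k) \<le> count_above x k' r"
      using count_above_step[of k x r] count_above_step[of k' x r] k k' by simp
    also have "\<dots> \<le> count_above t k' r" by (rule dom)
    also have "\<dots> = count_above t (Suc k) r"
      using count_above_step[of k t r] count_above_step[of k' t r] k k' False t by simp
    finally show ?thesis by simp
  qed
  then show "dominated (x \<circ> simple_refl k) (t \<circ> simple_refl k)"
    unfolding dominated_def by (auto simp: count_above_swap[OF k] dom)
qed

definition leading :: "((nat \<Rightarrow> nat) \<Rightarrow> 'f) \<Rightarrow> (nat \<Rightarrow> nat) \<Rightarrow> bool"
  where "leading v t \<longleftrightarrow> v t \<noteq> 0 \<and> (\<forall>x. v x \<noteq> 0 \<longrightarrow> dominated x t)"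

text \<open>
Turning a descent of the leading word into an ascent yields the leading word of the new vector,
with coefficient multiplied by \<open>q\<close>.
\<close>

lemma leading_act:
  assumes k: "k \<in> {1..<n}" and t: "t (Suc k) < t k" and v: "leading v t"
  shows "leading (act k v) (t \<circ> simple_refl k)"
  unfolding leading_def
proof (intro conjI allI impI)
  show "act k v (t \<circ> simple_refl k) \<noteq> 0"
    using v t q_nonzero by (simp add: act_def leading_def)
  fix x assume "act k v x \<noteq> 0"
  then have "v x \<noteq> 0 \<or> v (x \<circ> simple_refl k) \<noteq> 0" by (auto simp: act_def split: if_splits)
  then show "dominated x (t \<circ> simple_refl k)"
  proof
    assume "v x \<noteq> 0"
    then show ?thesis using v dominated_swap(1)[OF k t] by (simp add: leading_def)
  next
    assume "v (x \<circ> simple_refl k) \<noteq> 0"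
    then have "dominated (x \<circ> simple_refl k \<circ> simple_refl k) (t \<circ> simple_refl k)"
      using v dominated_swap(2)[OF k t] by (simp add: leading_def del: simple_refl_comp)
    then show ?thesis by simp
  qed
qed

text \<open>
Among the vectors of content \<open>\<mu>\<close> these form the intersection of kernels that James's theorem
identifies with the Specht module.
\<close>

definition highest :: "((nat \<Rightarrow> nat) \<Rightarrow> 'f) \<Rightarrow> bool"
  where "highest v \<longleftrightarrow> (\<forall>b\<ge>1. \<forall>m\<ge>1. move b (Suc b) m v = (\<lambda>_. 0))"

lemma highest_act: "k \<in> {1..<n} \<Longrightarrow> highest v \<Longrightarrow> highest (act k v)"
  by (simp add: highest_def flip: move_act) (simp add: act_def fun_eq_iff)

lemma highest_lincomb: "highest u \<Longrightarrow> highest v \<Longrightarrow> highest (\<lambda>w. u w + c * v w)"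
  using linear_op_move by (simp add: highest_def linear_op_def)

lemma move_up_eq: "move b (Suc b) m v w
    = crossing_sum q (letters b w) m (\<lambda>B. v (relabel B (Suc b) w))"
  by (simp add: move_def crossing_sum_def move_exp_def)

text \<open>
A word of partition content is ballot iff the row standard tableau it encodes is standard.
\<close>

definition ballot :: "(nat \<Rightarrow> nat) \<Rightarrow> bool"
  where "ballot w \<longleftrightarrow>
    (\<forall>b\<ge>1. \<forall>p. card {i \<in> letters (Suc b) w. i \<le> p} \<le> card {i \<in> letters b w. i \<le> p})"

text \<open>
Suppose that some prefix of the leading word \<open>w\<close> has more letters \<open>b + 1\<close> than letters \<open>b\<close>. Keep the
letters outside the prefix fixed and let the letters \<open>b\<close>, \<open>b + 1\<close> in the prefix vary. If a raising operator
moves a letter outside the prefix, the resulting word is larger than \<open>w\<close> and contributes nothing, so the vector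
restricted to the prefix is itself killed by all raising operators. It has negative weight and
hence vanishes.
\<close>

lemma highest_max_ballot:
  assumes v: "highest v" and w: "v w \<noteq> 0" and max: "\<And>x. colex_less w x \<Longrightarrow> v x = 0"
  shows "ballot w"
proof (rule ccontr)
  assume "\<not> ballot w"
  then obtain b p where b: "b \<ge> 1"
    and gt: "card {i \<in> letters b w. i \<le> p} < card {i \<in> letters (Suc b) w. i \<le> p}"
    by (auto simp: ballot_def not_le)
  \<comment> \<open>\<open>D\<close> and \<open>E\<close> are the letters \<open>b + 1\<close> and \<open>b\<close> of the prefix, \<open>S\<close> the letters \<open>b\<close> after it; \<open>W Y\<close> is \<open>w\<close> with the letters \<open>b + 1\<close> of the prefix moved to the set \<open>Y\<close>.\<close>
  define D where "D = {i \<in> letters (Suc b) w. i \<le> p}"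
  define E where "E = {i \<in> letters b w. i \<le> p}"
  define S where "S = {i \<in> letters b w. p < i}"
  define W where "W Y = (\<lambda>i. if i \<in> D \<union> E then if i \<in> Y then Suc b else b else w i)" for Y
  have fin: "finite D" "finite E" "finite S" by (simp_all add: D_def E_def S_def letters_def)
  have "D \<inter> E = {}" by (auto simp: D_def E_def letters_def)
  then have weight: "1 + card (D \<union> E) \<le> 2 * card D"
    using gt fin by (simp add: card_Un_disjoint flip: D_def E_def)
  have ker: "crossing_sum q (D \<union> E - X) k (\<lambda>B. v (W (X \<union> B))) = 0"
    if k: "1 \<le> k" and X: "X \<subseteq> D \<union> E" for k X
  proof -
    have let_eq: "letters b (W X) = (D \<union> E - X) \<union> S"
      using X by (auto simp: W_def letters_def D_def E_def S_def split: if_splits)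
    have less: "\<forall>i\<in>D \<union> E - X. \<forall>s\<in>S. i < s" by (auto simp: D_def E_def S_def)
    have zero: "v (relabel B (Suc b) (W X)) = 0"
      if B: "B \<in> ksubsets ((D \<union> E - X) \<union> S) k" and nB: "\<not> B \<subseteq> D \<union> E - X" for B
    proof (rule max)
      let ?m = "Max (B \<inter> S)"
      have "B \<inter> S \<noteq> {}" using B nB by (auto simp: ksubsets_def)
      then have m: "?m \<in> B" "?m \<in> S" and m': "\<And>i. i \<in> B \<Longrightarrow> i \<in> S \<Longrightarrow> i \<le> ?m"
        using Max_in[of "B \<inter> S"] fin by auto
      have "relabel B (Suc b) (W X) i = w i" if i: "?m < i" for i
      proof -
        have "p < i" using m i by (auto simp: S_def)
        then have "i \<notin> D \<union> E" by (auto simp: D_def E_def)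
        moreover from this have "i \<notin> B" using m'[of i] i B by (auto simp: ksubsets_def)
        ultimately show ?thesis by (simp add: relabel_def W_def)
      qed
      moreover have "w ?m < relabel B (Suc b) (W X) ?m"
        using m by (simp add: relabel_def S_def letters_def)
      ultimately show "colex_less w (relabel B (Suc b) (W X))" unfolding colex_less_def by metis
    qed
    have "0 = crossing_sum q ((D \<union> E - X) \<union> S) k (\<lambda>B. v (relabel B (Suc b) (W X)))"
      using v b k unfolding highest_def let_eq[symmetric] move_up_eq[symmetric] by simp
    also have "\<dots> = q ^ (k * card S) * crossing_sum q (D \<union> E - X) k (\<lambda>B. v (relabel B (Suc b) (W X)))"
      using fin by (intro crossing_sum_Un_large less zero) auto
    also have "crossing_sum q (D \<union> E - X) k (\<lambda>B. v (relabel B (Suc b) (W X)))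
        = crossing_sum q (D \<union> E - X) k (\<lambda>B. v (W (X \<union> B)))"
    proof (rule crossing_sum_cong)
      fix B assume "B \<in> ksubsets (D \<union> E - X) k"
      then have "relabel B (Suc b) (W X) = W (X \<union> B)"
        by (auto simp: relabel_def W_def ksubsets_def fun_eq_iff)
      then show "v (relabel B (Suc b) (W X)) = v (W (X \<union> B))" by simp
    qed
    finally show ?thesis using q_nonzero by simp
  qed
  have "v (W D) = 0"
    by (rule negative_weight_vanish[OF q_nonzero _ weight, of "\<lambda>Y. v (W Y)"])
      (use ker fin in \<open>auto simp: ksubsets_def\<close>)
  moreover have "W D = w" by (auto simp: W_def D_def E_def letters_def)
  ultimately show False using w by simp
qed

text \<open>
Gaussian elimination: subtract a multiple of an element of \<open>V\<close> with the same leading word, which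
is ballot by \<open>highest_max_ballot\<close>, and proceed with the smaller remainder.
\<close>

lemma highest_induct:
  assumes fin: "finite {r. mu r \<noteq> 0}"
    and lead: "\<And>w. w \<in> words mu \<Longrightarrow> ballot w
      \<Longrightarrow> \<exists>u. leading u w \<and> highest u \<and> {x. u x \<noteq> 0} \<subseteq> words mu \<and> u \<in> V"
    and zero: "(\<lambda>_. 0) \<in> V"
    and comb: "\<And>u v c. u \<in> V \<Longrightarrow> v \<in> V \<Longrightarrow> (\<lambda>w. u w + c * v w) \<in> V"
    and v: "highest v" "{x. v x \<noteq> 0} \<subseteq> words mu"
  shows "v \<in> V"
proof -
  define rank where "rank w = card {x \<in> words mu. colex_less x w}" for w
  note finW = finite_words[OF fin]
  have rank_less: "rank x < rank w" if "x \<in> words mu" "colex_less x w" for x w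
    unfolding rank_def
  proof (rule psubset_card_mono)
    have "x \<in> {y \<in> words mu. colex_less y w}" "x \<notin> {y \<in> words mu. colex_less y x}"
      using that colex_less_irrefl by auto
    then show "{y \<in> words mu. colex_less y x} \<subset> {y \<in> words mu. colex_less y w}"
      using that colex_less_trans by blast
  qed (simp add: finW)
  have "v \<in> V" if "highest v" "{x. v x \<noteq> 0} \<subseteq> words mu" "\<And>x. v x \<noteq> 0 \<Longrightarrow> rank x < N" for v N
    using that
  proof (induction N arbitrary: v)
    case 0
    then have "v = (\<lambda>_. 0)" by auto
    then show ?case using zero by simp
  next
    case (Suc N)
    show ?case
    proof (cases "v = (\<lambda>_. 0)")
      case True
      then show ?thesis using zero by simp
    next
      case False
      have "finite {x. v x \<noteq> 0}" "{x. v x \<noteq> 0} \<noteq> {}"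
        using Suc.prems(2) finW finite_subset False by auto
      then obtain w where w: "v w \<noteq> 0" and max: "\<And>x. v x \<noteq> 0 \<Longrightarrow> \<not> colex_less w x"
        using colex_max by (metis (mono_tags, lifting) mem_Collect_eq)
      have wW: "w \<in> words mu" using w Suc.prems(2) by auto
      have "ballot w" by (rule highest_max_ballot[OF Suc.prems(1) w]) (use max in blast)
      then obtain u where u: "leading u w" "highest u" "{x. u x \<noteq> 0} \<subseteq> words mu" "u \<in> V"
        using lead[OF wW] by blast
      have uw: "u w \<noteq> 0" using u(1) by (simp add: leading_def)
      define v' where "v' = (\<lambda>x. v x + (- v w / u w) * u x)"
      have v'w: "v' w = 0" using uw by (simp add: v'_def)
      have sub: "v x \<noteq> 0 \<or> u x \<noteq> 0" if "v' x \<noteq> 0" for x using that by (auto simp: v'_def)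
      have "v' \<in> V"
      proof (rule Suc.IH)
        show "highest v'" unfolding v'_def using Suc.prems(1) u(2) by (rule highest_lincomb)
        show supp: "{x. v' x \<noteq> 0} \<subseteq> words mu" using sub Suc.prems(2) u(3) by auto
        fix x assume x: "v' x \<noteq> 0"
        then have xW: "x \<in> words mu" and ne: "x \<noteq> w" using supp v'w by auto
        have out: "x i = w i" if "i \<notin> {1..n}" for i
          using wordsD(1)[OF xW that] wordsD(1)[OF wW that] by simp
        have "colex_less x w"
          using sub[OF x]
        proof
          assume "v x \<noteq> 0"
          then show ?thesis using max colex_less_total[OF out ne] by blast
        next
          assume "u x \<noteq> 0"
          then show ?thesis using u(1) dominated_imp_colex_less[OF out _ ne] by (simp add: leading_def)
        qed
        then show "rank x < N" using rank_less[OF xW] Suc.prems(3)[OF w] by fastforce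
      qed
      then have "(\<lambda>x. v' x + (v w / u w) * u x) \<in> V" using u(4) comb by blast
      moreover have "(\<lambda>x. v' x + (v w / u w) * u x) = v" by (simp add: v'_def)
      ultimately show ?thesis by simp
    qed
  qed
  from this[of v "Suc (card (words mu))"] show ?thesis
    using v card_mono[OF finW] by (auto simp: rank_def less_Suc_eq_le)
qed

end

section \<open>The column word of a partition and its polytabloid\<close>

lemma rank_bij:
  fixes le :: "'a \<Rightarrow> 'a \<Rightarrow> bool"
  assumes fin: "finite D"
    and trans: "\<And>x y z. le x y \<Longrightarrow> le y z \<Longrightarrow> le x z"
    and antisym: "\<And>x y. le x y \<Longrightarrow> le y x \<Longrightarrow> x = y"
    and total: "\<And>x y. le x y \<or> le y x"
  shows "bij_betw (\<lambda>x. card {y \<in> D. le y x}) D {1..card D}"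
    and "\<And>x y. x \<in> D \<Longrightarrow> y \<in> D \<Longrightarrow>
      card {z \<in> D. le z x} < card {z \<in> D. le z y} \<longleftrightarrow> le x y \<and> x \<noteq> y"
proof -
  let ?f = "\<lambda>x. card {y \<in> D. le y x}"
  have less: "?f x < ?f y" if "x \<in> D" "y \<in> D" "le x y" "x \<noteq> y" for x y
  proof (rule psubset_card_mono)
    have "y \<in> {z \<in> D. le z y}" "y \<notin> {z \<in> D. le z x}" using that total antisym by blast+
    then show "{z \<in> D. le z x} \<subset> {z \<in> D. le z y}" using trans that by blast
  qed (simp add: fin)
  show iff: "?f x < ?f y \<longleftrightarrow> le x y \<and> x \<noteq> y" if "x \<in> D" "y \<in> D" for x y
  proof
    assume l: "?f x < ?f y"
    then have "x \<noteq> y" by auto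
    moreover have "\<not> le y x" using less[of y x] that l \<open>x \<noteq> y\<close> by auto
    ultimately show "le x y \<and> x \<noteq> y" using total by blast
  qed (use less that in blast)
  have inj: "inj_on ?f D"
  proof (rule inj_onI, rule ccontr)
    fix x y assume "x \<in> D" "y \<in> D" "?f x = ?f y" "x \<noteq> y"
    then show False using less[of x y] less[of y x] total[of x y] by auto
  qed
  have "?f ` D \<subseteq> {1..card D}"
  proof (intro subsetI, elim imageE)
    fix m x assume x: "m = ?f x" "x \<in> D"
    then have "x \<in> {y \<in> D. le y x}" using total by blast
    then have "?f x \<noteq> 0" using fin by (auto simp: card_eq_0_iff)
    moreover have "?f x \<le> card D" using fin by (intro card_mono) auto
    ultimately show "m \<in> {1..card D}" using x by simp
  qed
  moreover have "card (?f ` D) = card D" using inj by (rule card_image)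
  ultimately have "?f ` D = {1..card D}" by (intro card_subset_eq) simp_all
  then show "bij_betw ?f D {1..card D}" using inj by (simp add: bij_betw_def)
qed

lemma permutes_inverted_pair:
  fixes w :: "nat \<Rightarrow> nat"
  assumes w: "w permutes {1..n}" and ij: "i < j" "w j < w i"
  shows "i \<in> {1..n}" "j \<in> {1..n}"
proof -
  have mem: "w p \<in> {1..n} \<longleftrightarrow> p \<in> {1..n}" for p by (rule permutes_in_image[OF w])
  have out: "w p = p" if "p \<notin> {1..n}" for p using permutes_not_in[OF w that] .
  show "i \<in> {1..n}" using out[of i] out[of j] mem[of j] ij by (cases "j \<in> {1..n}"; force)
  then show "j \<in> {1..n}" using out[of j] mem[of i] ij by force
qed

text \<open>
For a permutation all of whose inverted pairs satisfy \<open>R\<close>, induction along a reduced expression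
meets only swaps of entries related by \<open>R\<close>.
\<close>

lemma perm_up_induct_rel [consumes 1, case_names rel id up]:
  assumes w: "w permutes {1..n}"
    and rel: "\<And>i j. i < j \<Longrightarrow> w j < w i \<Longrightarrow> R i j"
    and id: "P id"
    and up: "\<And>w k. \<lbrakk>w permutes {1..n}; k \<in> {1..<n}; inv w k < inv w (Suc k);
      R (inv w k) (inv w (Suc k)); P w\<rbrakk> \<Longrightarrow> P (w \<cdot> simple_refl k)"
  shows "P w"
  using w rel
proof (induction rule: perm_up_induct)
  case (up w k)
  let ?i = "inv w k" and ?j = "inv w (Suc k)"
  have ij: "w ?i = k" "w ?j = Suc k" using permutes_inverses[OF up(1)] by auto
  have R: "R ?i ?j"
    using up.prems[of ?i ?j] up(3) by (simp add: pmul_def ij)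
  have "P w"
  proof (rule up.IH)
    fix i j assume "i < j" "w j < w i"
    have "(w j, w i) \<noteq> (k, Suc k)"
    proof
      assume "(w j, w i) = (k, Suc k)"
      then have "?i = j" "?j = i" using permutes_inv_eq[OF up(1)] by auto
      then show False using up(3) \<open>i < j\<close> by simp
    qed
    then show "R i j" using up.prems[of i j] simple_refl_less(1) \<open>i < j\<close> \<open>w j < w i\<close> by (simp add: pmul_def)
  qed
  then show ?case using up R assms(4) by blast
qed (rule id)

locale partition_words = word_module n q for n :: nat and q :: "'f::field" +
  fixes lam :: "nat \<Rightarrow> nat"
  assumes part: "is_partition n lam"
begin

lemma lam_0: "lam 0 = 0" and finite_lam: "finite {i. lam i \<noteq> 0}"
  and sum_lam: "(\<Sum>i | lam i \<noteq> 0. lam i) = n"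
  using part by (auto simp: is_partition_def is_composition_def)

lemma lam_antimono:
  assumes "1 \<le> i" "i \<le> j"
  shows "lam j \<le> lam i"
  using assms(2)
proof (induction j rule: dec_induct)
  case (step j)
  then have "lam (Suc j) \<le> lam j" using part assms(1) by (simp add: is_partition_def)
  then show ?case using step by simp
qed simp

lemma diagram_mem: "(i, j) \<in> diagram lam \<longleftrightarrow> 1 \<le> i \<and> 1 \<le> j \<and> j \<le> lam i"
  by (simp add: diagram_def)

lemma diagram_Sigma: "diagram lam = Sigma {i. lam i \<noteq> 0} (\<lambda>i. {1..lam i})"
  using lam_0 by (auto simp: diagram_def) (metis not_less_eq_eq not_one_le_zero One_nat_def Suc_leI gr0I)

lemma finite_diagram: "finite (diagram lam)" and card_diagram: "card (diagram lam) = n"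
  unfolding diagram_Sigma using finite_lam sum_lam by auto

lemma row_tableau_bij: "bij_betw (row_tableau lam) (diagram lam) {1..n}"
  and row_tableau_less: "\<lbrakk>x \<in> diagram lam; y \<in> diagram lam\<rbrakk> \<Longrightarrow>
    row_tableau lam x < row_tableau lam y \<longleftrightarrow> fst x < fst y \<or> fst x = fst y \<and> snd x < snd y"
proof -
  define le :: "nat \<times> nat \<Rightarrow> nat \<times> nat \<Rightarrow> bool"
    where "le x y \<longleftrightarrow> fst x < fst y \<or> fst x = fst y \<and> snd x \<le> snd y" for x y
  have eq: "row_tableau lam = (\<lambda>x. card {y \<in> diagram lam. le y x})"
    by (auto simp: row_tableau_def le_def fun_eq_iff intro!: arg_cong[where f = card])
  note r = rank_bij[OF finite_diagram, of le]
  have "bij_betw (\<lambda>x. card {y \<in> diagram lam. le y x}) (diagram lam) {1..card (diagram lam)}"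
    by (rule r(1)) (auto simp: le_def prod_eq_iff)
  then show "bij_betw (row_tableau lam) (diagram lam) {1..n}" unfolding eq card_diagram .
  assume xy: "x \<in> diagram lam" "y \<in> diagram lam"
  have "card {z \<in> diagram lam. le z x} < card {z \<in> diagram lam. le z y} \<longleftrightarrow> le x y \<and> x \<noteq> y"
    by (rule r(2)[OF _ _ _ xy]) (auto simp: le_def prod_eq_iff)
  then show "row_tableau lam x < row_tableau lam y \<longleftrightarrow> fst x < fst y \<or> fst x = fst y \<and> snd x < snd y"
    unfolding eq by (auto simp: le_def prod_eq_iff)
qed

lemma col_tableau_bij: "bij_betw (col_tableau lam) (diagram lam) {1..n}"
  and col_tableau_less: "\<lbrakk>x \<in> diagram lam; y \<in> diagram lam\<rbrakk> \<Longrightarrow>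
    col_tableau lam x < col_tableau lam y \<longleftrightarrow> snd x < snd y \<or> snd x = snd y \<and> fst x < fst y"
proof -
  define le :: "nat \<times> nat \<Rightarrow> nat \<times> nat \<Rightarrow> bool"
    where "le x y \<longleftrightarrow> snd x < snd y \<or> snd x = snd y \<and> fst x \<le> fst y" for x y
  have eq: "col_tableau lam = (\<lambda>x. card {y \<in> diagram lam. le y x})"
    by (auto simp: col_tableau_def le_def fun_eq_iff intro!: arg_cong[where f = card])
  note r = rank_bij[OF finite_diagram, of le]
  have "bij_betw (\<lambda>x. card {y \<in> diagram lam. le y x}) (diagram lam) {1..card (diagram lam)}"
    by (rule r(1)) (auto simp: le_def prod_eq_iff)
  then show "bij_betw (col_tableau lam) (diagram lam) {1..n}" unfolding eq card_diagram .
  assume xy: "x \<in> diagram lam" "y \<in> diagram lam"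
  have "card {z \<in> diagram lam. le z x} < card {z \<in> diagram lam. le z y} \<longleftrightarrow> le x y \<and> x \<noteq> y"
    by (rule r(2)[OF _ _ _ xy]) (auto simp: le_def prod_eq_iff)
  then show "col_tableau lam x < col_tableau lam y \<longleftrightarrow> snd x < snd y \<or> snd x = snd y \<and> fst x < fst y"
    unfolding eq by (auto simp: le_def prod_eq_iff)
qed

definition row_node :: "nat \<Rightarrow> nat \<times> nat"
  where "row_node = inv_into (diagram lam) (row_tableau lam)"

definition col_node :: "nat \<Rightarrow> nat \<times> nat"
  where "col_node = inv_into (diagram lam) (col_tableau lam)"

definition row_word :: "nat \<Rightarrow> nat"
  where "row_word p = (if p \<in> {1..n} then fst (row_node p) else 0)"

text \<open>
The word \<open>col_word\<close> encodes the tableau \<open>col_tableau\<close>, whose columns are intervals of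
positions; \<open>col_index\<close> is the column containing a position.
\<close>

definition col_word :: "nat \<Rightarrow> nat"
  where "col_word p = (if p \<in> {1..n} then fst (col_node p) else 0)"

definition col_index :: "nat \<Rightarrow> nat"
  where "col_index p = (if p \<in> {1..n} then snd (col_node p) else 0)"

lemma row_node: "p \<in> {1..n} \<Longrightarrow> row_node p \<in> diagram lam"
  "p \<in> {1..n} \<Longrightarrow> row_tableau lam (row_node p) = p"
  "x \<in> diagram lam \<Longrightarrow> row_node (row_tableau lam x) = x"
  "x \<in> diagram lam \<Longrightarrow> row_tableau lam x \<in> {1..n}"
  unfolding row_node_def using row_tableau_bij
  by (auto simp: bij_betw_def inv_into_into f_inv_into_f inv_into_f_f simp del: atLeastAtMost_iff)

lemma col_node: "p \<in> {1..n} \<Longrightarrow> col_node p \<in> diagram lam"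
  "p \<in> {1..n} \<Longrightarrow> col_tableau lam (col_node p) = p"
  "x \<in> diagram lam \<Longrightarrow> col_node (col_tableau lam x) = x"
  "x \<in> diagram lam \<Longrightarrow> col_tableau lam x \<in> {1..n}"
  unfolding col_node_def using col_tableau_bij
  by (auto simp: bij_betw_def inv_into_into f_inv_into_f inv_into_f_f simp del: atLeastAtMost_iff)

lemma col_node_eq: "p \<in> {1..n} \<Longrightarrow> col_node p = (col_word p, col_index p)"
  by (simp add: col_word_def col_index_def)

lemma col_node_mem: "p \<in> {1..n} \<Longrightarrow> (col_word p, col_index p) \<in> diagram lam"
  using col_node(1) col_node_eq by metis

lemma col_word_tableau: "(i, j) \<in> diagram lam \<Longrightarrow> col_word (col_tableau lam (i, j)) = i"
  "(i, j) \<in> diagram lam \<Longrightarrow> col_index (col_tableau lam (i, j)) = j"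
  using col_node(3,4)[of "(i, j)"] by (auto simp: col_word_def col_index_def)

lemma col_less:
  assumes "p \<in> {1..n}" "p' \<in> {1..n}"
  shows "p < p' \<longleftrightarrow> col_index p < col_index p' \<or> col_index p = col_index p' \<and> col_word p < col_word p'"
  using col_tableau_less[OF col_node_mem[OF assms(1)] col_node_mem[OF assms(2)]]
    col_node(2)[OF assms(1)] col_node(2)[OF assms(2)]
  by (simp add: col_node_eq[OF assms(1)] col_node_eq[OF assms(2)])

lemma col_eqI:
  assumes "p \<in> {1..n}" "p' \<in> {1..n}" "col_index p = col_index p'" "col_word p = col_word p'"
  shows "p = p'"
  using col_less[OF assms(1,2)] col_less[OF assms(2,1)] assms(3,4) by simp

text \<open>
Within a column the node below occupies the next position. This makes the conditions on columns
below conditions on neighbouring positions.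
\<close>

lemma col_tableau_Suc:
  assumes x: "(i, j) \<in> diagram lam" and y: "(Suc i, j) \<in> diagram lam"
  shows "col_tableau lam (Suc i, j) = Suc (col_tableau lam (i, j))"
proof (rule ccontr)
  let ?p = "col_tableau lam (i, j)" and ?p' = "col_tableau lam (Suc i, j)"
  assume ne: "?p' \<noteq> Suc ?p"
  have p: "?p \<in> {1..n}" "?p' \<in> {1..n}" using col_node(4) x y by blast+
  have "?p < ?p'" using col_tableau_less[OF x y] by simp
  then have l: "?p < Suc ?p" "Suc ?p < ?p'" using ne by auto
  then have "Suc ?p \<in> {1..n}" using p by auto
  then show False
    using l col_less[of ?p "Suc ?p"] col_less[of "Suc ?p" ?p'] p col_word_tableau[OF x] col_word_tableau[OF y]
    by auto
qed

lemma col_below: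
  assumes p: "p \<in> {1..n}" and below: "(Suc (col_word p), col_index p) \<in> diagram lam"
  shows "p \<in> {1..<n}" "col_index (Suc p) = col_index p" "col_word (Suc p) = Suc (col_word p)"
proof -
  have eq: "col_tableau lam (Suc (col_word p), col_index p) = Suc p"
    using col_tableau_Suc[OF col_node_mem[OF p] below] col_node(2)[OF p] by (simp add: col_node_eq[OF p])
  then show "p \<in> {1..<n}" using col_node(4)[OF below] p by auto
  show "col_index (Suc p) = col_index p" "col_word (Suc p) = Suc (col_word p)"
    using col_word_tableau[OF below] unfolding eq by auto
qed

lemma col_above:
  assumes p: "p \<in> {1..n}" and "1 < col_word p"
  obtains p' where "p = Suc p'" "p' \<in> {1..<n}" "col_index p' = col_index p" "col_word p = Suc (col_word p')"
proof -
  obtain i where i: "col_word p = Suc i" "1 \<le> i" using assms by (cases "col_word p") auto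
  have m: "(Suc i, col_index p) \<in> diagram lam" using col_node_mem[OF p] i by simp
  then have m': "(i, col_index p) \<in> diagram lam"
    using lam_antimono[of i "Suc i"] i by (auto simp: diagram_mem)
  let ?p' = "col_tableau lam (i, col_index p)"
  have "p = Suc ?p'"
    using col_tableau_Suc[OF m' m] col_node(2)[OF p] i by (simp add: col_node_eq[OF p])
  moreover have "?p' \<in> {1..<n}" using calculation p col_node(4)[OF m'] by auto
  ultimately show thesis using that col_word_tableau[OF m'] i by metis
qed

lemma letters_col_word: "1 \<le> r \<Longrightarrow> letters r col_word = (\<lambda>j. col_tableau lam (r, j)) ` {1..lam r}"
proof (intro equalityI subsetI)
  fix p assume "1 \<le> r" "p \<in> letters r col_word"
  then have "p \<in> {1..n}" "col_word p = r" by (auto simp: letters_def)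
  then show "p \<in> (\<lambda>j. col_tableau lam (r, j)) ` {1..lam r}"
    using col_node(2)[of p] col_node_mem[of p]
    by (intro image_eqI[of _ _ "col_index p"]) (auto simp: col_node_eq diagram_mem)
next
  fix p assume "1 \<le> r" "p \<in> (\<lambda>j. col_tableau lam (r, j)) ` {1..lam r}"
  then obtain j where "p = col_tableau lam (r, j)" "(r, j) \<in> diagram lam"
    by (auto simp: diagram_mem)
  then show "p \<in> letters r col_word"
    using col_node(4) col_word_tableau(1) by (auto simp: letters_def simp del: atLeastAtMost_iff)
qed

lemma col_word_words: "col_word \<in> words lam"
  unfolding words_def
proof (intro CollectI conjI allI ballI impI)
  show "col_word i = 0" if "i \<notin> {1..n}" for i using that by (auto simp: col_word_def)
  show "1 \<le> col_word i" if "i \<in> {1..n}" for i using col_node_mem[OF that] by (auto simp: diagram_mem)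
  show "card (letters r col_word) = lam r" if "1 \<le> r" for r
  proof -
    have "inj_on (\<lambda>j. col_tableau lam (r, j)) {1..lam r}"
      using that by (intro inj_onI) (metis atLeastAtMost_iff col_word_tableau(2) diagram_mem)
    then show ?thesis by (simp add: letters_col_word[OF that] card_image)
  qed
qed

lemma row_word_words: "row_word \<in> words lam"
  unfolding words_def
proof (intro CollectI conjI allI ballI impI)
  show "row_word i = 0" if "i \<notin> {1..n}" for i using that by (auto simp: row_word_def)
  show "1 \<le> row_word i" if "i \<in> {1..n}" for i
    using row_node(1)[OF that] that by (auto simp: row_word_def diagram_def)
  show "card (letters r row_word) = lam r" if "1 \<le> r" for r
  proof -
    have "bij_betw snd (row_node ` letters r row_word) {1..lam r}"
      unfolding bij_betw_def
    proof
      have m: "row_node p \<in> diagram lam" "fst (row_node p) = r" if "p \<in> letters r row_word" for p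
        using that row_node(1)[of p] by (auto simp: letters_def row_word_def split: if_splits)
      then show "inj_on snd (row_node ` letters r row_word)"
        by (auto simp: inj_on_def prod_eq_iff)
      show "snd ` row_node ` letters r row_word = {1..lam r}"
      proof (intro equalityI subsetI)
        fix j assume "j \<in> snd ` row_node ` letters r row_word"
        then show "j \<in> {1..lam r}" using m by (force simp: diagram_def)
      next
        fix j assume "j \<in> {1..lam r}"
        then have d: "(r, j) \<in> diagram lam" using \<open>1 \<le> r\<close> by (simp add: diagram_mem)
        then have "row_tableau lam (r, j) \<in> letters r row_word"
          using row_node(3,4)[OF d] by (simp add: letters_def row_word_def)
        then show "j \<in> snd ` row_node ` letters r row_word"
          using row_node(3)[OF d] by (metis image_eqI snd_conv)
      qed
    qed
    moreover have "inj_on row_node (letters r row_word)"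
      by (rule inj_on_subset[of _ "{1..n}"]) (auto simp: letters_def intro!: inj_onI dest: row_node(2), metis row_node(2) atLeastAtMost_iff One_nat_def)
    ultimately show ?thesis
      by (metis bij_betw_same_card card_atLeastAtMost card_image diff_Suc_1)
  qed
qed

lemma row_word_mono: "\<lbrakk>p \<in> {1..n}; p' \<in> {1..n}; p \<le> p'\<rbrakk> \<Longrightarrow> row_word p \<le> row_word p'"
  using row_tableau_less[OF row_node(1) row_node(1), of p p'] row_node(2)
  by (cases "p = p'") (auto simp: row_word_def)

definition alternating_columns :: "((nat \<Rightarrow> nat) \<Rightarrow> 'f) \<Rightarrow> bool"
  where "alternating_columns v \<longleftrightarrow>
    (\<forall>k\<in>{1..<n}. col_index k = col_index (Suc k) \<longrightarrow> alternating k v)"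

definition increasing_columns :: "(nat \<Rightarrow> nat) \<Rightarrow> bool"
  where "increasing_columns w \<longleftrightarrow>
    (\<forall>k\<in>{1..<n}. col_index k = col_index (Suc k) \<longrightarrow> w k < w (Suc k))"

text \<open>
Swapping a descent within a column preserves nonvanishing and enlarges the word, so the largest
word in the support strictly increases along columns.
\<close>

lemma alternating_columns_eq_0:
  assumes fin: "finite {w. v w \<noteq> 0}" and alt: "alternating_columns v"
    and zero: "\<And>w. increasing_columns w \<Longrightarrow> v w = 0"
  shows "v w = 0"
proof (rule ccontr)
  assume "v w \<noteq> 0"
  then have "{w. v w \<noteq> 0} \<noteq> {}" by blast
  then obtain w where w: "v w \<noteq> 0" and max: "\<And>x. v x \<noteq> 0 \<Longrightarrow> \<not> colex_less w x"
    using colex_max[OF fin] by (metis (mono_tags, lifting) mem_Collect_eq)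
  have "increasing_columns w"
    unfolding increasing_columns_def
  proof (intro ballI impI)
    fix k assume k: "k \<in> {1..<n}" "col_index k = col_index (Suc k)"
    then have a: "alternating k v" using alt by (simp add: alternating_columns_def)
    then have "w k \<noteq> w (Suc k)" using w by (auto simp: alternating_def)
    moreover have "\<not> w (Suc k) < w k"
    proof
      assume l: "w (Suc k) < w k"
      then have "v (w \<circ> simple_refl k \<circ> simple_refl k) = - v (w \<circ> simple_refl k) / q"
        using a unfolding alternating_def by (metis comp_apply simple_refl_simps(1,2))
      then have "v (w \<circ> simple_refl k) \<noteq> 0" using w by auto
      moreover have "colex_less w (w \<circ> simple_refl k)"
        unfolding colex_less_def using l by (intro exI[of _ "Suc k"]) auto
      ultimately show False using max by blast
    qed
    ultimately show "w k < w (Suc k)" by linarith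
  qed
  then show False using zero w by blast
qed

lemma alternating_columns_move:
  "\<lbrakk>d = Suc c \<or> c = Suc d; alternating_columns v\<rbrakk> \<Longrightarrow> alternating_columns (move c d m v)"
  by (simp add: alternating_columns_def alternating_move)

lemma increasing_columns_ge:
  assumes w: "increasing_columns w" "\<And>i. i \<in> {1..n} \<Longrightarrow> 1 \<le> w i" and p: "p \<in> {1..n}"
  shows "col_word p \<le> w p"
  using p
proof (induction p)
  case (Suc p)
  show ?case
  proof (cases "1 < col_word (Suc p)")
    case True
    then obtain p' where "Suc p = Suc p'" "p' \<in> {1..<n}" "col_index p' = col_index (Suc p)"
      "col_word (Suc p) = Suc (col_word p')" using col_above[OF Suc.prems] by metis
    then have "p \<in> {1..<n}" "col_index p = col_index (Suc p)" "col_word (Suc p) = Suc (col_word p)" by auto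
    then have "w p < w (Suc p)" "col_word p \<le> w p"
      using w(1) Suc.IH by (auto simp: increasing_columns_def)
    then show ?thesis using \<open>col_word (Suc p) = Suc (col_word p)\<close> by simp
  next
    case False
    then show ?thesis using w(2)[OF Suc.prems] by simp
  qed
qed simp

text \<open>
Along a column of positive strictly increasing letters the letter in row \<open>i\<close> is at least \<open>i\<close>. Thus a word with
increasing columns is bounded below by \<open>col_word\<close>, position by position, and its content is
dominated by \<open>lam\<close>.
\<close>

lemma increasing_columns_count:
  assumes w: "increasing_columns w" "\<And>i. i \<in> {1..n} \<Longrightarrow> 1 \<le> w i"
  shows "card {p \<in> {1..n}. w p \<le> r} \<le> card {p \<in> {1..n}. col_word p \<le> r}"
    and "card {p \<in> {1..n}. w p \<le> r} = card {p \<in> {1..n}. col_word p \<le> r}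
      \<Longrightarrow> p \<in> {1..n} \<Longrightarrow> w p \<le> r \<longleftrightarrow> col_word p \<le> r"
proof -
  have sub: "{p \<in> {1..n}. w p \<le> r} \<subseteq> {p \<in> {1..n}. col_word p \<le> r}"
    using increasing_columns_ge[OF w] order_trans by blast
  then show "card {p \<in> {1..n}. w p \<le> r} \<le> card {p \<in> {1..n}. col_word p \<le> r}"
    by (intro card_mono) simp_all
  assume "card {p \<in> {1..n}. w p \<le> r} = card {p \<in> {1..n}. col_word p \<le> r}" "p \<in> {1..n}"
  then show "w p \<le> r \<longleftrightarrow> col_word p \<le> r" using card_subset_eq[OF _ sub] by fastforce
qed

definition col_stab :: "(nat \<Rightarrow> nat) set"
  where "col_stab = {w. w permutes {1..n} \<and> (\<forall>p. col_index (w p) = col_index p)}"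

text \<open>
The coordinates of the generator of the Specht module (\<open>realize_polytabloid\<close>): the column word
times the signed sum over the column stabilizer.
\<close>

definition polytabloid :: "(nat \<Rightarrow> nat) \<Rightarrow> 'f"
  where "polytabloid x =
    (\<Sum>w\<in>col_stab. if col_word \<circ> inv w = x then (- q) powi (- int (perm_length n w)) else 0)"

lemma finite_col_stab: "finite col_stab"
  using finite_permutations[of "{1..n}"] by (auto simp: col_stab_def intro: finite_subset[rotated])

lemma col_stab_inv:
  assumes "w \<in> col_stab"
  shows "col_index (inv w p) = col_index p"
  using assms permutes_inverses(1)[of w "{1..n}"] by (auto simp: col_stab_def) (metis)

lemma col_stab_order:
  assumes w: "w \<in> col_stab" and ij: "i < j" "w j < w i"
  shows "col_word i < col_word j"
proof -
  have p: "w permutes {1..n}" and c: "\<And>p. col_index (w p) = col_index p"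
    using w by (auto simp: col_stab_def)
  have i: "i \<in> {1..n}" and j: "j \<in> {1..n}" using permutes_inverted_pair[OF p ij] by blast+
  have wi: "w i \<in> {1..n}" "w j \<in> {1..n}" using i j permutes_in_image[OF p] by blast+
  show ?thesis
    using col_less[OF i j] col_less[OF wi(2,1)] ij c by auto
qed

lemma polytabloid_support:
  assumes "polytabloid x \<noteq> 0"
  obtains w where "w \<in> col_stab" "x = col_word \<circ> inv w"
proof (rule ccontr)
  assume "\<not> thesis"
  then have "polytabloid x = 0"
    unfolding polytabloid_def using that by (intro sum.neutral ballI if_not_P) blast
  then show False using assms by simp
qed

lemma polytabloid_dominated:
  assumes "polytabloid x \<noteq> 0"
  shows "dominated x col_word"
proof -
  obtain w where w: "w \<in> col_stab" "x = col_word \<circ> inv w"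
    using assms polytabloid_support by blast
  then have "w permutes {1..n}" by (simp add: col_stab_def)
  then have "dominated (col_word \<circ> inv w) col_word"
  proof (induction rule: perm_up_induct_rel[where R = "\<lambda>i j. col_word i < col_word j"])
    case (up w k)
    let ?x = "col_word \<circ> inv w"
    have "dominated (?x \<circ> simple_refl k) (?x \<circ> simple_refl k \<circ> simple_refl k)"
      by (rule dominated_swap(1)[OF up(2)]) (use up(4) in auto)
    then have "dominated (?x \<circ> simple_refl k) ?x" by (simp only: simple_refl_comp)
    then have "dominated (?x \<circ> simple_refl k) col_word" using up(5) by (rule dominated_trans)
    then show ?case by (simp only: inv_pmul_simple_refl[OF up(1,2)] comp_assoc)
  qed (use w col_stab_order in auto)
  then show ?thesis using w by simp
qed

lemma polytabloid_col_word: "polytabloid col_word = 1"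
proof -
  have "w = id" if w: "w \<in> col_stab" "col_word \<circ> inv w = col_word" for w
  proof -
    have p: "w permutes {1..n}" using w by (simp add: col_stab_def)
    have "inv w i = i" for i
    proof (cases "i \<in> {1..n}")
      case True
      then have "inv w i \<in> {1..n}" using permutes_in_image[OF permutes_inv[OF p]] by blast
      then show ?thesis
        using True col_stab_inv[OF w(1)] fun_cong[OF w(2), of i]
        by - (rule col_eqI, simp_all)
    next
      case False
      then show ?thesis by (rule permutes_not_in[OF permutes_inv[OF p]])
    qed
    then have "inv w = id" by (simp add: fun_eq_iff)
    then show ?thesis using permutes_inv_inv[OF p] by simp
  qed
  moreover have "id \<in> col_stab" by (auto simp: col_stab_def permutes_id)
  moreover have "perm_length n id = 0"
    by (simp add: perm_length_eq_inversions permutes_id inversions_def pair_count_def inv_id)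
      (auto simp: card_eq_0_iff)
  ultimately have "(\<Sum>w\<in>col_stab. if col_word \<circ> inv w = col_word then (- q) powi (- int (perm_length n w)) else 0)
      = (\<Sum>w\<in>{id :: nat \<Rightarrow> nat}. 1)"
    using finite_col_stab by (intro sum.mono_neutral_cong_right) auto
  then show ?thesis by (simp add: polytabloid_def)
qed

lemma polytabloid_leading: "leading polytabloid col_word"
  by (simp add: leading_def polytabloid_col_word polytabloid_dominated)

lemma polytabloid_words: "{x. polytabloid x \<noteq> 0} \<subseteq> words lam"
proof
  fix x assume "x \<in> {x. polytabloid x \<noteq> 0}"
  then obtain w where "w \<in> col_stab" "x = col_word \<circ> inv w"
    using polytabloid_support by blast
  then show "x \<in> words lam" using permute_words col_word_words by (simp add: col_stab_def)
qed

text \<open>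
Right multiplication by the simple reflection permutes the column stabilizer and changes the length by one.
\<close>

lemma polytabloid_alternating: "alternating_columns polytabloid"
  unfolding alternating_columns_def alternating_def
proof (intro ballI impI conjI allI)
  fix k x assume k: "k \<in> {1..<n}" and c: "col_index k = col_index (Suc k)"
  have in_col: "col_word (inv w k) < col_word (inv w (Suc k)) \<longleftrightarrow> inv w k < inv w (Suc k)"
    "col_word (inv w k) \<noteq> col_word (inv w (Suc k))" if w: "w \<in> col_stab" for w
  proof -
    have p: "w permutes {1..n}" using w by (simp add: col_stab_def)
    have m: "inv w k \<in> {1..n}" "inv w (Suc k) \<in> {1..n}"
      using permutes_in_image[OF permutes_inv[OF p]] k by auto
    have i: "col_index (inv w k) = col_index (inv w (Suc k))" using col_stab_inv[OF w] c by simp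
    show "col_word (inv w k) < col_word (inv w (Suc k)) \<longleftrightarrow> inv w k < inv w (Suc k)"
      using col_less[OF m] i by simp
    show "col_word (inv w k) \<noteq> col_word (inv w (Suc k))"
      using col_eqI[OF m i] inv_ne[OF p] by blast
  qed
  show "polytabloid x = 0" if "x k = x (Suc k)"
    unfolding polytabloid_def
  proof (intro sum.neutral ballI)
    fix w assume "w \<in> col_stab"
    then show "(if col_word \<circ> inv w = x then (- q) powi (- int (perm_length n w)) else 0) = 0"
      using in_col(2)[of w] that by auto
  qed
  show "polytabloid (x \<circ> simple_refl k) = - polytabloid x / q" if x: "x k < x (Suc k)"
  proof -
    have mem: "w \<cdot> simple_refl k \<in> col_stab" if "w \<in> col_stab" for w
    proof -
      have "col_index (simple_refl k i) = col_index i" for i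
        using c by (auto simp: simple_refl_def transpose_def)
      then show ?thesis
        using that pmul_simple_refl_permutes[OF _ k] by (auto simp: col_stab_def pmul_def)
    qed
    have bij: "bij_betw (\<lambda>w. w \<cdot> simple_refl k) col_stab col_stab"
      by (rule bij_betwI[where g = "\<lambda>w. w \<cdot> simple_refl k"]) (auto simp: mem)
    have "polytabloid (x \<circ> simple_refl k) = (\<Sum>w\<in>col_stab.
        if col_word \<circ> inv (w \<cdot> simple_refl k) = x \<circ> simple_refl k
        then (- q) powi (- int (perm_length n (w \<cdot> simple_refl k))) else 0)"
      unfolding polytabloid_def by (rule sum.reindex_bij_betw[OF bij, symmetric])
    also have "\<dots> = (\<Sum>w\<in>col_stab. if col_word \<circ> inv w = x
        then (- 1 / q) * (- q) powi (- int (perm_length n w)) else 0)"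
    proof (intro sum.cong refl)
      fix w assume w: "w \<in> col_stab"
      then have p: "w permutes {1..n}" by (simp add: col_stab_def)
      have iff: "col_word \<circ> inv (w \<cdot> simple_refl k) = x \<circ> simple_refl k \<longleftrightarrow> col_word \<circ> inv w = x"
      proof
        assume h: "col_word \<circ> inv (w \<cdot> simple_refl k) = x \<circ> simple_refl k"
        show "col_word \<circ> inv w = x"
        proof
          fix i show "(col_word \<circ> inv w) i = x i"
            using fun_cong[OF h, of "simple_refl k i"] by (simp add: inv_pmul_simple_refl[OF p k])
        qed
      qed (simp add: inv_pmul_simple_refl[OF p k] flip: comp_assoc)
      show "(if col_word \<circ> inv (w \<cdot> simple_refl k) = x \<circ> simple_refl k
          then (- q) powi (- int (perm_length n (w \<cdot> simple_refl k))) else 0)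
        = (if col_word \<circ> inv w = x then (- 1 / q) * (- q) powi (- int (perm_length n w)) else 0)"
      proof (cases "col_word \<circ> inv w = x")
        case True
        then have "inv w k < inv w (Suc k)" using in_col(1)[OF w] x by auto
        then have "perm_length n (w \<cdot> simple_refl k) = perm_length n w + 1"
          using perm_length_up[OF p k] by simp
        then have "(- q) powi (- int (perm_length n (w \<cdot> simple_refl k)))
            = (- 1 / q) * (- q) powi (- int (perm_length n w))"
          unfolding power_int_minus power_int_of_nat using q_nonzero by (simp add: field_simps)
        then show ?thesis using True iff by simp
      qed (simp add: iff)
    qed
    also have "\<dots> = (- 1 / q) * polytabloid x"
      unfolding polytabloid_def sum_distrib_left by (intro sum.cong refl) auto
    finally show ?thesis by simp
  qed
qed

lemma words_count:
  assumes "x \<in> words mu"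
  shows "card {p \<in> {1..n}. x p \<le> r} = (\<Sum>i=1..r. mu i)"
proof -
  have "{p \<in> {1..n}. x p \<le> r} = (\<Union>i\<in>{1..r}. letters i x)"
    using wordsD(2)[OF assms] by (auto simp: letters_def)
  also have "card \<dots> = (\<Sum>i=1..r. card (letters i x))"
    by (rule card_UN_disjoint) (auto simp: letters_def)
  also have "\<dots> = (\<Sum>i=1..r. mu i)" using wordsD(3)[OF assms] by (intro sum.cong) auto
  finally show ?thesis .
qed

lemma ballot_mono:
  assumes "ballot w" "1 \<le> b" "b \<le> c"
  shows "card {i \<in> letters c w. i \<le> p} \<le> card {i \<in> letters b w. i \<le> p}"
  using assms(3)
proof (induction c rule: dec_induct)
  case (step c)
  then show ?case using assms(1,2) unfolding ballot_def by (meson order_trans)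
qed simp

text \<open>
Send the \<open>i\<close>-th occurrence of the letter \<open>r\<close> in \<open>w\<close> to the node \<open>(r, i)\<close>. If two positions
come in the wrong column order, the ballot condition forces the earlier one to carry the smaller letter: for
a larger letter \<open>w p > w p'\<close>, the letter \<open>w p'\<close> has already occurred before \<open>p\<close> at least as often as \<open>w p\<close>.
So \<open>w\<close> arises from \<open>col_word\<close> by successively turning descents into ascents.
\<close>

lemma ballot_perm:
  assumes w: "w \<in> words lam" and bal: "ballot w"
  obtains u where "u permutes {1..n}" "w = col_word \<circ> inv u"
    "\<And>i j. i < j \<Longrightarrow> u j < u i \<Longrightarrow> col_word j < col_word i"
proof -
  define occ where "occ p = card {i \<in> letters (w p) w. i \<le> p}" for p
  define t where "t p = (if p \<in> {1..n} then col_tableau lam (w p, occ p) else p)" for p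
  have mem: "(w p, occ p) \<in> diagram lam" if p: "p \<in> {1..n}" for p
  proof -
    have "p \<in> {i \<in> letters (w p) w. i \<le> p}" using p by (simp add: letters_def)
    then have "occ p \<noteq> 0" by (auto simp: occ_def card_eq_0_iff)
    moreover have "occ p \<le> card (letters (w p) w)" unfolding occ_def by (intro card_mono) auto
    ultimately show ?thesis
      using wordsD(2,3)[OF w] p by (simp add: diagram_mem)
  qed
  have occ_less: "occ p < occ p'" if "p < p'" "w p = w p'" "p' \<in> {1..n}" for p p'
    unfolding occ_def
  proof (rule psubset_card_mono)
    have "p' \<in> {i \<in> letters (w p') w. i \<le> p'}" "p' \<notin> {i \<in> letters (w p) w. i \<le> p}"
      using that by (simp_all add: letters_def)
    moreover have "{i \<in> letters (w p) w. i \<le> p} \<subseteq> {i \<in> letters (w p') w. i \<le> p'}" using that by auto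
    ultimately show "{i \<in> letters (w p) w. i \<le> p} \<subset> {i \<in> letters (w p') w. i \<le> p'}" by blast
  qed simp
  have tm: "t p \<in> {1..n}" if "p \<in> {1..n}" for p using col_node(4)[OF mem[OF that]] that by (simp add: t_def)
  have tw: "col_word (t p) = w p" "col_index (t p) = occ p" if "p \<in> {1..n}" for p
    using col_word_tableau[OF mem[OF that]] that by (simp_all add: t_def)
  have inj: "inj_on t {1..n}"
  proof (rule inj_onI)
    fix p p' assume p: "p \<in> {1..n}" "p' \<in> {1..n}" "t p = t p'"
    then have "w p = w p'" "occ p = occ p'" using tw by metis+
    then show "p = p'" using occ_less[of p p'] occ_less[of p' p] p by (metis less_irrefl linorder_neqE_nat)
  qed
  have "t ` {1..n} = {1..n}" by (rule endo_inj_surj) (use tm inj in auto)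
  then have "bij_betw t {1..n} {1..n}" using inj by (simp add: bij_betw_def)
  then have t: "t permutes {1..n}" by (rule bij_imp_permutes) (simp only: t_def if_False)
  have wt: "w = col_word \<circ> t"
  proof
    fix p show "w p = (col_word \<circ> t) p"
      using tw(1)[of p] wordsD(1)[OF w, of p] by (cases "p \<in> {1..n}") (auto simp: t_def col_word_def)
  qed
  have order: "w p < w p'" if p: "p \<in> {1..n}" "p' \<in> {1..n}" "p < p'" "t p' < t p" for p p'
  proof -
    have lex: "occ p' < occ p \<or> occ p' = occ p \<and> w p' < w p"
      using col_less[OF tm[OF p(2)] tm[OF p(1)]] p tw by simp
    show ?thesis
    proof (rule ccontr)
      assume "\<not> w p < w p'"
      then have le: "w p' \<le> w p" by simp
      show False
      proof (cases "w p' = w p")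
        case True
        then show False using occ_less[of p p'] p lex by simp
      next
        case False
        have "occ p \<le> card {i \<in> letters (w p') w. i \<le> p}"
          unfolding occ_def by (rule ballot_mono[OF bal wordsD(2)[OF w p(2)] le])
        also have "\<dots> < occ p'"
          unfolding occ_def
        proof (rule psubset_card_mono)
          have "p' \<in> {i \<in> letters (w p') w. i \<le> p'}" using p by (simp add: letters_def)
          moreover have "p' \<notin> {i \<in> letters (w p') w. i \<le> p}" using p(3) by simp
          moreover have "{i \<in> letters (w p') w. i \<le> p} \<subseteq> {i \<in> letters (w p') w. i \<le> p'}"
            using p(3) by auto
          ultimately show "{i \<in> letters (w p') w. i \<le> p} \<subset> {i \<in> letters (w p') w. i \<le> p'}"
            by blast
        qed simp
        finally show False using lex by simp
      qed
    qed
  qed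
  show thesis
  proof (rule that)
    show u: "inv t permutes {1..n}" by (rule permutes_inv[OF t])
    show "w = col_word \<circ> inv (inv t)" using wt permutes_inv_inv[OF t] by simp
    fix i j assume ij: "i < j" "inv t j < inv t i"
    have i: "i \<in> {1..n}" and j: "j \<in> {1..n}" using permutes_inverted_pair[OF u ij] by blast+
    have p: "inv t j \<in> {1..n}" "inv t i \<in> {1..n}" using permutes_in_image[OF u] i j by blast+
    have "w (inv t j) < w (inv t i)"
      by (rule order[OF p ij(2)]) (use ij(1) permutes_inverses[OF t] in simp)
    then show "col_word j < col_word i" using wt permutes_inverses[OF t] by simp
  qed
qed

end

section \<open>Shifting nodes between two adjacent rows\<close>

text \<open>
The content obtained when \<open>m\<close> letters \<open>b + 1\<close> become \<open>b\<close>. It describes both the effect of a raising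
operator and the passage from \<open>\<mu>\<close> to \<open>\<lambda>\<close>.
\<close>

definition shift_up :: "nat \<Rightarrow> nat \<Rightarrow> (nat \<Rightarrow> nat) \<Rightarrow> nat \<Rightarrow> nat"
  where "shift_up b m mu = mu(b := mu b + m, Suc b := mu (Suc b) - m)"

lemma sum_shift_up:
  assumes "1 \<le> b" "m \<le> mu (Suc b)"
  shows "(\<Sum>i=1..r. shift_up b m mu i) = (\<Sum>i=1..r. mu i) + (if r = b then m else 0)"
proof (induction r)
  case 0
  then show ?case using assms by simp
next
  case (Suc r)
  then show ?case using assms by (auto simp: shift_up_def)
qed

lemma crossings_all:
  assumes "\<And>i j. i \<in> B \<Longrightarrow> j \<in> A \<Longrightarrow> i < j"
  shows "crossings B A = card B * card A"
proof -
  have "{(i, j). i \<in> B \<and> j \<in> A \<and> i < j} = B \<times> A" using assms by auto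
  then show ?thesis by (simp add: crossings_def card_cartesian_product)
qed

context word_module
begin

lemma words_relabel:
  assumes w: "relabel B d w \<in> words nu" and B: "B \<subseteq> letters c w" and cd: "c \<noteq> d" "1 \<le> c" "1 \<le> d"
  shows "w \<in> words (nu(c := nu c + card B, d := nu d - card B))" and "card B \<le> nu d"
proof -
  have finB: "finite B" using B by (rule finite_subset) simp
  have c: "letters c w = letters c (relabel B d w) \<union> B" "letters c (relabel B d w) \<inter> B = {}"
    and d: "letters d (relabel B d w) = letters d w \<union> B" "letters d w \<inter> B = {}"
    using B cd by (auto simp: letters_def relabel_def)
  have cc: "card (letters c w) = nu c + card B"
    using wordsD(3)[OF w cd(2)] c finB by (simp add: card_Un_disjoint)
  have dd: "nu d = card (letters d w) + card B"
    using wordsD(3)[OF w cd(3)] d finB by (simp add: card_Un_disjoint)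
  then show "card B \<le> nu d" by simp
  have other: "letters r w = letters r (relabel B d w)" if "r \<noteq> c" "r \<noteq> d" for r
    using B that by (auto simp: letters_def relabel_def)
  have "w i = 0" if "i \<notin> {1..n}" for i
  proof -
    have "i \<notin> B" using B that by (auto simp: letters_def)
    then show ?thesis using wordsD(1)[OF w that] by (simp add: relabel_def)
  qed
  moreover have "1 \<le> w i" if "i \<in> {1..n}" for i
  proof (cases "i \<in> B")
    case True
    then show ?thesis using B cd by (auto simp: letters_def)
  next
    case False
    then show ?thesis using wordsD(2)[OF w that] by (simp add: relabel_def)
  qed
  moreover have "card (letters r w) = (nu(c := nu c + card B, d := nu d - card B)) r" if "1 \<le> r" for r
    using cc dd other[of r] wordsD(3)[OF w that] by auto
  ultimately show "w \<in> words (nu(c := nu c + card B, d := nu d - card B))"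
    unfolding words_def by blast
qed

lemma move_words:
  assumes supp: "{x. v x \<noteq> 0} \<subseteq> words nu" and cd: "c \<noteq> d" "1 \<le> c" "1 \<le> d" and x: "move c d m v x \<noteq> 0"
  shows "x \<in> words (nu(c := nu c + m, d := nu d - m))" and "m \<le> nu d"
proof -
  have "\<exists>B\<in>ksubsets (letters c x) m. v (relabel B d x) \<noteq> 0"
  proof (rule ccontr)
    assume "\<not> ?thesis"
    then have "move c d m v x = 0" unfolding move_def by (intro sum.neutral) auto
    then show False using x by simp
  qed
  then obtain B where B: "B \<subseteq> letters c x" "card B = m" "v (relabel B d x) \<noteq> 0"
    by (auto simp: ksubsets_def)
  then have "relabel B d x \<in> words nu" using supp by auto
  then show "x \<in> words (nu(c := nu c + m, d := nu d - m))" "m \<le> nu d"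
    using words_relabel[OF _ B(1) cd] B(2) by auto
qed

lemma move_up_words:
  assumes "{x. v x \<noteq> 0} \<subseteq> words nu" "1 \<le> b" "move b (Suc b) m v x \<noteq> 0"
  shows "x \<in> words (shift_up b m nu)" "m \<le> nu (Suc b)"
  unfolding shift_up_def using move_words[OF assms(1) _ _ _ assms(3)] assms(2) by auto

lemma finite_shift_up: "finite {r. nu r \<noteq> 0} \<Longrightarrow> finite {r. shift_up b m nu r \<noteq> 0}"
  by (rule finite_subset[of _ "insert b (insert (Suc b) {r. nu r \<noteq> 0})"]) (auto simp: shift_up_def)

end

context partition_words
begin

text \<open>
An image under a raising operator is again alternating on columns, so it suffices to look at its values on words with
increasing columns, and there the content must be dominated by \<open>lam\<close>.
\<close>

lemma alternating_columns_move_up_eq_0: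
  assumes fin: "finite {r. nu r \<noteq> 0}" and supp: "{x. v x \<noteq> 0} \<subseteq> words nu"
    and alt: "alternating_columns v" and b: "1 \<le> b"
    and zero: "\<And>w. \<lbrakk>increasing_columns w; w \<in> words (shift_up b m nu); m \<le> nu (Suc b);
        \<And>r. (\<Sum>i=1..r. nu i) + (if r = b then m else 0) \<le> (\<Sum>i=1..r. lam i)\<rbrakk>
      \<Longrightarrow> move b (Suc b) m v w = 0"
  shows "move b (Suc b) m v = (\<lambda>_. 0)"
proof
  fix w
  show "move b (Suc b) m v w = 0"
  proof (rule alternating_columns_eq_0[where v = "move b (Suc b) m v"])
    have "{w. move b (Suc b) m v w \<noteq> 0} \<subseteq> words (shift_up b m nu)"
      using move_up_words(1)[OF supp b] by blast
    then show "finite {w. move b (Suc b) m v w \<noteq> 0}"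
      using finite_words[OF finite_shift_up[OF fin]] finite_subset by blast
    show "alternating_columns (move b (Suc b) m v)" using alt by (intro alternating_columns_move) auto
    fix w assume inc: "increasing_columns w"
    show "move b (Suc b) m v w = 0"
    proof (rule ccontr)
      assume nz: "move b (Suc b) m v w \<noteq> 0"
      note ww = move_up_words[OF supp b nz]
      have "(\<Sum>i=1..r. nu i) + (if r = b then m else 0) \<le> (\<Sum>i=1..r. lam i)" for r
        using increasing_columns_count(1)[OF inc wordsD(2)[OF ww(1)], of r]
        unfolding words_count[OF ww(1)] words_count[OF col_word_words]
          sum_shift_up[where mu = nu, OF b ww(2)] .
      then show False using zero[OF inc ww] nz by simp
    qed
  qed
qed

lemma polytabloid_highest: "highest polytabloid"
  unfolding highest_def
proof (intro allI impI)
  fix b m :: nat assume b: "1 \<le> b" and m: "1 \<le> m"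
  show "move b (Suc b) m polytabloid = (\<lambda>_. 0)"
  proof (rule alternating_columns_move_up_eq_0[OF finite_lam polytabloid_words polytabloid_alternating b])
    fix w assume "increasing_columns w" "w \<in> words (shift_up b m lam)" "m \<le> lam (Suc b)"
      and le: "\<And>r. (\<Sum>i=1..r. lam i) + (if r = b then m else 0) \<le> (\<Sum>i=1..r. lam i)"
    from le[of b] show "move b (Suc b) m polytabloid w = 0" using m by simp
  qed
qed

text \<open>
The bottom positions of the columns of height exactly \<open>a\<close>. Only there can a letter \<open>a\<close> be turned into
\<open>a + 1\<close> without repeating a letter in a column.
\<close>

definition free_feet :: "nat \<Rightarrow> nat set"
  where "free_feet a = {p \<in> letters a col_word. (Suc a, col_index p) \<notin> diagram lam}"

lemma card_free_feet:
  assumes a: "1 \<le> a"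
  shows "card (free_feet a) = lam a - lam (Suc a)"
proof -
  have "free_feet a = (\<lambda>j. col_tableau lam (a, j)) ` {lam (Suc a)<..lam a}"
  proof (intro equalityI subsetI)
    fix p assume "p \<in> free_feet a"
    then have p: "p \<in> letters a col_word" "(Suc a, col_index p) \<notin> diagram lam" by (auto simp: free_feet_def)
    then obtain j where j: "p = col_tableau lam (a, j)" "j \<in> {1..lam a}"
      using letters_col_word[OF a] by auto
    then have "(a, j) \<in> diagram lam" using a by (simp add: diagram_mem)
    then have "col_index p = j" using j col_word_tableau by simp
    then show "p \<in> (\<lambda>j. col_tableau lam (a, j)) ` {lam (Suc a)<..lam a}"
      using p j by (auto simp: diagram_mem)
  next
    fix p assume "p \<in> (\<lambda>j. col_tableau lam (a, j)) ` {lam (Suc a)<..lam a}"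
    then obtain j where j: "p = col_tableau lam (a, j)" "lam (Suc a) < j" "j \<le> lam a" by auto
    then have d: "(a, j) \<in> diagram lam" using a by (simp add: diagram_mem)
    then have "p \<in> letters a col_word" unfolding letters_col_word[OF a] using j by (auto simp: diagram_mem)
    then show "p \<in> free_feet a" using j col_word_tableau(2)[OF d] by (simp add: free_feet_def diagram_mem)
  qed
  moreover have "inj_on (\<lambda>j. col_tableau lam (a, j)) {lam (Suc a)<..lam a}"
  proof (rule inj_onI)
    fix i j assume ij: "i \<in> {lam (Suc a)<..lam a}" "j \<in> {lam (Suc a)<..lam a}"
      "col_tableau lam (a, i) = col_tableau lam (a, j)"
    then have "(a, i) \<in> diagram lam" "(a, j) \<in> diagram lam" using a by (auto simp: diagram_mem)
    then show "i = j" using ij(3) col_word_tableau(2) by metis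
  qed
  ultimately show ?thesis by (simp add: card_image)
qed

lemma finite_free_feet [simp]: "finite (free_feet a)"
  by (simp add: free_feet_def)

lemma free_feetD:
  assumes "p \<in> free_feet a"
  shows "p \<in> {1..n}" "col_word p = a" "(Suc a, col_index p) \<notin> diagram lam"
  using assms by (auto simp: free_feet_def letters_def)

lemma less_free_feet:
  assumes p: "p \<in> free_feet a" and x: "x \<in> {1..n}" "(Suc a, col_index x) \<in> diagram lam"
  shows "x < p"
proof -
  have "1 \<le> col_index p" using col_node_mem[OF free_feetD(1)[OF p]] by (simp add: diagram_mem)
  then have "col_index x < col_index p" using free_feetD(3)[OF p] x(2) by (auto simp: diagram_mem)
  then show ?thesis using col_less[OF x(1) free_feetD(1)[OF p]] by simp
qed

text \<open>
If the content agrees with \<open>lam\<close> outside the rows \<open>a\<close> and \<open>a + 1\<close>, equality holds in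
\<open>increasing_columns_count\<close> for all \<open>r \<noteq> a\<close>, which fixes every letter of the word except those at
the free feet.
\<close>

lemma increasing_columns_one_row:
  assumes a: "1 \<le> a" and inc: "increasing_columns w" and w: "w \<in> words nu"
    and count: "\<And>r. r \<noteq> a \<Longrightarrow> (\<Sum>i=1..r. nu i) = (\<Sum>i=1..r. lam i)"
  obtains J where "J \<subseteq> free_feet a" "w = relabel J (Suc a) col_word"
proof -
  define J where "J = {p \<in> letters a col_word. w p = Suc a}"
  have le: "w p \<le> r \<longleftrightarrow> col_word p \<le> r" if "p \<in> {1..n}" "r \<noteq> a" for p r
    by (rule increasing_columns_count(2)[OF inc wordsD(2)[OF w] _ that(1)])
      (simp_all only: words_count[OF w] words_count[OF col_word_words] count[OF that(2)])
  have ge: "col_word p \<le> w p" if "p \<in> {1..n}" for p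
    by (rule increasing_columns_ge[OF inc wordsD(2)[OF w] that])
  have "w p = relabel J (Suc a) col_word p" for p
  proof (cases "p \<in> {1..n}")
    case False
    then show ?thesis using wordsD(1)[OF w False] wordsD(1)[OF col_word_words False]
      by (auto simp: relabel_def J_def letters_def)
  next
    case True
    show ?thesis
    proof (cases "col_word p = a")
      case False
      then have "w p = col_word p" using le[OF True False] ge[OF True] by simp
      then show ?thesis using False by (simp add: relabel_def J_def letters_def)
    next
      case a: True
      then have "w p \<le> Suc a" "a \<le> w p" using le[OF True, of "Suc a"] ge[OF True] by simp_all
      then show ?thesis using a True by (auto simp: relabel_def J_def letters_def)
    qed
  qed
  then have eq: "w = relabel J (Suc a) col_word" by blast
  have "J \<subseteq> free_feet a"
  proof
    fix p assume p: "p \<in> J"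
    then have p': "p \<in> {1..n}" "col_word p = a" by (auto simp: J_def letters_def)
    have "(Suc a, col_index p) \<notin> diagram lam"
    proof
      assume "(Suc a, col_index p) \<in> diagram lam"
      then have b: "p \<in> {1..<n}" "col_index (Suc p) = col_index p" "col_word (Suc p) = Suc a"
        using col_below[OF p'(1)] p'(2) by auto
      then have "w p < w (Suc p)" using inc by (simp add: increasing_columns_def)
      moreover have "w (Suc p) = Suc a" using b(3) by (simp add: eq relabel_def)
      ultimately show False using p by (simp add: J_def)
    qed
    then show "p \<in> free_feet a" using p by (simp add: free_feet_def J_def)
  qed
  then show thesis using eq by (rule that)
qed

end

text \<open>
The partition \<open>lam\<close> arises from \<open>mu\<close> by moving \<open>g\<close> nodes from row \<open>a + 1\<close> to row \<open>a\<close>. The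
characteristic and the order of \<open>q\<close> enter only through the vanishing of Gaussian binomial coefficients.
\<close>

locale row_shift = word_module n q + L: partition_words n q lam + M: partition_words n q mu
  for n :: nat and q :: "'f::field" and lam mu :: "nat \<Rightarrow> nat" +
  fixes a g :: nat
  assumes a: "1 \<le> a" and g: "1 \<le> g" "g \<le> mu (Suc a)"
    and lam_eq: "lam = shift_up a g mu"
    and vanish: "\<And>Q k. \<lbrakk>finite Q; 1 \<le> k; k \<le> g; card Q = mu a - mu (Suc a) + g + k\<rbrakk>
      \<Longrightarrow> gauss_sum q Q k = 0"
begin

definition shifted :: "(nat \<Rightarrow> nat) \<Rightarrow> 'f"
  where "shifted = move (Suc a) a g L.polytabloid"

lemma lam_a: "lam a = mu a + g" "lam (Suc a) = mu (Suc a) - g"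
  by (simp_all add: lam_eq shift_up_def)

lemma mu_le: "mu (Suc a) \<le> mu a"
  using M.lam_antimono[of a "Suc a"] a by simp

lemma shifted_words: "{x. shifted x \<noteq> 0} \<subseteq> words mu"
proof
  fix x assume x: "x \<in> {x. shifted x \<noteq> 0}"
  have "x \<in> words (lam(Suc a := lam (Suc a) + g, a := lam a - g))"
    by (rule move_words(1)[OF L.polytabloid_words]) (use x a in \<open>simp_all add: shifted_def\<close>)
  moreover have "lam(Suc a := lam (Suc a) + g, a := lam a - g) = mu"
    using g by (auto simp: lam_eq shift_up_def)
  ultimately show "x \<in> words mu" by simp
qed

lemma shifted_alternating: "L.alternating_columns shifted"
  unfolding shifted_def by (intro L.alternating_columns_move L.polytabloid_alternating) simp

text \<open>
Of all ways to turn \<open>g\<close> letters \<open>a + 1\<close> back into \<open>a\<close>, only the one that restores \<open>col_word\<close> avoids a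
repeated letter in a column. The point of the formula is that the value does not depend on the set \<open>J\<close>.
\<close>

lemma shifted_relabel:
  assumes J: "J \<subseteq> L.free_feet a" "card J = g"
  shows "shifted (relabel J (Suc a) L.col_word) = q ^ (card (letters (Suc a) L.col_word) * g)"
proof -
  let ?t = "L.col_word"
  let ?w = "relabel J (Suc a) ?t"
  have finJ: "finite J" using J(1) by (rule finite_subset) simp
  have Jt: "p \<in> {1..n}" "?t p = a" "(Suc a, L.col_index p) \<notin> diagram lam" if "p \<in> J" for p
    using L.free_feetD that J(1) by blast+
  have lw: "letters (Suc a) ?w = letters (Suc a) ?t \<union> J"
    using Jt by (auto simp: letters_def relabel_def)
  have JA: "J \<in> ksubsets (letters (Suc a) ?w) g" using J by (auto simp: ksubsets_def lw)
  have zero: "L.polytabloid (relabel B a ?w) = 0"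
    if B: "B \<in> ksubsets (letters (Suc a) ?w) g" and ne: "B \<noteq> J" for B
  proof -
    have "\<not> B \<subseteq> J" using card_subset_eq[OF finJ] B ne J(2) by (auto simp: ksubsets_def)
    then obtain p where p: "p \<in> B" "p \<notin> J" by blast
    then have pt: "p \<in> {1..n}" "?t p = Suc a" using B lw by (auto simp: ksubsets_def letters_def)
    then obtain p' where p': "p = Suc p'" "p' \<in> {1..<n}" "L.col_index p' = L.col_index p"
      "?t p = Suc (?t p')" using L.col_above[of p] a by force
    have "p' \<notin> J" using Jt(3)[of p'] L.col_node_mem[OF pt(1)] p' pt by auto
    then have "relabel B a ?w p' = a" using p' pt by (simp add: relabel_def)
    moreover have "relabel B a ?w p = a" using p by (simp add: relabel_def)
    ultimately show ?thesis
      using L.polytabloid_alternating p'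
      by (simp add: L.alternating_columns_def alternating_def)
  qed
  have "shifted ?w = (\<Sum>B\<in>{J}. q ^ move_exp (Suc a) a ?w B * L.polytabloid (relabel B a ?w))"
    unfolding shifted_def move_def
    by (rule sum.mono_neutral_right) (use JA zero in auto)
  also have "\<dots> = q ^ move_exp (Suc a) a ?w J"
  proof -
    have "relabel J a ?w = ?t" using Jt by (auto simp: relabel_def)
    then show ?thesis by (simp add: L.polytabloid_col_word)
  qed
  also have "move_exp (Suc a) a ?w J = card (letters (Suc a) ?t) * g"
  proof -
    have "letters (Suc a) ?w - J = letters (Suc a) ?t"
      unfolding lw using Jt by (auto simp: letters_def)
    moreover have "crossings (letters (Suc a) ?t) J = card (letters (Suc a) ?t) * card J"
    proof (rule crossings_all)
      fix x p assume x: "x \<in> letters (Suc a) ?t" and p: "p \<in> J"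
      then have "x \<in> {1..n}" "?t x = Suc a" by (auto simp: letters_def)
      then show "x < p" using L.less_free_feet[of p a x] L.col_node_mem[of x] p J(1) by auto
    qed
    ultimately show ?thesis using J(2) by (simp add: move_exp_def)
  qed
  finally show ?thesis .
qed

lemma free_feet_card: "card (L.free_feet a) = mu a - mu (Suc a) + 2 * g"
  using L.card_free_feet[OF a] lam_a g mu_le by simp

lemma shifted_nonzero: "shifted \<noteq> (\<lambda>_. 0)"
proof -
  obtain J where "J \<subseteq> L.free_feet a" "card J = g"
    using obtain_subset_with_card_n[of g "L.free_feet a"] free_feet_card by auto
  then have "shifted (relabel J (Suc a) L.col_word) \<noteq> 0" using shifted_relabel q_nonzero by simp
  then show ?thesis by auto
qed

text \<open>
The image under the raising operator of order \<open>m\<close> from \<open>b + 1\<close> to \<open>b\<close> is nonzero only if its content is dominated by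
\<open>lam\<close>, which forces \<open>b = a\<close> and \<open>m \<le> g\<close>. By \<open>increasing_columns_one_row\<close> the remaining values to compute are
those at the words that arise from \<open>col_word\<close> by turning a set \<open>J\<close> of \<open>g - m\<close> free feet into \<open>a + 1\<close>. As \<open>shifted\<close> is constant on
the words that contribute, such a value is a multiple of the Gaussian binomial coefficient for choosing
\<open>m\<close> of the other free feet.
\<close>

lemma shifted_highest: "highest shifted"
  unfolding highest_def
proof (intro allI impI)
  fix b m :: nat assume b: "1 \<le> b" and m: "1 \<le> m"
  show "move b (Suc b) m shifted = (\<lambda>_. 0)"
  proof (rule L.alternating_columns_move_up_eq_0[OF M.finite_lam shifted_words shifted_alternating b])
    fix w assume inc: "L.increasing_columns w" and w: "w \<in> words (shift_up b m mu)"
      and mle: "m \<le> mu (Suc b)"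
      and le: "\<And>r. (\<Sum>i=1..r. mu i) + (if r = b then m else 0) \<le> (\<Sum>i=1..r. lam i)"
    have sum_lam: "(\<Sum>i=1..r. lam i) = (\<Sum>i=1..r. mu i) + (if r = a then g else 0)" for r
      unfolding lam_eq by (rule sum_shift_up[where mu = mu, OF a g(2)])
    have ba: "b = a" "m \<le> g" using le[of b] m unfolding sum_lam by (auto split: if_splits)
    have "(\<Sum>i=1..r. shift_up b m mu i) = (\<Sum>i=1..r. lam i)" if "r \<noteq> a" for r
      using that ba unfolding sum_lam sum_shift_up[where mu = mu, OF b mle] by simp
    then obtain J where J: "J \<subseteq> L.free_feet a" and weq: "w = relabel J (Suc a) L.col_word"
      using L.increasing_columns_one_row[OF a inc w] by blast
    let ?t = "L.col_word"
    have finJ: "finite J" using J by (rule finite_subset) simp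
    have Jt: "p \<in> {1..n}" "?t p = a" "(Suc a, L.col_index p) \<notin> diagram lam" if "p \<in> J" for p
      using L.free_feetD that J by blast+
    have cardJ: "card J + m = g"
    proof -
      have "letters (Suc a) w = letters (Suc a) ?t \<union> J" "letters (Suc a) ?t \<inter> J = {}"
        using Jt unfolding weq by (auto simp: letters_def relabel_def)
      then have "card (letters (Suc a) w) = lam (Suc a) + card J"
        using finJ wordsD(3)[OF L.col_word_words, of "Suc a"] by (simp add: card_Un_disjoint)
      then have "shift_up b m mu (Suc a) = lam (Suc a) + card J"
        using wordsD(3)[OF w, of "Suc a"] by simp
      then show ?thesis using ba mle g lam_a by (simp add: shift_up_def)
    qed
    define A where "A = L.free_feet a - J"
    define S where "S = letters a ?t - L.free_feet a"
    have lw: "letters a w = A \<union> S"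
      using J unfolding weq by (auto simp: A_def S_def letters_def relabel_def L.free_feet_def)
    have less: "\<forall>i\<in>A. \<forall>s\<in>S. s < i"
      using L.less_free_feet by (auto simp: A_def S_def L.free_feet_def letters_def)
    have zero: "shifted (relabel B (Suc a) w) = 0" if B: "B \<in> ksubsets (A \<union> S) m" "\<not> B \<subseteq> A" for B
    proof -
      obtain p where p: "p \<in> B" "p \<in> S" using B by (auto simp: ksubsets_def)
      then have pt: "p \<in> {1..n}" "?t p = a" "(Suc a, L.col_index p) \<in> diagram lam"
        by (auto simp: S_def letters_def L.free_feet_def)
      then have p': "p \<in> {1..<n}" "L.col_index (Suc p) = L.col_index p" "?t (Suc p) = Suc a"
        using L.col_below[of p] by auto
      have "relabel B (Suc a) w p = Suc a" "relabel B (Suc a) w (Suc p) = Suc a"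
        using p p' by (simp_all add: relabel_def weq)
      then show ?thesis
        using shifted_alternating p' by (simp add: L.alternating_columns_def alternating_def)
    qed
    have "move b (Suc b) m shifted w = crossing_sum q (A \<union> S) m (\<lambda>B. shifted (relabel B (Suc a) w))"
      unfolding move_up_eq ba lw ..
    also have "\<dots> = crossing_sum q A m (\<lambda>B. shifted (relabel B (Suc a) w))"
      by (rule crossing_sum_Un_small[OF _ _ less zero]) (simp_all add: A_def S_def)
    also have "\<dots> = crossing_sum q A m (\<lambda>B. q ^ (card (letters (Suc a) ?t) * g) * 1)"
    proof (rule crossing_sum_cong)
      fix B assume "B \<in> ksubsets A m"
      then have B: "B \<subseteq> L.free_feet a - J" "card B = m" by (auto simp: ksubsets_def A_def)
      then have "finite B" using finite_subset by fastforce
      moreover have "J \<inter> B = {}" using B by auto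
      ultimately have "card (J \<union> B) = g" using finJ B cardJ by (simp add: card_Un_disjoint)
      moreover have "J \<union> B \<subseteq> L.free_feet a" using J B by auto
      moreover have "relabel B (Suc a) w = relabel (J \<union> B) (Suc a) ?t"
        by (auto simp: relabel_def weq)
      ultimately show "shifted (relabel B (Suc a) w) = q ^ (card (letters (Suc a) ?t) * g) * 1"
        using shifted_relabel by simp
    qed
    also have "\<dots> = q ^ (card (letters (Suc a) ?t) * g) * gauss_sum q A m"
      unfolding crossing_sum_def sum_distrib_left by (intro sum.cong refl) (simp add: mult_ac)
    also have "gauss_sum q A m = 0"
    proof (rule vanish)
      have "card A = card (L.free_feet a) - card J"
        unfolding A_def by (rule card_Diff_subset[OF finJ J])
      then show "card A = mu a - mu (Suc a) + g + m" using free_feet_card cardJ by simp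
    qed (use m ba in \<open>simp_all add: A_def\<close>)
    finally show "move b (Suc b) m shifted w = 0" by simp
  qed
qed

end

section \<open>From words to Specht modules\<close>

lemma block_stabilizer_iff:
  fixes f :: "nat \<Rightarrow> nat"
  assumes w: "w permutes {1..n}"
  shows "(\<forall>i. w ` {p \<in> {1..n}. f p = i} = {p \<in> {1..n}. f p = i}) \<longleftrightarrow> (\<forall>p. f (w p) = f p)"
proof
  assume h: "\<forall>i. w ` {p \<in> {1..n}. f p = i} = {p \<in> {1..n}. f p = i}"
  show "\<forall>p. f (w p) = f p"
  proof
    fix p show "f (w p) = f p"
    proof (cases "p \<in> {1..n}")
      case True
      then have "w p \<in> w ` {p' \<in> {1..n}. f p' = f p}" by blast
      also have "w ` {p' \<in> {1..n}. f p' = f p} = {p' \<in> {1..n}. f p' = f p}" using h by blast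
      finally show ?thesis by simp
    next
      case False
      then have "w p = p" by (rule permutes_not_in[OF w])
      then show ?thesis by simp
    qed
  qed
next
  assume h: "\<forall>p. f (w p) = f p"
  show "\<forall>i. w ` {p \<in> {1..n}. f p = i} = {p \<in> {1..n}. f p = i}"
  proof
    fix i
    have "w ` {p \<in> {1..n}. f p = i} \<subseteq> {p \<in> {1..n}. f p = i}"
      using h permutes_in_image[OF w] by blast
    moreover have "{p \<in> {1..n}. f p = i} \<subseteq> w ` {p \<in> {1..n}. f p = i}"
    proof
      fix p assume p: "p \<in> {p \<in> {1..n}. f p = i}"
      have "w (inv w p) = p" by (rule permutes_inverses(1)[OF w])
      moreover have "inv w p \<in> {1..n}" using p permutes_in_image[OF permutes_inv[OF w]] by blast
      ultimately show "p \<in> w ` {p \<in> {1..n}. f p = i}" using p h by (metis (mono_tags, lifting) image_eqI mem_Collect_eq)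
    qed
    ultimately show "w ` {p \<in> {1..n}. f p = i} = {p \<in> {1..n}. f p = i}" by blast
  qed
qed

lemma initial_segment:
  fixes A :: "nat set"
  assumes fin: "finite A" and down: "\<And>i j. i \<in> A \<Longrightarrow> 1 \<le> j \<Longrightarrow> j \<le> i \<Longrightarrow> j \<in> A" and pos: "\<And>i. i \<in> A \<Longrightarrow> 1 \<le> i"
  shows "A = {1..card A}"
proof (cases "A = {}")
  case False
  have "A = {1..Max A}"
  proof (intro equalityI subsetI)
    fix i assume "i \<in> A" then show "i \<in> {1..Max A}" using fin pos by simp
  next
    fix i assume "i \<in> {1..Max A}" then show "i \<in> A" using down[OF Max_in[OF fin False]] by simp
  qed
  then show ?thesis by (metis card_atLeastAtMost diff_Suc_1)
qed simp

context partition_words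
begin

lemma conjugate_diagram: "(i, j) \<in> diagram (conjugate lam) \<longleftrightarrow> (j, i) \<in> diagram lam"
proof -
  let ?A = "{r. (r, i) \<in> diagram lam}"
  have "?A \<subseteq> fst ` diagram lam" by force
  then have fin: "finite ?A" using finite_diagram finite_surj by blast
  have seg: "?A = {1..card ?A}"
  proof (rule initial_segment[OF fin])
    fix r s assume "r \<in> ?A" "1 \<le> s" "s \<le> r"
    then show "s \<in> ?A" using lam_antimono[of s r] by (auto simp: diagram_mem)
  qed (simp add: diagram_mem)
  have "(i, j) \<in> diagram (conjugate lam) \<longleftrightarrow> 1 \<le> i \<and> j \<in> {1..card ?A}"
    by (auto simp: diagram_def conjugate_def)
  also have "\<dots> \<longleftrightarrow> (j, i) \<in> diagram lam" using seg by (auto simp: diagram_mem)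
  finally show ?thesis .
qed

lemma row_tableau_conjugate: "row_tableau (conjugate lam) (i, j) = col_tableau lam (j, i)"
proof -
  have "bij_betw prod.swap
      {(r, c). (r, c) \<in> diagram (conjugate lam) \<and> (r < i \<or> r = i \<and> c \<le> j)}
      {(r, c). (r, c) \<in> diagram lam \<and> (c < i \<or> c = i \<and> r \<le> j)}"
    by (rule bij_betwI[where g = prod.swap]) (auto simp: conjugate_diagram)
  then show ?thesis unfolding row_tableau_def col_tableau_def prod.case by (rule bij_betw_same_card)
qed

lemma row_blocks: "row_tableau lam ` {x \<in> diagram lam. fst x = i} = {p \<in> {1..n}. row_word p = i}"
proof (intro equalityI subsetI)
  fix p assume "p \<in> row_tableau lam ` {x \<in> diagram lam. fst x = i}"
  then obtain x where "p = row_tableau lam x" "x \<in> diagram lam" "fst x = i" by blast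
  then show "p \<in> {p \<in> {1..n}. row_word p = i}" using row_node(3,4)[of x] by (auto simp: row_word_def)
next
  fix p assume "p \<in> {p \<in> {1..n}. row_word p = i}"
  then have p: "p \<in> {1..n}" "row_word p = i" by auto
  then have "fst (row_node p) = i" by (simp add: row_word_def)
  then show "p \<in> row_tableau lam ` {x \<in> diagram lam. fst x = i}"
    using row_node(1,2)[OF p(1)] by (intro image_eqI[of _ _ "row_node p"]) auto
qed

lemma col_blocks:
  "row_tableau (conjugate lam) ` {x \<in> diagram (conjugate lam). fst x = i} = {p \<in> {1..n}. col_index p = i}"
proof (intro equalityI subsetI)
  fix p assume "p \<in> row_tableau (conjugate lam) ` {x \<in> diagram (conjugate lam). fst x = i}"
  then obtain j where j: "p = row_tableau (conjugate lam) (i, j)" "(i, j) \<in> diagram (conjugate lam)" by force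
  then have "p = col_tableau lam (j, i)" "(j, i) \<in> diagram lam"
    by (simp_all only: row_tableau_conjugate conjugate_diagram)
  then show "p \<in> {p \<in> {1..n}. col_index p = i}" using col_node(4) col_word_tableau(2) by blast
next
  fix p assume "p \<in> {p \<in> {1..n}. col_index p = i}"
  then have p: "p \<in> {1..n}" "col_index p = i" by auto
  have "p = row_tableau (conjugate lam) (i, col_word p)"
    using col_node(2)[OF p(1)] p by (simp only: row_tableau_conjugate col_node_eq[OF p(1)])
  moreover have "(i, col_word p) \<in> diagram (conjugate lam)"
    using col_node_mem[OF p(1)] p(2) by (simp only: conjugate_diagram)
  ultimately show "p \<in> row_tableau (conjugate lam) ` {x \<in> diagram (conjugate lam). fst x = i}" by force
qed

lemma row_stabilizer_iff:
  "w \<in> row_stabilizer n lam \<longleftrightarrow> w permutes {1..n} \<and> row_word \<circ> inv w = row_word"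
proof (cases "w permutes {1..n}")
  case True
  have "w \<in> row_stabilizer n lam \<longleftrightarrow> (\<forall>p. row_word (w p) = row_word p)"
    unfolding row_stabilizer_def row_blocks mem_Collect_eq block_stabilizer_iff[OF True]
    using True by simp
  also have "\<dots> \<longleftrightarrow> row_word \<circ> inv w = row_word"
  proof
    assume h: "\<forall>p. row_word (w p) = row_word p"
    show "row_word \<circ> inv w = row_word"
    proof
      fix p show "(row_word \<circ> inv w) p = row_word p"
        using h[rule_format, of "inv w p"] permutes_inverses(1)[OF True] by simp
    qed
  next
    assume h: "row_word \<circ> inv w = row_word"
    show "\<forall>p. row_word (w p) = row_word p"
    proof
      fix p show "row_word (w p) = row_word p"
        using fun_cong[OF h, of "w p"] permutes_inverses(2)[OF True] by simp
    qed
  qed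
  finally show ?thesis using True by simp
qed (simp add: row_stabilizer_def)

lemma row_stabilizer_conjugate: "row_stabilizer n (conjugate lam) = col_stab"
  unfolding row_stabilizer_def col_blocks col_stab_def
  by (intro Collect_cong conj_cong refl block_stabilizer_iff)

lemma tableau_perm:
  shows "tableau_perm n lam permutes {1..n}"
    and "x \<in> diagram lam \<Longrightarrow> tableau_perm n lam (row_tableau lam x) = col_tableau lam x"
proof -
  let ?P = "\<lambda>w. w permutes {1..n} \<and> (\<forall>x\<in>diagram lam. w (row_tableau lam x) = col_tableau lam x)"
  define w0 where "w0 p = (if p \<in> {1..n} then col_tableau lam (row_node p) else p)" for p
  have "bij_betw (col_tableau lam \<circ> row_node) {1..n} {1..n}"
    unfolding row_node_def
    by (rule bij_betw_trans[OF bij_betw_inv_into[OF row_tableau_bij] col_tableau_bij])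
  then have "bij_betw w0 {1..n} {1..n}"
    by (rule bij_betw_cong[THEN iffD1, rotated]) (simp add: w0_def)
  then have "w0 permutes {1..n}" by (rule bij_imp_permutes) (simp only: w0_def if_False)
  moreover have "\<forall>x\<in>diagram lam. w0 (row_tableau lam x) = col_tableau lam x"
    by (intro ballI) (simp only: w0_def row_node(3,4) if_True)
  ultimately have ex: "?P w0" by blast
  have "w = w0" if "?P w" for w
  proof
    fix p show "w p = w0 p"
    proof (cases "p \<in> {1..n}")
      case True
      then show ?thesis using that ex row_node(1,2)[OF True] by metis
    next
      case False
      then show ?thesis using that ex permutes_not_in by metis
    qed
  qed
  then have "?P (tableau_perm n lam)"
    unfolding tableau_perm_def using ex by (intro theI[of ?P w0])
  then show "tableau_perm n lam permutes {1..n}"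
    "x \<in> diagram lam \<Longrightarrow> tableau_perm n lam (row_tableau lam x) = col_tableau lam x" by blast+
qed

lemma tableau_perm_word: "row_word \<circ> inv (tableau_perm n lam) = col_word"
proof
  fix p
  let ?w = "tableau_perm n lam"
  note w = tableau_perm(1)
  show "(row_word \<circ> inv ?w) p = col_word p"
  proof (cases "p \<in> {1..n}")
    case True
    let ?x = "(col_word p, col_index p)"
    have x: "?x \<in> diagram lam" by (rule col_node_mem[OF True])
    have "?w (row_tableau lam ?x) = p"
      using tableau_perm(2)[OF x] col_node(2)[OF True] by (simp only: col_node_eq[OF True])
    then have "inv ?w p = row_tableau lam ?x" using permutes_inv_eq[OF w] by blast
    then show ?thesis using row_node(3,4)[OF x] by (simp only: comp_apply row_word_def if_True fst_conv)
  next
    case False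
    then show ?thesis using permutes_not_in[OF permutes_inv[OF w] False]
      by (simp only: comp_apply row_word_def col_word_def if_False)
  qed
qed

lemma tableau_perm_order:
  assumes ij: "i < j" "tableau_perm n lam j < tableau_perm n lam i"
  shows "row_word i < row_word j"
proof -
  let ?w = "tableau_perm n lam"
  have i: "i \<in> {1..n}" and j: "j \<in> {1..n}" using permutes_inverted_pair[OF tableau_perm(1) ij] by blast+
  have w: "?w i = col_tableau lam (row_node i)" "?w j = col_tableau lam (row_node j)"
    using tableau_perm(2)[OF row_node(1)] row_node(2) i j by metis+
  show ?thesis
    using row_tableau_less[OF row_node(1)[OF i] row_node(1)[OF j]]
      col_tableau_less[OF row_node(1)[OF j] row_node(1)[OF i]] row_node(2)[OF i] row_node(2)[OF j] ij w i j
    by (auto simp: row_word_def)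
qed

lemma words_orbit:
  assumes x: "x \<in> words lam"
  obtains w where "w permutes {1..n}" "x = row_word \<circ> inv w"
proof -
  have "card {i \<in> {1..n}. x i = r} = card {i \<in> {1..n}. row_word i = r}" for r
  proof (cases "1 \<le> r")
    case True
    then show ?thesis
      using wordsD(3)[OF x True] wordsD(3)[OF row_word_words True] by (simp add: letters_def)
  next
    case False
    then show ?thesis using wordsD(2)[OF x] wordsD(2)[OF row_word_words] by (metis (mono_tags, lifting))
  qed
  then have "image_mset x (mset_set {1..n}) = image_mset row_word (mset_set {1..n})"
    by (intro multiset_eqI) (simp add: count_image_mset_eq_card_vimage)
  then obtain p where p: "p permutes {1..n}" "\<forall>i\<in>{1..n}. x i = row_word (p i)"
    using image_mset_eq_implies_permutes[of "{1..n}" x row_word] by blast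
  have "x = row_word \<circ> p"
  proof
    fix i show "x i = (row_word \<circ> p) i"
      using p wordsD(1)[OF x, of i] wordsD(1)[OF row_word_words, of i] permutes_not_in[OF p(1), of i]
      by (cases "i \<in> {1..n}") auto
  qed
  then show thesis
    using that[of "inv p"] permutes_inv[OF p(1)] permutes_inv_inv[OF p(1)] by simp
qed

end

locale hecke_words = hecke_algebra scale n q T + word_module n q
  for scale :: "'f::field \<Rightarrow> 'h::ring_1 \<Rightarrow> 'h" and n :: nat and q :: 'f and T :: "(nat \<Rightarrow> nat) \<Rightarrow> 'h"
begin

lemma finite_perms [simp]: "finite {w. w permutes {1..n}}"
  by (simp add: finite_permutations)

lemma T_mult_simple:
  assumes w: "w permutes {1..n}" and k: "k \<in> {1..<n}"
  shows "T w * T (simple_refl k)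
    = scale (if inv w k < inv w (Suc k) then 1 else q) (T (w \<cdot> simple_refl k))
      + scale (if inv w k < inv w (Suc k) then 0 else q - 1) (T w)"
  using T_mult_up[OF w k perm_length_up[OF w k]] T_mult_down[OF w k perm_length_down[OF w k]] inv_ne[OF w, of k]
  by (cases "inv w k < inv w (Suc k)") auto

text \<open>
The element of the Hecke algebra whose coefficient at \<open>T w\<close> is the value of \<open>g\<close> at the word of the
tableau obtained from the initial one by \<open>w\<close>. For \<open>r\<close> the row word of \<open>\<mu>\<close> this identifies the vectors of content
\<open>\<mu>\<close> with \<open>x\<^sub>\<mu>H\<close>: a basis word goes to the sum over a coset of the row stabilizer.
\<close>

definition realize :: "(nat \<Rightarrow> nat) \<Rightarrow> ((nat \<Rightarrow> nat) \<Rightarrow> 'f) \<Rightarrow> 'h"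
  where "realize r g = (\<Sum>w | w permutes {1..n}. scale (g (r \<circ> inv w)) (T w))"

lemma realize_add_scale: "realize r (\<lambda>x. u x + c * v x) = realize r u + scale c (realize r v)"
  by (simp add: realize_def scale_left_distrib sum.distrib scale_sum_right)

lemma realize_0 [simp]: "realize r (\<lambda>_. 0) = 0"
  by (simp add: realize_def)

lemma realize_eq_0:
  assumes "realize r g = 0" and w: "w permutes {1..n}"
  shows "g (r \<circ> inv w) = 0"
proof -
  let ?S = "{w. w permutes {1..n}}"
  have "(\<Sum>b\<in>T ` ?S. scale (g (r \<circ> inv (inv_into ?S T b))) b) = realize r g"
    unfolding realize_def using T_inj by (simp add: sum.reindex inv_into_f_f)
  then have "g (r \<circ> inv (inv_into ?S T (T w))) = 0"
    using independentD[OF T_independent, of "T ` ?S" "\<lambda>b. g (r \<circ> inv (inv_into ?S T b))" "T w"]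
      finite_imageI[OF finite_perms] assms by (simp del: One_nat_def)
  then show ?thesis using T_inj w by (simp add: inv_into_f_f)
qed

text \<open>
As \<open>r\<close> is weakly increasing, this compares with the regular representation in the same way as
\<open>act_pullback\<close> does for words: equal letters absorb both cases of the multiplication.
\<close>

lemma realize_act:
  assumes r: "\<And>i j. i \<in> {1..n} \<Longrightarrow> j \<in> {1..n} \<Longrightarrow> i \<le> j \<Longrightarrow> r i \<le> r j" and k: "k \<in> {1..<n}"
  shows "realize r g * T (simple_refl k) = realize r (act k g)"
proof -
  let ?S = "{w. w permutes {1..n}}" and ?s = "simple_refl k"
  let ?up = "\<lambda>w. inv w k < inv w (Suc k)"
  have bij: "bij_betw (\<lambda>w. w \<cdot> ?s) ?S ?S"
    by (rule bij_betwI[where g = "\<lambda>w. w \<cdot> ?s"]) (use pmul_simple_refl_permutes[OF _ k] in \<open>simp_all add: Pi_def del: One_nat_def\<close>)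
  have "realize r g * T ?s
      = (\<Sum>w\<in>?S. scale (g (r \<circ> inv w) * (if ?up w then 1 else q)) (T (w \<cdot> ?s)))
        + (\<Sum>w\<in>?S. scale (g (r \<circ> inv w) * (if ?up w then 0 else q - 1)) (T w))"
    unfolding realize_def sum_distrib_right sum.distrib[symmetric]
    by (intro sum.cong refl) (simp add: scale_mult_left T_mult_simple[OF _ k] scale_right_distrib)
  also have "(\<Sum>w\<in>?S. scale (g (r \<circ> inv w) * (if ?up w then 1 else q)) (T (w \<cdot> ?s)))
      = (\<Sum>w\<in>?S. scale (g (r \<circ> inv (w \<cdot> ?s)) * (if ?up (w \<cdot> ?s) then 1 else q)) (T w))"
    using sum.reindex_bij_betw[OF bij, of "\<lambda>w. scale (g (r \<circ> inv w) * (if ?up w then 1 else q)) (T (w \<cdot> ?s))"]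
    by simp
  also have "\<dots> + (\<Sum>w\<in>?S. scale (g (r \<circ> inv w) * (if ?up w then 0 else q - 1)) (T w))
      = realize r (act k g)"
    unfolding realize_def sum.distrib[symmetric]
  proof (intro sum.cong refl)
    fix w assume "w \<in> ?S"
    then have w: "w permutes {1..n}" by simp
    let ?x = "r \<circ> inv w"
    have xs: "r \<circ> inv (w \<cdot> ?s) = ?x \<circ> ?s" by (simp only: inv_pmul_simple_refl[OF w k] comp_assoc)
    have ups: "?up (w \<cdot> ?s) \<longleftrightarrow> \<not> ?up w"
      using inv_ne[OF w, of k] by (auto simp: inv_pmul_simple_refl[OF w k])
    have mem: "inv w k \<in> {1..n}" "inv w (Suc k) \<in> {1..n}"
      using permutes_in_image[OF permutes_inv[OF w]] k by auto
    have mono: "?up w \<Longrightarrow> ?x k \<le> ?x (Suc k)" "\<not> ?up w \<Longrightarrow> ?x (Suc k) \<le> ?x k"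
      using r mem by auto
    have "g (?x \<circ> ?s) * (if ?up w then q else 1) + g ?x * (if ?up w then 0 else q - 1) = act k g ?x"
    proof (cases "?x k = ?x (Suc k)")
      case True
      then have "?x \<circ> ?s = ?x" by (auto simp: fun_eq_iff simple_refl_def transpose_def)
      then show ?thesis using True by (simp add: act_def algebra_simps)
    next
      case False
      then show ?thesis using mono by (cases "?up w") (auto simp: act_def algebra_simps)
    qed
    moreover have "(if \<not> ?up w then 1 else q) = (if ?up w then q else 1)" by simp
    ultimately show "scale (g (r \<circ> inv (w \<cdot> ?s)) * (if ?up (w \<cdot> ?s) then 1 else q)) (T w)
        + scale (g ?x * (if ?up w then 0 else q - 1)) (T w) = scale (act k g ?x) (T w)"
      unfolding xs ups scale_left_distrib[symmetric] by (simp only:)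
  qed
  finally show ?thesis .
qed

definition word_basis :: "(nat \<Rightarrow> nat) \<Rightarrow> (nat \<Rightarrow> nat) \<Rightarrow> 'f"
  where "word_basis x = (\<lambda>y. if y = x then 1 else 0)"

lemma act_word_basis:
  assumes x: "x k < x (Suc k)"
  shows "act k (word_basis x) = word_basis (x \<circ> simple_refl k)"
proof
  fix y
  have "y = x \<circ> simple_refl k \<longleftrightarrow> y \<circ> simple_refl k = x"
    by (metis simple_refl_comp(2))
  moreover have "x \<circ> simple_refl k \<noteq> x"
  proof
    assume "x \<circ> simple_refl k = x"
    from fun_cong[OF this, of k] show False using x by simp
  qed
  ultimately show "act k (word_basis x) y = word_basis (x \<circ> simple_refl k) y"
    using x by (auto simp: act_def word_basis_def)
qed

text \<open>
Along a reduced expression only ascents are swapped, and there the action on basis words has no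
correction term.
\<close>

lemma realize_word_basis_mult:
  assumes r: "\<And>i j. i \<in> {1..n} \<Longrightarrow> j \<in> {1..n} \<Longrightarrow> i \<le> j \<Longrightarrow> r i \<le> r j"
    and w: "w permutes {1..n}" and asc: "\<And>i j. i < j \<Longrightarrow> w j < w i \<Longrightarrow> x i < x j"
  shows "realize r (word_basis x) * T w = realize r (word_basis (x \<circ> inv w))"
  using w
proof (induction rule: perm_up_induct_rel[where R = "\<lambda>i j. x i < x j"])
  case (up w k)
  have T: "T (w \<cdot> simple_refl k) = T w * T (simple_refl k)"
    using T_mult_simple[OF up(1,2)] up(3) by simp
  have "realize r (word_basis x) * T (w \<cdot> simple_refl k)
      = realize r (word_basis (x \<circ> inv w)) * T (simple_refl k)"
    by (simp only: T up(5) mult.assoc[symmetric])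
  also have "\<dots> = realize r (word_basis (x \<circ> inv w \<circ> simple_refl k))"
    using up(4) by (simp only: realize_act[OF r up(2)] act_word_basis comp_apply)
  finally show ?case by (simp only: inv_pmul_simple_refl[OF up(1,2)] comp_assoc)
next
  case (rel i j)
  then show ?case by (rule asc)
next
  case id
  show ?case by (simp only: T_id mult_1_right inv_id comp_id)
qed

end

locale hecke_partition = hecke_words scale n q T + partition_words n q lam
  for scale :: "'f::field \<Rightarrow> 'h::ring_1 \<Rightarrow> 'h" and n :: nat and q :: 'f and T :: "(nat \<Rightarrow> nat) \<Rightarrow> 'h"
    and lam :: "nat \<Rightarrow> nat"
begin

lemma realize_polytabloid:
  "realize row_word polytabloid = x_elt lam * T (tableau_perm n lam) * y_elt (conjugate lam)"
proof -
  have x: "x_elt lam = realize row_word (word_basis row_word)"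
  proof -
    have "realize row_word (word_basis row_word)
        = (\<Sum>w\<in>row_stabilizer n lam. scale (word_basis row_word (row_word \<circ> inv w)) (T w))"
      unfolding realize_def
      by (rule sum.mono_neutral_right[OF finite_perms]) (auto simp: row_stabilizer_iff word_basis_def)
    also have "\<dots> = x_elt lam"
      unfolding x_elt_def by (intro sum.cong refl) (simp add: row_stabilizer_iff word_basis_def)
    finally show ?thesis by simp
  qed
  have "x_elt lam * T (tableau_perm n lam) = realize row_word (word_basis col_word)"
    unfolding x
    using realize_word_basis_mult[OF row_word_mono tableau_perm(1) tableau_perm_order]
    by (simp only: tableau_perm_word)
  moreover have "realize row_word (word_basis col_word) * T w
      = realize row_word (word_basis (col_word \<circ> inv w))" if "w \<in> col_stab" for w
    by (rule realize_word_basis_mult[OF row_word_mono])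
      (use that col_stab_order in \<open>auto simp: col_stab_def\<close>)
  ultimately have "x_elt lam * T (tableau_perm n lam) * y_elt (conjugate lam)
      = (\<Sum>w\<in>col_stab. scale ((- q) powi (- int (perm_length n w))) (realize row_word (word_basis (col_word \<circ> inv w))))"
    unfolding y_elt_def row_stabilizer_conjugate by (simp add: sum_distrib_left scale_mult_right)
  also have "\<dots> = (\<Sum>v | v permutes {1..n}. \<Sum>w\<in>col_stab.
      scale ((- q) powi (- int (perm_length n w)) * word_basis (col_word \<circ> inv w) (row_word \<circ> inv v)) (T v))"
    unfolding realize_def by (subst sum.swap) (simp add: scale_sum_right)
  also have "\<dots> = realize row_word polytabloid"
    unfolding realize_def polytabloid_def
    by (intro sum.cong refl) (auto simp: scale_sum_left word_basis_def intro!: sum.cong)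
  finally show ?thesis by simp
qed

lemma specht_eq: "specht lam = {realize row_word polytabloid * h | h. True}"
  unfolding specht_def realize_polytabloid ..

text \<open>
Multiply the polytabloid by \<open>T\<close> along the reduced expression supplied by \<open>ballot_perm\<close>: each step
turns a descent of the leading word into an ascent.
\<close>

lemma ballot_leading:
  assumes w: "w \<in> words lam" "ballot w"
  shows "\<exists>u. leading u w \<and> highest u \<and> {x. u x \<noteq> 0} \<subseteq> words lam \<and> realize row_word u \<in> specht lam"
proof -
  obtain p where p: "p permutes {1..n}" "w = col_word \<circ> inv p"
    and order: "\<And>i j. i < j \<Longrightarrow> p j < p i \<Longrightarrow> col_word j < col_word i"
    using ballot_perm[OF w] by blast
  have "\<exists>u. leading u (col_word \<circ> inv p) \<and> highest u \<and> {x. u x \<noteq> 0} \<subseteq> words lam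
      \<and> realize row_word u \<in> specht lam"
    using p(1)
  proof (induction rule: perm_up_induct_rel[where R = "\<lambda>i j. col_word j < col_word i"])
    case (rel i j)
    then show ?case by (rule order)
  next
    case id
    have "realize row_word polytabloid \<in> specht lam"
      unfolding specht_eq by (metis (mono_tags, lifting) mem_Collect_eq mult.right_neutral)
    then show ?case
      using polytabloid_leading polytabloid_highest polytabloid_words by auto
  next
    case (up p k)
    then obtain u where u: "leading u (col_word \<circ> inv p)" "highest u" "{x. u x \<noteq> 0} \<subseteq> words lam"
      "realize row_word u \<in> specht lam" by blast
    have "leading (act k u) (col_word \<circ> inv p \<circ> simple_refl k)"
      by (rule leading_act[OF up(2) _ u(1)]) (use up(4) in simp)
    moreover have "highest (act k u)" by (rule highest_act[OF up(2) u(2)])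
    moreover have "{x. act k u x \<noteq> 0} \<subseteq> words lam" by (rule act_words[OF up(2) u(3)])
    moreover have "realize row_word (act k u) \<in> specht lam"
      using specht_mult[OF u(4), of "T (simple_refl k)"] realize_act[OF row_word_mono up(2), where g = u]
      by (simp only:)
    ultimately show ?case unfolding inv_pmul_simple_refl[OF up(1,2)] comp_assoc by blast
  qed
  then show ?thesis using p(2) by simp
qed

text \<open>
The inclusion of the kernel intersection theorem that puts elements into a Specht module.
\<close>

theorem highest_in_specht:
  assumes v: "highest v" "{x. v x \<noteq> 0} \<subseteq> words lam"
  shows "realize row_word v \<in> specht lam"
proof -
  have "v \<in> {v. realize row_word v \<in> specht lam}"
  proof (rule highest_induct[OF finite_lam _ _ _ v])
    show "\<exists>u. leading u w \<and> highest u \<and> {x. u x \<noteq> 0} \<subseteq> words lam \<and> u \<in> {v. realize row_word v \<in> specht lam}"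
      if "w \<in> words lam" "ballot w" for w
      using ballot_leading[OF that] by simp
    show "(\<lambda>_. 0) \<in> {v. realize row_word v \<in> specht lam}" by (simp add: zero_in_specht)
    show "(\<lambda>w. u w + c * v w) \<in> {v. realize row_word v \<in> specht lam}"
      if "u \<in> {v. realize row_word v \<in> specht lam}" "v \<in> {v. realize row_word v \<in> specht lam}" for u v c
      using that by (simp add: realize_add_scale specht_add specht_scale)
  qed
  then show ?thesis by simp
qed

end

context hecke_algebra
begin

text \<open>
A homomorphism is determined by its value on the generator, so the Hom space embeds into the finite
dimensional algebra. Finite dimension matters, because \<open>dim\<close> is 0 on infinite dimensional spaces.
\<close>

lemma hom_dim_ge_1:
  assumes f: "f \<in> hom_space (specht lam) (specht mu)" and nz: "f \<noteq> 0"
  shows "hom_dim (specht lam) (specht mu) \<ge> 1"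
proof -
  let ?V = "hom_space (specht lam) (specht mu)"
  let ?z = "x_elt lam * T (tableau_perm n lam) * y_elt (conjugate lam)"
  interpret F: vector_space fun_scale by (rule vector_space_fun_scale)
  interpret ev: Vector_Spaces.linear fun_scale scale "\<lambda>f. f ?z"
    by unfold_locales (auto simp: fun_scale_def scale_right_distrib scale_left_distrib)
  obtain B where B: "B \<subseteq> ?V" "F.independent B" "?V \<subseteq> F.span B" "card B = F.dim ?V"
    using F.basis_exists by blast
  have sub: "F.span B \<subseteq> ?V"
    using F.span_minimal[OF B(1) hom_space_specht_subspace] .
  have z: "?z \<in> specht lam"
    unfolding specht_def by (metis (mono_tags, lifting) mem_Collect_eq mult.right_neutral)
  have "inj_on (\<lambda>f. f ?z) ?V"
  proof (rule inj_onI)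
    fix f g assume fg: "f \<in> ?V" "g \<in> ?V" "f ?z = g ?z"
    show "f = g"
    proof
      fix x show "f x = g x"
      proof (cases "x \<in> specht lam")
        case True
        then obtain h where "x = ?z * h" by (auto simp: specht_def)
        then show ?thesis using fg z unfolding hom_space_def by auto
      next
        case False
        then show ?thesis using fg unfolding hom_space_def by auto
      qed
    qed
  qed
  then have inj: "inj_on (\<lambda>f. f ?z) (F.span B)" using sub by (rule inj_on_subset)
  have "independent ((\<lambda>f. f ?z) ` B)" by (rule ev.independent_injective_image[OF B(2) inj])
  moreover have "finite (T ` {w. w permutes {1..n}})" by (simp add: finite_permutations)
  ultimately have "finite ((\<lambda>f. f ?z) ` B)"
    using independent_span_bound T_span by blast
  then have "finite B"
    using inj_on_subset[OF inj F.span_superset] by (rule finite_imageD)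
  moreover have "B \<noteq> {}"
  proof
    assume "B = {}"
    then have "f \<in> F.span {}" using f B(3) by blast
    then show False using nz F.span_empty by blast
  qed
  ultimately have "card B \<noteq> 0" by simp
  then show ?thesis unfolding hom_dim_def using B(4) by simp
qed

end

locale hecke_row_shift = hecke_words scale n q T + row_shift n q lam mu a g
  for scale :: "'f::field \<Rightarrow> 'h::ring_1 \<Rightarrow> 'h" and n :: nat and q :: 'f and T :: "(nat \<Rightarrow> nat) \<Rightarrow> 'h"
    and lam mu :: "nat \<Rightarrow> nat" and a g :: nat
begin

sublocale LH: hecke_partition scale n q T lam by unfold_locales
sublocale MH: hecke_partition scale n q T mu by unfold_locales

text \<open>
Right multiplication by an arbitrary \<open>h\<close> has no formula on words; the vector \<open>v'\<close> representing
\<open>v h\<close> is built along an expression of \<open>h\<close> in simple reflections, and \<open>move\<close> follows every step.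
\<close>

lemma move_intertwines:
  assumes supp: "{x. v x \<noteq> 0} \<subseteq> words lam"
  shows "\<exists>v'. {x. v' x \<noteq> 0} \<subseteq> words lam \<and> realize L.row_word v' = realize L.row_word v * h
    \<and> realize M.row_word (move (Suc a) a g v') = realize M.row_word (move (Suc a) a g v) * h"
    (is "?P v h")
proof -
  have T: "?P v (T w)" if w: "w permutes {1..n}" and supp: "{x. v x \<noteq> 0} \<subseteq> words lam" for w v
    using w
  proof (induction rule: perm_up_induct)
    case id
    show ?case by (intro exI[of _ v] conjI) (simp_all only: T_id mult_1_right supp)
  next
    case (up w k)
    then obtain v' where v': "{x. v' x \<noteq> 0} \<subseteq> words lam"
      "realize L.row_word v' = realize L.row_word v * T w"
      "realize M.row_word (move (Suc a) a g v') = realize M.row_word (move (Suc a) a g v) * T w" by blast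
    have "T (w \<cdot> simple_refl k) = T w * T (simple_refl k)"
      using T_mult_simple[OF up(1,2)] up(3) by simp
    moreover have "move (Suc a) a g (act k v') = act k (move (Suc a) a g v')"
      using move_act[OF _ up(2), of a "Suc a"] by simp
    ultimately show ?case
      using v' act_words[OF up(2) v'(1)] realize_act[OF L.row_word_mono up(2)] realize_act[OF M.row_word_mono up(2)]
      by (intro exI[of _ "act k v'"]) (simp add: mult.assoc[symmetric] flip: v'(2,3))
  qed
  have "h \<in> span (T ` {w. w permutes {1..n}})" using T_span by simp
  then show ?thesis
  proof (induction h rule: span_induct_alt)
    case base
    have "move (Suc a) a g (\<lambda>_. 0) = (\<lambda>_. 0)" by (simp add: move_def fun_eq_iff)
    then show ?case by (intro exI[of _ "\<lambda>_. 0"]) simp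
  next
    case (step c y h)
    then obtain w where w: "w permutes {1..n}" "y = T w" by blast
    obtain v1 where v1: "{x. v1 x \<noteq> 0} \<subseteq> words lam" "realize L.row_word v1 = realize L.row_word v * y"
      "realize M.row_word (move (Suc a) a g v1) = realize M.row_word (move (Suc a) a g v) * y"
      using T[OF w(1) supp] w(2) by blast
    obtain v2 where v2: "{x. v2 x \<noteq> 0} \<subseteq> words lam" "realize L.row_word v2 = realize L.row_word v * h"
      "realize M.row_word (move (Suc a) a g v2) = realize M.row_word (move (Suc a) a g v) * h"
      using step.IH by blast
    let ?v = "\<lambda>x. v2 x + c * v1 x"
    have "{x. ?v x \<noteq> 0} \<subseteq> words lam"
    proof
      fix x assume "x \<in> {x. ?v x \<noteq> 0}"
      then have "v1 x \<noteq> 0 \<or> v2 x \<noteq> 0" by auto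
      then show "x \<in> words lam" using v1(1) v2(1) by blast
    qed
    moreover have "move (Suc a) a g ?v = (\<lambda>x. move (Suc a) a g v2 x + c * move (Suc a) a g v1 x)"
      using linear_op_move by (simp add: linear_op_def)
    ultimately show ?case
      using v1 v2 by (intro exI[of _ ?v])
        (simp add: realize_add_scale distrib_left scale_mult_right add.commute)
  qed
qed

lemma realize_inj:
  assumes "{x. v x \<noteq> 0} \<subseteq> words lam" "realize L.row_word v = 0"
  shows "v = (\<lambda>_. 0)"
proof (rule ccontr)
  assume "v \<noteq> (\<lambda>_. 0)"
  then obtain x where x: "v x \<noteq> 0" by auto
  then obtain w where "w permutes {1..n}" "x = L.row_word \<circ> inv w"
    using L.words_orbit assms(1) by blast
  then show False using realize_eq_0[OF assms(2)] x by simp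
qed

lemma annihilator:
  assumes "realize L.row_word L.polytabloid * h = 0"
  shows "realize M.row_word shifted * h = 0"
proof -
  obtain v' where v': "{x. v' x \<noteq> 0} \<subseteq> words lam" "realize L.row_word v' = realize L.row_word L.polytabloid * h"
    "realize M.row_word (move (Suc a) a g v') = realize M.row_word shifted * h"
    using move_intertwines[OF L.polytabloid_words] unfolding shifted_def by blast
  have "v' = (\<lambda>_. 0)" using realize_inj[OF v'(1)] v'(2) assms by simp
  then have "move (Suc a) a g v' = (\<lambda>_. 0)" by (simp add: move_def fun_eq_iff)
  then show ?thesis using v'(3) by simp
qed

text \<open>
The homomorphism \<open>z h \<mapsto> v h\<close> for the generator \<open>z\<close> and the image \<open>v\<close> of the polytabloid under the divided
power.
\<close>

theorem hom_dim_specht: "hom_dim (specht lam) (specht mu) \<ge> 1"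
proof -
  let ?z = "realize L.row_word L.polytabloid" and ?v = "realize M.row_word shifted"
  define f where "f x = (if x \<in> specht lam then ?v * (SOME h. x = ?z * h) else 0)" for x
  have mem: "?z * h \<in> specht lam" for h unfolding LH.specht_eq by blast
  have fz: "f (?z * h) = ?v * h" for h
  proof -
    let ?h = "SOME h'. ?z * h = ?z * h'"
    have "?z * h = ?z * ?h" by (rule someI) simp
    then have "?z * (?h - h) = 0" by (simp add: right_diff_distrib)
    then have "?v * (?h - h) = 0" by (rule annihilator)
    then show ?thesis using mem by (simp add: f_def right_diff_distrib)
  qed
  have v_mem: "?v \<in> specht mu"
    using MH.highest_in_specht[OF shifted_highest shifted_words] .
  have "f \<in> hom_space (specht lam) (specht mu)"
    unfolding hom_space_def
  proof (intro CollectI conjI ballI allI impI)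
    show "f x \<in> specht mu" if "x \<in> specht lam" for x
      using that fz specht_mult[OF v_mem] unfolding LH.specht_eq by auto
    show "f (x + y) = f x + f y" if xy: "x \<in> specht lam" "y \<in> specht lam" for x y
    proof -
      obtain h h' where "x = ?z * h" "y = ?z * h'" using xy unfolding LH.specht_eq by blast
      then show ?thesis using fz by (simp flip: distrib_left)
    qed
    show "f (x * h) = f x * h" if x: "x \<in> specht lam" for x h
    proof -
      obtain h' where "x = ?z * h'" using x unfolding LH.specht_eq by blast
      then show ?thesis using fz by (simp add: mult.assoc)
    qed
  qed (simp add: f_def)
  moreover have "f \<noteq> 0"
  proof
    assume "f = 0"
    then have v0: "?v = 0" using fz[of 1] by simp
    obtain x where x: "shifted x \<noteq> 0" using shifted_nonzero by auto
    then obtain w where "w permutes {1..n}" "x = M.row_word \<circ> inv w"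
      using M.words_orbit shifted_words by blast
    then show False using realize_eq_0[OF v0] x by simp
  qed
  ultimately show ?thesis by (rule hom_dim_ge_1)
qed

end

theorem corollary3p6:
  fixes scale :: "'f::field \<Rightarrow> 'h::ring_1 \<Rightarrow> 'h"
    and q :: 'f and T :: "(nat \<Rightarrow> nat) \<Rightarrow> 'h"
    and n e p a \<gamma> :: nat and lam mu :: "nat \<Rightarrow> nat"
  assumes "n \<ge> 1"
    and "p = CHAR('f)"
    and "q \<noteq> 0"
    and "is_quantum_char q e"
    and "hecke_algebra scale n q T"
    and "is_partition n lam"
    and "is_partition n mu"
    and "a \<ge> 1" and "\<gamma> \<ge> 1"
    and "\<forall>i\<ge>1. int (lam i) =
          (if i = a then int (mu i) + int \<gamma>
           else if i = a + 1 then int (mu i) - int \<gamma>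
           else int (mu i))"
  shows "(p = 0 \<longrightarrow>
            [int (mu a) - int (mu (a + 1)) + int \<gamma> = - 1] (mod int e) \<and> \<gamma> < e \<longrightarrow>
            hecke_algebra.hom_dim scale
              (hecke_algebra.specht scale n q T lam) (hecke_algebra.specht scale n q T mu) \<ge> 1)
       \<and> (p > 0 \<longrightarrow>
            [int (mu a) - int (mu (a + 1)) + int \<gamma> = - 1] (mod int (e * p ^ ell_p p (\<gamma> div e))) \<longrightarrow>
            hecke_algebra.hom_dim scale
              (hecke_algebra.specht scale n q T lam) (hecke_algebra.specht scale n q T mu) \<ge> 1)"
proof -
  interpret hecke_algebra scale n q T by (rule assms(5))
  have diff: "int (lam i) = (if i = a then int (mu i) + int \<gamma>
      else if i = a + 1 then int (mu i) - int \<gamma> else int (mu i))" if "1 \<le> i" for i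
    using assms(10) that by blast
  have lam_eq: "lam = shift_up a \<gamma> mu"
  proof
    fix i
    have "lam 0 = 0" "mu 0 = 0" using assms(6,7) by (auto simp: is_partition_def is_composition_def)
    then show "lam i = shift_up a \<gamma> mu i"
      using diff[of i] assms(8) by (cases "i = 0") (auto simp: shift_up_def split: if_splits)
  qed
  have \<gamma>_le: "\<gamma> \<le> mu (Suc a)" using diff[of "Suc a"] by simp
  have mu_le: "mu (Suc a) \<le> mu a" using assms(7,8) by (simp add: is_partition_def)
  let ?m = "mu a - mu (Suc a) + \<gamma>"
  \<comment> \<open>Both characteristics at once: \<open>P\<close> is the power of the characteristic in the congruence, and 1 in characteristic 0.\<close>
  have hom: "hom_dim (specht lam) (specht mu) \<ge> 1"
    if P: "P = 1 \<or> prime CHAR('f) \<and> P = CHAR('f) ^ s" and small: "\<gamma> < e * P"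
      and cong: "[int (mu a) - int (mu (a + 1)) + int \<gamma> = - 1] (mod int (e * P))" for P s
  proof -
    have "int (?m + 1) = int (mu a) - int (mu (a + 1)) + int \<gamma> - (- 1)"
      using mu_le by (simp add: of_nat_diff)
    then have "int (e * P) dvd int (?m + 1)"
      using cong unfolding cong_iff_dvd_diff by (simp only:)
    then have dvd: "e * P dvd ?m + 1" by (simp only: of_nat_dvd_iff)
    interpret hecke_row_shift scale n q T lam mu a \<gamma>
    proof unfold_locales
      show "gauss_sum q Q k = 0" if "finite Q" "1 \<le> k" "k \<le> \<gamma>" "card Q = ?m + k" for Q k
        using that small by (intro gauss_sum_eq_0[OF assms(4,3) P dvd]) auto
    qed (use assms lam_eq \<gamma>_le in auto)
    show ?thesis by (rule hom_dim_specht)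
  qed
  show ?thesis
  proof (intro conjI impI)
    assume "p = 0" and h: "[int (mu a) - int (mu (a + 1)) + int \<gamma> = - 1] (mod int e) \<and> \<gamma> < e"
    then show "hom_dim (specht lam) (specht mu) \<ge> 1" using hom[of 1] by simp
  next
    assume p: "p > 0" and h: "[int (mu a) - int (mu (a + 1)) + int \<gamma> = - 1]
      (mod int (e * p ^ ell_p p (\<gamma> div e)))"
    have pr: "prime CHAR('f)" using p assms(2) prime_CHAR_semidom[where ?'a = 'f] by simp
    then have "1 < p" unfolding assms(2) by (rule prime_gt_1_nat)
    then have "\<gamma> div e < p ^ (\<gamma> div e)" using power_gt_expt[of p "\<gamma> div e"] by simp
    then have "\<exists>k. \<gamma> div e < p ^ k" by blast
    then have "\<gamma> div e < p ^ ell_p p (\<gamma> div e)" unfolding ell_p_def by (rule LeastI_ex)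
    moreover have "0 < e" using assms(4) by (simp add: is_quantum_char_def)
    ultimately have small: "\<gamma> < e * p ^ ell_p p (\<gamma> div e)"
      using div_less_iff_less_mult by (simp only: mult.commute)
    show "hom_dim (specht lam) (specht mu) \<ge> 1"
    proof (rule hom[OF _ small h])
      show "p ^ ell_p p (\<gamma> div e) = 1 \<or>
          prime CHAR('f) \<and> p ^ ell_p p (\<gamma> div e) = CHAR('f) ^ ell_p p (\<gamma> div e)"
        using pr assms(2) by simp
    qed
  qed
qed

end
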